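(* Suppose assumptions O1–O7, P1, F1 and F2 listed in the context hold and that $\limsup p/n<1$. Let $$ \widehat\beta=\operatorname{argmin}_{\beta\in\mathbb{R}^p}\frac1n\sum_{i=1}^n\rho(\varepsilon_i-X_i^\top\beta),\qquad \widehat\beta_\tau=\operatorname{argmin}_{\beta\in\mathbb{R}^p}\left\{\frac1n\sum_{i=1}^n\rho(\varepsilon_i-X_i^\top\beta)+\frac{\tau}{2}\|\beta\|^2\right\}\quad(\tau>0). $$ If $\rho$ is strongly convex, then $\|\widehat\beta_\tau-\widehat\beta\|$ tends to $0$ in probability as $\tau\to0$, asymptotically in $n$: for every $\delta>0$, $\lim_{\tau\to0}\limsup_{n\to\infty}P(\|\widehat\beta_\tau-\widehat\beta\|>\delta)=0$. Hence $\|\widehat\beta\|$ is asymptotically deterministic and can be computed as the limit of $\|\widehat\beta_\tau\|$ as $\tau\to0$: denoting by $r_\tau$ the deterministic limit in probability of $\|\widehat\beta_\tau\|$ as $n\to\infty$ (for fixed $\tau>0$), the limit $\lim_{\tau\to0}r_\tau$ exists and $\|\widehat\beta\|\to\lim_{\tau\to0}r_\tau$ in probability as $n\to\infty$.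
   Context: For each $n$, $p=p_n$, $X_1,\dots,X_n$ are random vectors in $\mathbb{R}^p$ (whose law may depend on $n$), $\varepsilon_1,\dots,\varepsilon_n$ are real random variables, and $\rho:\mathbb{R}\to\mathbb{R}$ is a fixed function with $\psi=\rho'$. $\|\cdot\|$ is the Euclidean norm. When $\rho$ is strongly convex, $\widehat\beta$ is unique whenever the design matrix with rows $X_i^\top$ has full column rank. It is part of the setting (a result of the paper) that for fixed $\tau>0$, under these assumptions, $\|\widehat\beta_\tau\|$ converges in probability to a deterministic limit. Assumptions. (O1) $p/n$ has a finite non-zero limit. (O2) $\rho$ is twice differentiable, convex and non-linear, $\rho\ge0$, $\rho(0)=0$ (so $\psi'\ge0$ and $x\psi(x)\ge0$). (O3) $\psi(|x|)=O(|x|^m)$ as $|x|\to\infty$ for some $m$; $\psi'$ is $L(u)$-Lipschitz on $(-|u|,|u|)$, where $L(|u|)\le K|u|^{m_1}$ as $|u|\to\infty$, for some constants $K,m_1$. (O4) The $X_i$'s are i.i.d. with mean $0$ and covariance $\mathrm{Id}_p$, and for every convex 1-Lipschitz $F:\mathbb{R}^p\to\mathbb{R}$ and $t>0$, $P(|F(X_i)-m_F|>t)\le C_n\exp(-c_nt^2)$, where $m_F$ is the mean or median of $F(X_i)$, $C_n$ is bounded in $n$ and $1/c_n=O((\log n)^\alpha)$ for some $\alpha\ge0$. (O5) $\{X_i\}_{i=1}^n$ is independent of $\{\varepsilon_i\}_{i=1}^n$. (O6) For any fixed $k$, $\frac1n\sum_{i=1}^n\mathbf{E}(\psi^{2k}(\varepsilon_i))$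 is uniformly bounded in $n,p$. (O7) The $\varepsilon_i$'s are independent and $\mathcal{E}_n=\sup_{1\le i\le n}|\varepsilon_i|=O((\log n)^b)$ in $L_k$ for every fixed $k$, for some $b$. (P1) Each $X_i$ has i.i.d. entries. (F1) The $\varepsilon_i$'s have identical distribution, and for any $r>0$, if $Z\sim\mathcal N(0,1)$ is independent of $\varepsilon_i$, $\varepsilon_i+rZ$ has a density $f$ which is increasing on $(-\infty,0)$ and decreasing on $(0,\infty)$, with $\lim_{|t|\to\infty}tf(t)=0$. (F2) For any fixed $k$, $\mathbf{E}(|\varepsilon_i|^k)<\infty$. *)

theory Defs
  imports "HOL-Probability.Probability" "HOL-Library.Landau_Symbols"
begin

(* The dimension p varies with n, so R^p is rendered as the functions on {..<p} that are
   undefined elsewhere; vec_borel p is R^p with its Borel sigma-algebra. The data for sample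
   size n live on their own probability space M n and are indexed by {..<n} instead of
   {1..n}. *)

abbreviation vecs :: "nat \<Rightarrow> (nat \<Rightarrow> real) set" where
  "vecs p \<equiv> {..<p} \<rightarrow>\<^sub>E UNIV"

abbreviation vec_borel :: "nat \<Rightarrow> (nat \<Rightarrow> real) measure" where
  "vec_borel p \<equiv> Pi\<^sub>M {..<p} (\<lambda>_. borel)"

abbreviation vnorm :: "nat \<Rightarrow> (nat \<Rightarrow> real) \<Rightarrow> real" where
  "vnorm p v \<equiv> L2_set v {..<p}"

definition vec_convex :: "nat \<Rightarrow> ((nat \<Rightarrow> real) \<Rightarrow> real) \<Rightarrow> bool" where
  "vec_convex p F \<longleftrightarrow>
     (\<forall>x\<in>vecs p. \<forall>y\<in>vecs p. \<forall>u\<ge>0. \<forall>v\<ge>0. u + v = 1 \<longrightarrow>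
        F (\<lambda>j\<in>{..<p}. u * x j + v * y j) \<le> u * F x + v * F y)"

definition vec_1_lipschitz :: "nat \<Rightarrow> ((nat \<Rightarrow> real) \<Rightarrow> real) \<Rightarrow> bool" where
  "vec_1_lipschitz p F \<longleftrightarrow>
     (\<forall>x\<in>vecs p. \<forall>y\<in>vecs p. \<bar>F x - F y\<bar> \<le> vnorm p (\<lambda>j. x j - y j))"

definition strongly_convex :: "(real \<Rightarrow> real) \<Rightarrow> bool" where
  "strongly_convex f \<longleftrightarrow>
     (\<exists>c>0. \<forall>x y. \<forall>u\<ge>0. \<forall>v\<ge>0. u + v = 1 \<longrightarrow>
        f (u * x + v * y) \<le> u * f x + v * f y - c / 2 * u * v * (x - y)\<^sup>2)"

definition identically_distributed ::
  "'a measure \<Rightarrow> 'b measure \<Rightarrow> ('i \<Rightarrow> 'a \<Rightarrow> 'b) \<Rightarrow> 'i set \<Rightarrow> bool" where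
  "identically_distributed M N Y I \<longleftrightarrow> (\<forall>i\<in>I. \<forall>j\<in>I. distr M N (Y i) = distr M N (Y j))"

definition expect :: "'a measure \<Rightarrow> ('a \<Rightarrow> real) \<Rightarrow> real" where
  "expect M Y = (\<integral>\<omega>. Y \<omega> \<partial>M)"

definition covariance :: "'a measure \<Rightarrow> ('a \<Rightarrow> real) \<Rightarrow> ('a \<Rightarrow> real) \<Rightarrow> real" where
  "covariance M Y Z = expect M (\<lambda>\<omega>. (Y \<omega> - expect M Y) * (Z \<omega> - expect M Z))"

definition is_median :: "'a measure \<Rightarrow> ('a \<Rightarrow> real) \<Rightarrow> real \<Rightarrow> bool" where
  "is_median M Y m \<longleftrightarrow>
     measure M {\<omega>\<in>space M. Y \<omega> \<le> m} \<ge> 1 / 2 \<and> measure M {\<omega>\<in>space M. Y \<omega> \<ge> m} \<ge> 1 / 2"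

definition tendsto_in_prob ::
  "(nat \<Rightarrow> 'a measure) \<Rightarrow> (nat \<Rightarrow> 'a \<Rightarrow> real) \<Rightarrow> real \<Rightarrow> bool" where
  "tendsto_in_prob M Y L \<longleftrightarrow>
     (\<forall>\<delta>>0. (\<lambda>n. measure (M n) {\<omega>\<in>space (M n). \<bar>Y n \<omega> - L\<bar> > \<delta>}) \<longlonglongrightarrow> 0)"

definition proportional_dimension :: "(nat \<Rightarrow> nat) \<Rightarrow> bool" where
  "proportional_dimension p \<longleftrightarrow> (\<exists>\<kappa>. \<kappa> \<noteq> 0 \<and> (\<lambda>n. real (p n) / real n) \<longlonglongrightarrow> \<kappa>)"

(* As rho 0 = 0, affine is the same as linear here. *)
definition smooth_convex_loss :: "(real \<Rightarrow> real) \<Rightarrow> bool" where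
  "smooth_convex_loss \<rho> \<longleftrightarrow>
     (\<forall>x. \<rho> differentiable (at x)) \<and> (\<forall>x. deriv \<rho> differentiable (at x)) \<and>
     convex_on UNIV \<rho> \<and> \<not> linear \<rho> \<and> (\<forall>x. \<rho> x \<ge> 0) \<and> \<rho> 0 = 0"

definition polynomial_growth_loss :: "(real \<Rightarrow> real) \<Rightarrow> bool" where
  "polynomial_growth_loss \<rho> \<longleftrightarrow>
     (\<exists>m::real. (\<lambda>x. deriv \<rho> \<bar>x\<bar>) \<in> O[at_infinity](\<lambda>x. \<bar>x\<bar> powr m)) \<and>
     (\<exists>(L::real \<Rightarrow> real) (K::real) (m\<^sub>1::real).
        (\<forall>u. lipschitz_on (L u) {-\<bar>u\<bar><..<\<bar>u\<bar>} (deriv (deriv \<rho>))) \<and>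
        (\<forall>\<^sub>F u in at_infinity. L \<bar>u\<bar> \<le> K * \<bar>u\<bar> powr m\<^sub>1))"

definition iid_isotropic_design ::
  "(nat \<Rightarrow> 'a measure) \<Rightarrow> (nat \<Rightarrow> nat) \<Rightarrow> (nat \<Rightarrow> nat \<Rightarrow> 'a \<Rightarrow> nat \<Rightarrow> real) \<Rightarrow> bool" where
  "iid_isotropic_design M p X \<longleftrightarrow>
     (\<forall>n. prob_space.indep_vars (M n) (\<lambda>_. vec_borel (p n)) (X n) {..<n} \<and>
          identically_distributed (M n) (vec_borel (p n)) (X n) {..<n} \<and>
          (\<forall>i<n. \<forall>j<p n.
             integrable (M n) (\<lambda>\<omega>. (X n i \<omega> j)\<^sup>2) \<and>
             expect (M n) (\<lambda>\<omega>. X n i \<omega> j) = 0 \<and>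
             (\<forall>k<p n. covariance (M n) (\<lambda>\<omega>. X n i \<omega> j) (\<lambda>\<omega>. X n i \<omega> k)
                        = (if j = k then 1 else 0))))"

(* For each F the centring m may be the mean or a median; only one of them has to work. *)
definition convex_concentration ::
  "(nat \<Rightarrow> 'a measure) \<Rightarrow> (nat \<Rightarrow> nat) \<Rightarrow> (nat \<Rightarrow> nat \<Rightarrow> 'a \<Rightarrow> nat \<Rightarrow> real) \<Rightarrow> bool" where
  "convex_concentration M p X \<longleftrightarrow>
     (\<exists>(C::nat \<Rightarrow> real) (c::nat \<Rightarrow> real) (\<alpha>::real).
        \<alpha> \<ge> 0 \<and> Bseq C \<and> (\<forall>n. c n > 0) \<and> (\<lambda>n. 1 / c n) \<in> O(\<lambda>n. ln (real n) powr \<alpha>) \<and>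
        (\<forall>n. \<forall>i<n. \<forall>F. vec_convex (p n) F \<and> vec_1_lipschitz (p n) F \<longrightarrow>
           (\<exists>m. (m = expect (M n) (\<lambda>\<omega>. F (X n i \<omega>)) \<or> is_median (M n) (\<lambda>\<omega>. F (X n i \<omega>)) m) \<and>
                (\<forall>t>0. measure (M n) {\<omega>\<in>space (M n). \<bar>F (X n i \<omega>) - m\<bar> > t}
                        \<le> C n * exp (- c n * t\<^sup>2)))))"

(* Independence of the two families is independence of the sigma-algebras they generate: the
   library's indep_var needs both variables to have the same type. *)
definition design_indep_errors ::
  "(nat \<Rightarrow> 'a measure) \<Rightarrow> (nat \<Rightarrow> nat) \<Rightarrow> (nat \<Rightarrow> nat \<Rightarrow> 'a \<Rightarrow> nat \<Rightarrow> real) \<Rightarrow>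
   (nat \<Rightarrow> nat \<Rightarrow> 'a \<Rightarrow> real) \<Rightarrow> bool" where
  "design_indep_errors M p X \<epsilon> \<longleftrightarrow>
     (\<forall>n. prob_space.indep_set (M n)
            {(\<lambda>\<omega>. \<lambda>i\<in>{..<n}. X n i \<omega>) -` A \<inter> space (M n) | A.
               A \<in> sets (Pi\<^sub>M {..<n} (\<lambda>_. vec_borel (p n)))}
            {(\<lambda>\<omega>. \<lambda>i\<in>{..<n}. \<epsilon> n i \<omega>) -` B \<inter> space (M n) | B.
               B \<in> sets (Pi\<^sub>M {..<n} (\<lambda>_. borel))})"

definition bounded_score_moments ::
  "(nat \<Rightarrow> 'a measure) \<Rightarrow> (real \<Rightarrow> real) \<Rightarrow> (nat \<Rightarrow> nat \<Rightarrow> 'a \<Rightarrow> real) \<Rightarrow> bool" where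
  "bounded_score_moments M \<rho> \<epsilon> \<longleftrightarrow>
     (\<forall>k::nat. \<exists>B::real. \<forall>n.
        (\<forall>i<n. integrable (M n) (\<lambda>\<omega>. deriv \<rho> (\<epsilon> n i \<omega>) ^ (2 * k))) \<and>
        1 / real n * (\<Sum>i<n. expect (M n) (\<lambda>\<omega>. deriv \<rho> (\<epsilon> n i \<omega>) ^ (2 * k))) \<le> B)"

definition max_abs_error :: "(nat \<Rightarrow> nat \<Rightarrow> 'a \<Rightarrow> real) \<Rightarrow> nat \<Rightarrow> 'a \<Rightarrow> real" where
  "max_abs_error \<epsilon> n \<omega> = (MAX i\<in>{..<n}. \<bar>\<epsilon> n i \<omega>\<bar>)"

definition indep_errors_polylog ::
  "(nat \<Rightarrow> 'a measure) \<Rightarrow> (nat \<Rightarrow> nat \<Rightarrow> 'a \<Rightarrow> real) \<Rightarrow> bool" where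
  "indep_errors_polylog M \<epsilon> \<longleftrightarrow>
     (\<forall>n. prob_space.indep_vars (M n) (\<lambda>_. borel) (\<epsilon> n) {..<n}) \<and>
     (\<exists>b::real. \<forall>k\<ge>(1::nat).
        (\<forall>n\<ge>1. integrable (M n) (\<lambda>\<omega>. max_abs_error \<epsilon> n \<omega> ^ k)) \<and>
        (\<lambda>n. root k (expect (M n) (\<lambda>\<omega>. max_abs_error \<epsilon> n \<omega> ^ k)))
          \<in> O(\<lambda>n. ln (real n) powr b))"

definition iid_entries ::
  "(nat \<Rightarrow> 'a measure) \<Rightarrow> (nat \<Rightarrow> nat) \<Rightarrow> (nat \<Rightarrow> nat \<Rightarrow> 'a \<Rightarrow> nat \<Rightarrow> real) \<Rightarrow> bool" where
  "iid_entries M p X \<longleftrightarrow>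
     (\<forall>n. \<forall>i<n. prob_space.indep_vars (M n) (\<lambda>_. borel) (\<lambda>j \<omega>. X n i \<omega> j) {..<p n} \<and>
                 identically_distributed (M n) borel (\<lambda>j \<omega>. X n i \<omega> j) {..<p n})"

(* The independent Z with law N(0,1) is the second coordinate of the product of M n with the
   standard normal law, since M n itself need not carry such a variable. *)
definition smoothed_unimodal_errors ::
  "(nat \<Rightarrow> 'a measure) \<Rightarrow> (nat \<Rightarrow> nat \<Rightarrow> 'a \<Rightarrow> real) \<Rightarrow> bool" where
  "smoothed_unimodal_errors M \<epsilon> \<longleftrightarrow>
     (\<forall>n. identically_distributed (M n) borel (\<epsilon> n) {..<n} \<and>
        (\<forall>i<n. \<forall>r>0. \<exists>f::real \<Rightarrow> real. (\<forall>t. f t \<ge> 0) \<and>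
           distributed (M n \<Otimes>\<^sub>M density lborel std_normal_density) lborel
             (\<lambda>(\<omega>, z). \<epsilon> n i \<omega> + r * z) (\<lambda>t. ennreal (f t)) \<and>
           mono_on {..<0} f \<and> antimono_on {0<..} f \<and>
           ((\<lambda>t. t * f t) \<longlongrightarrow> 0) at_infinity))"

definition error_moments ::
  "(nat \<Rightarrow> 'a measure) \<Rightarrow> (nat \<Rightarrow> nat \<Rightarrow> 'a \<Rightarrow> real) \<Rightarrow> bool" where
  "error_moments M \<epsilon> \<longleftrightarrow>
     (\<forall>n. \<forall>i<n. \<forall>k::nat. integrable (M n) (\<lambda>\<omega>. \<bar>\<epsilon> n i \<omega>\<bar> ^ k))"

definition emp_risk ::
  "(real \<Rightarrow> real) \<Rightarrow> (nat \<Rightarrow> nat) \<Rightarrow> (nat \<Rightarrow> nat \<Rightarrow> 'a \<Rightarrow> nat \<Rightarrow> real) \<Rightarrow>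
   (nat \<Rightarrow> nat \<Rightarrow> 'a \<Rightarrow> real) \<Rightarrow> nat \<Rightarrow> 'a \<Rightarrow> (nat \<Rightarrow> real) \<Rightarrow> real" where
  "emp_risk \<rho> p X \<epsilon> n \<omega> \<beta> =
     1 / real n * (\<Sum>i<n. \<rho> (\<epsilon> n i \<omega> - (\<Sum>j<p n. X n i \<omega> j * \<beta> j)))"

definition ridge_risk ::
  "(real \<Rightarrow> real) \<Rightarrow> (nat \<Rightarrow> nat) \<Rightarrow> (nat \<Rightarrow> nat \<Rightarrow> 'a \<Rightarrow> nat \<Rightarrow> real) \<Rightarrow>
   (nat \<Rightarrow> nat \<Rightarrow> 'a \<Rightarrow> real) \<Rightarrow> real \<Rightarrow> nat \<Rightarrow> 'a \<Rightarrow> (nat \<Rightarrow> real) \<Rightarrow> real" where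
  "ridge_risk \<rho> p X \<epsilon> \<tau> n \<omega> \<beta> = emp_risk \<rho> p X \<epsilon> n \<omega> \<beta> + \<tau> / 2 * (vnorm (p n) \<beta>)\<^sup>2"

(* b is a version of the argmin over R^p of the random objective Q: a random vector that
   minimises Q at every sample point. Where the minimiser is not unique (possible for the
   unpenalised risk if the design does not have full column rank) any measurable selection is
   allowed. *)
definition argmin_estimator ::
  "(nat \<Rightarrow> 'a measure) \<Rightarrow> (nat \<Rightarrow> nat) \<Rightarrow> (nat \<Rightarrow> 'a \<Rightarrow> (nat \<Rightarrow> real) \<Rightarrow> real) \<Rightarrow>
   (nat \<Rightarrow> 'a \<Rightarrow> nat \<Rightarrow> real) \<Rightarrow> bool" where
  "argmin_estimator M p Q b \<longleftrightarrow>
     (\<forall>n. b n \<in> measurable (M n) (vec_borel (p n)) \<and>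
          (\<forall>\<omega>\<in>space (M n). is_arg_min (Q n \<omega>) (\<lambda>\<beta>. \<beta> \<in> vecs (p n)) (b n \<omega>)))"

end

theory Submission
  imports Defs "HOL-Real_Asymp.Real_Asymp"
begin

text \<open>Compare the unpenalised and the penalised risk at the two estimators. Strong convexity of \<open>\<rho>\<close>
  gives \<open>|X (\<beta>\<^sub>\<tau> - \<beta>)|\<^sup>2 / n = O(\<tau> |\<beta>|\<^sup>2)\<close> and \<open>|X \<beta>|\<^sup>2 / n = O(1/n \<Sum> \<rho>(\<epsilon>\<^sub>i))\<close>, and the last average
  is bounded in mean because \<open>\<rho> = O(\<psi>\<^sup>2)\<close>. Hence everything follows from a lower bound \<open>|X v|\<^sup>2 \<ge> \<mu> n |v|\<^sup>2\<close>
  which holds for all \<open>v\<close> with probability tending to \<open>1\<close>.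

  Split the columns into finitely many blocks of \<open>\<eta> n\<close> columns; it suffices to bound the distance of
  \<open>X v\<close> to the span of the columns outside a block by the part of \<open>v\<close> inside the block. Project onto the
  orthogonal complement of the outside columns, then add the columns of the block one at a time. The
  symmetric matrix \<open>I - R\<close> represents the partial minimum over \<open>v\<close> of \<open>|z - X v|\<^sup>2 - l |v|\<^sup>2\<close>; a new column is a
  rank-one update, possible as long as its Schur complement is positive, and \<open>l\<close> is lowered a little
  after each update. As the new column is independent of \<open>R\<close> and quadratic forms in it concentrate
  around their mean (here the entries only need eighth moments of slow growth), the traces of \<open>R\<close> and
  \<open>R\<^sup>2\<close> stay under control, which is expressed by a supermartingale argument.\<close>

subsection \<open>Fourth moments of quadratic forms\<close>

text \<open>The Schur complement of a new column has mean \<open>n - tr1 n R - l\<close>, so the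
  trace of \<open>R\<close> has to stay below \<open>n\<close> by a fixed multiple of
  \<open>r\<close>. Projecting out a column costs at most 1 of trace, which is affordable for up to
  \<open>n - r\<close> columns but yields no quantitative bound. The regularised update yields one,
  but is charged \<open>D\<close> of trace, and \<open>D \<ge> 128\<close> since
  \<open>r \<le> n\<close>. A budget of \<open>r / 8\<close> therefore pays for
  \<open>r / (8 * D)\<close> columns only. This forces the mixture of the two: the block is
  regularised, everything else is projected out beforehand.

  Of order \<open>n\<close> columns have to succeed, so a single failure must have probability
  \<open>o(1/n)\<close>. Chebyshev's inequality for the Schur complement gives order
  \<open>1/n\<close> at best; the fourth moment of the quadratic form suffices, and this is where
  eighth moments of the entries come in.

  The fluctuations are governed by the trace of \<open>R^2\<close>, whose expected growth under the
  rank-one update contains the trace of \<open>R^3\<close>, for which the bound on the trace of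
  \<open>R^2\<close> is too weak. Lowering \<open>l\<close> produces a negative multiple of the same
  trace, and \<open>h\<close> is chosen large enough for it to win.\<close>

lemma abs_mult_powers_le:
  fixes x y :: real
  shows "\<bar>x ^ 3 * y\<bar> \<le> x ^ 4 + y ^ 4" "\<bar>x ^ 2 * y ^ 2\<bar> \<le> x ^ 4 + y ^ 4"
    "\<bar>x * y ^ 3\<bar> \<le> (x ^ 2 * y ^ 2 + y ^ 4) / 2" "\<bar>x * y ^ 3\<bar> \<le> x ^ 4 + y ^ 4"
proof -
  have sq: "2 * u * v \<le> u ^ 2 + v ^ 2" for u v :: real
    using sum_squares_bound[of u v] by simp
  show 2: "\<bar>x ^ 2 * y ^ 2\<bar> \<le> x ^ 4 + y ^ 4"
  proof -
    have "2 * (x ^ 2) * (y ^ 2) \<le> (x ^ 2) ^ 2 + (y ^ 2) ^ 2" by (rule sq)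
    then have "2 * (x\<^sup>2 * y\<^sup>2) \<le> x ^ 4 + y ^ 4" by (simp add: power_mult[symmetric] mult.assoc)
    moreover have "0 \<le> x ^ 2 * y ^ 2" by simp
    ultimately show ?thesis by linarith
  qed
  have gen: "\<bar>u * v ^ 3\<bar> \<le> (u ^ 2 * v ^ 2 + v ^ 4) / 2" for u v :: real
  proof -
    have "2 * \<bar>u * v\<bar> * (v ^ 2) \<le> \<bar>u * v\<bar> ^ 2 + (v ^ 2) ^ 2" by (rule sq)
    moreover have "\<bar>u * v\<bar> * v ^ 2 = \<bar>u * v ^ 3\<bar>"
      by (simp add: abs_mult power2_eq_square power3_eq_cube)
    ultimately show ?thesis by (simp add: power_mult[symmetric] power_mult_distrib)
  qed
  show 3: "\<bar>x * y ^ 3\<bar> \<le> (x ^ 2 * y ^ 2 + y ^ 4) / 2" by (rule gen)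
  have nn: "0 \<le> x ^ 4" "0 \<le> y ^ 4" by simp_all
  have 2: "x ^ 2 * y ^ 2 \<le> x ^ 4 + y ^ 4" using 2 by simp
  have c: "2 * \<bar>x * y ^ 3\<bar> \<le> x ^ 2 * y ^ 2 + y ^ 4" using 3 by simp
  show "\<bar>x * y ^ 3\<bar> \<le> x ^ 4 + y ^ 4" using 2 c nn by linarith
  have "\<bar>y * x ^ 3\<bar> \<le> (y ^ 2 * x ^ 2 + x ^ 4) / 2" by (rule gen)
  then have "2 * \<bar>x ^ 3 * y\<bar> \<le> x ^ 2 * y ^ 2 + x ^ 4" by (simp add: mult.commute)
  then show "\<bar>x ^ 3 * y\<bar> \<le> x ^ 4 + y ^ 4" using 2 nn by linarith
qed

text \<open>The common source of the Cauchy-Schwarz inequalities below: for moments, for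
  \<open>dot\<close>, for the form of a positive semidefinite matrix and for traces. For
  \<open>c < 0\<close> the values at \<open>t\<close> and \<open>-t\<close> are added, which cancels
  the linear term.\<close>

lemma discriminant_le:
  fixes a b c :: real
  assumes "\<And>t. 0 \<le> a + 2 * t * b + t\<^sup>2 * c"
  shows "b\<^sup>2 \<le> a * c"
proof (cases "c = 0")
  case True
  have "b = 0"
  proof (rule ccontr)
    assume "b \<noteq> 0"
    then show False using assms[of "- (a + 1) / (2 * b)"] True by (simp add: field_simps)
  qed
  then show ?thesis using True by simp
next
  case False
  have c: "0 < c"
  proof (rule ccontr)
    assume "\<not> 0 < c"
    then have c: "c < 0" using False by simp
    have "0 \<le> a" using assms[of 0] by simp
    define t where "t = (1 + a + \<bar>b\<bar>) / -c + 1"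
    have t: "t \<ge> 1" "t * (-c) \<ge> 1 + a + \<bar>b\<bar>" using c \<open>0 \<le> a\<close> by (auto simp: t_def field_simps)
    have 1: "0 \<le> a + 2 * t * b + t\<^sup>2 * c" "0 \<le> a + 2 * (-t) * b + (-t)\<^sup>2 * c" by (rule assms)+
    then have "0 \<le> a + t\<^sup>2 * c" by simp
    moreover have "t * (t * (-c)) \<ge> 1 * (1 + a + \<bar>b\<bar>)" using t \<open>0 \<le> a\<close> by (intro mult_mono) auto
    ultimately show False by (simp add: power2_eq_square)
  qed
  have "0 \<le> a + 2 * (- b / c) * b + (- b / c)\<^sup>2 * c" by (rule assms)
  also have "\<dots> = a - b\<^sup>2 / c" using c by (simp add: power2_eq_square field_simps)
  finally show ?thesis using c by (simp add: field_simps)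
qed

text \<open>\<open>orth\<close> removes the only term of the expansion that is linear in
  \<open>D\<close>. The rest is at most \<open>a^2 + 8 a d + 3 d^2\<close>, and \<open>8 a d\<close>
  is the cross term of \<open>(a + 4 d)^2\<close>. So the bound on the square root of the fourth
  moment grows by \<open>4 d\<close>, which makes it additive along a martingale.\<close>

lemma (in prob_space) fourth_moment_add:
  fixes f D :: "'a \<Rightarrow> real"
  assumes [measurable]: "f \<in> borel_measurable M" "D \<in> borel_measurable M"
    and f4: "integrable M (\<lambda>\<omega>. f \<omega> ^ 4)" and D4: "integrable M (\<lambda>\<omega>. D \<omega> ^ 4)"
    and orth: "expectation (\<lambda>\<omega>. f \<omega> ^ 3 * D \<omega>) = 0"
    and a: "0 \<le> a" "expectation (\<lambda>\<omega>. f \<omega> ^ 4) \<le> a\<^sup>2"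
    and d: "0 \<le> d" "expectation (\<lambda>\<omega>. D \<omega> ^ 4) \<le> d\<^sup>2"
  shows "integrable M (\<lambda>\<omega>. (f \<omega> + D \<omega>) ^ 4)"
    and "expectation (\<lambda>\<omega>. (f \<omega> + D \<omega>) ^ 4) \<le> (a + 4 * d)\<^sup>2"
proof -
  have i: "integrable M (\<lambda>\<omega>. f \<omega> ^ 4 + D \<omega> ^ 4)" using f4 D4 by simp
  have i31: "integrable M (\<lambda>\<omega>. f \<omega> ^ 3 * D \<omega>)"
    by (rule Bochner_Integration.integrable_bound[OF i]) (use abs_mult_powers_le(1) in auto)
  have i22: "integrable M (\<lambda>\<omega>. f \<omega> ^ 2 * D \<omega> ^ 2)"
    by (rule Bochner_Integration.integrable_bound[OF i]) (use abs_mult_powers_le(2) in auto)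
  have i13: "integrable M (\<lambda>\<omega>. f \<omega> * D \<omega> ^ 3)"
    by (rule Bochner_Integration.integrable_bound[OF i]) (use abs_mult_powers_le(4) in auto)
  have expand: "(f \<omega> + D \<omega>) ^ 4 = f \<omega> ^ 4 + 4 * (f \<omega> ^ 3 * D \<omega>) + 6 * (f \<omega> ^ 2 * D \<omega> ^ 2)
      + 4 * (f \<omega> * D \<omega> ^ 3) + D \<omega> ^ 4" for \<omega>
    by (simp add: eval_nat_numeral algebra_simps)
  show "integrable M (\<lambda>\<omega>. (f \<omega> + D \<omega>) ^ 4)"
    unfolding expand using f4 D4 i31 i22 i13 by simp
  have "(expectation (\<lambda>\<omega>. f \<omega> ^ 2 * D \<omega> ^ 2))\<^sup>2 \<le>
      expectation (\<lambda>\<omega>. f \<omega> ^ 4) * expectation (\<lambda>\<omega>. D \<omega> ^ 4)"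
  proof (rule discriminant_le)
    fix t
    have "0 \<le> expectation (\<lambda>\<omega>. (f \<omega> ^ 2 + t * D \<omega> ^ 2)\<^sup>2)" by simp
    also have "(\<lambda>\<omega>. (f \<omega> ^ 2 + t * D \<omega> ^ 2)\<^sup>2) =
        (\<lambda>\<omega>. f \<omega> ^ 4 + 2 * t * (f \<omega> ^ 2 * D \<omega> ^ 2) + t\<^sup>2 * D \<omega> ^ 4)"
      by (rule ext) (simp add: power2_sum power_mult_distrib power_mult[symmetric])
    finally show "0 \<le> expectation (\<lambda>\<omega>. f \<omega> ^ 4) + 2 * t * expectation (\<lambda>\<omega>. f \<omega> ^ 2 * D \<omega> ^ 2)
        + t\<^sup>2 * expectation (\<lambda>\<omega>. D \<omega> ^ 4)"
      using f4 D4 i22 by (simp add: mult.assoc)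
  qed
  also have "\<dots> \<le> a\<^sup>2 * d\<^sup>2" by (intro mult_mono a(2) d(2)) simp_all
  finally have "(expectation (\<lambda>\<omega>. f \<omega> ^ 2 * D \<omega> ^ 2))\<^sup>2 \<le> (a * d)\<^sup>2"
    by (simp only: power_mult_distrib)
  then have m22: "expectation (\<lambda>\<omega>. f \<omega> ^ 2 * D \<omega> ^ 2) \<le> a * d"
    by (rule power2_le_imp_le) (simp add: a(1) d(1))
  have "expectation (\<lambda>\<omega>. f \<omega> * D \<omega> ^ 3) \<le> expectation (\<lambda>\<omega>. (f \<omega> ^ 2 * D \<omega> ^ 2 + D \<omega> ^ 4) / 2)"
    by (rule integral_mono)
      (use i13 i22 D4 order.trans[OF abs_ge_self abs_mult_powers_le(3)] in auto)
  also have "\<dots> = (expectation (\<lambda>\<omega>. f \<omega> ^ 2 * D \<omega> ^ 2) + expectation (\<lambda>\<omega>. D \<omega> ^ 4)) / 2"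
    using i22 D4 by simp
  also have "\<dots> \<le> (a * d + d\<^sup>2) / 2" using m22 d by simp
  finally have m13: "expectation (\<lambda>\<omega>. f \<omega> * D \<omega> ^ 3) \<le> (a * d + d\<^sup>2) / 2" .
  have "expectation (\<lambda>\<omega>. (f \<omega> + D \<omega>) ^ 4) = expectation (\<lambda>\<omega>. f \<omega> ^ 4)
      + 6 * expectation (\<lambda>\<omega>. f \<omega> ^ 2 * D \<omega> ^ 2) + 4 * expectation (\<lambda>\<omega>. f \<omega> * D \<omega> ^ 3)
      + expectation (\<lambda>\<omega>. D \<omega> ^ 4)"
    unfolding expand using f4 D4 i31 i22 i13 orth by simp
  also have "\<dots> \<le> a\<^sup>2 + 6 * (a * d) + 4 * ((a * d + d\<^sup>2) / 2) + d\<^sup>2"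
    using m22 m13 a d by linarith
  also have "\<dots> \<le> (a + 4 * d)\<^sup>2"
    using a d by (simp add: power2_eq_square algebra_simps)
  finally show "expectation (\<lambda>\<omega>. (f \<omega> + D \<omega>) ^ 4) \<le> (a + 4 * d)\<^sup>2" .
qed

lemma (in prob_space) integrable_lower_power:
  fixes f :: "'a \<Rightarrow> real"
  assumes "f \<in> borel_measurable M" "integrable M (\<lambda>\<omega>. f \<omega> ^ m)" "even m" "k \<le> m"
  shows "integrable M (\<lambda>\<omega>. f \<omega> ^ k)"
proof (rule Bochner_Integration.integrable_bound[of M "\<lambda>\<omega>. 1 + f \<omega> ^ m"])
  show "integrable M (\<lambda>\<omega>. 1 + f \<omega> ^ m)" using assms by simp
  show "(\<lambda>\<omega>. f \<omega> ^ k) \<in> borel_measurable M" using assms by measurable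
  have "\<bar>x\<bar> ^ k \<le> 1 + \<bar>x\<bar> ^ m" for x :: real
  proof (cases "\<bar>x\<bar> \<le> 1")
    case True
    then have "\<bar>x\<bar> ^ k \<le> 1" by (simp add: power_le_one)
    then show ?thesis by (simp add: add_increasing2)
  next
    case False
    then have "\<bar>x\<bar> ^ k \<le> \<bar>x\<bar> ^ m" using assms(4) by (intro power_increasing) auto
    then show ?thesis by simp
  qed
  then have "\<bar>x ^ k\<bar> \<le> 1 + x ^ m" for x :: real
    using assms(3) by (simp add: power_abs power_even_abs)
  then show "AE \<omega> in M. norm (f \<omega> ^ k) \<le> norm (1 + f \<omega> ^ m)"
    using assms(3) by (intro AE_I2) (auto simp: zero_le_even_power intro: order.trans)
qed

lemma (in prob_space) second_moment_le_fourth: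
  fixes f :: "'a \<Rightarrow> real"
  assumes "integrable M (\<lambda>\<omega>. f \<omega> ^ 2)" "integrable M (\<lambda>\<omega>. f \<omega> ^ 4)"
    "0 \<le> c" "expectation (\<lambda>\<omega>. f \<omega> ^ 4) \<le> c\<^sup>2"
  shows "expectation (\<lambda>\<omega>. f \<omega> ^ 2) \<le> c"
proof -
  define e where "e = expectation (\<lambda>\<omega>. f \<omega> ^ 2)"
  have "0 \<le> expectation (\<lambda>\<omega>. (f \<omega> ^ 2 - e)\<^sup>2)" by simp
  also have "(\<lambda>\<omega>. (f \<omega> ^ 2 - e)\<^sup>2) = (\<lambda>\<omega>. f \<omega> ^ 4 - 2 * e * f \<omega> ^ 2 + e\<^sup>2)"
    by (auto simp: fun_eq_iff power2_eq_square eval_nat_numeral algebra_simps)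
  also have "expectation \<dots> = expectation (\<lambda>\<omega>. f \<omega> ^ 4) - e\<^sup>2"
    using assms by (simp add: e_def prob_space) (simp add: power2_eq_square)
  finally have "e\<^sup>2 \<le> c\<^sup>2" using assms by simp
  then show ?thesis using assms(3) by (simp add: e_def[symmetric] abs_le_square_iff[symmetric])
qed

lemma quartic_sum_le: "(x + y) ^ 4 \<le> 8 * (x ^ 4 + y ^ 4)" for x y :: real
proof -
  have a: "(x + y)\<^sup>2 \<le> 2 * (x\<^sup>2 + y\<^sup>2)"
    using sum_squares_bound[of x y] by (simp add: power2_sum)
  have b: "4 * (x\<^sup>2 + y\<^sup>2)\<^sup>2 \<le> 8 * ((x\<^sup>2)\<^sup>2 + (y\<^sup>2)\<^sup>2)"
    using sum_squares_bound[of "x\<^sup>2" "y\<^sup>2"] by (simp add: power2_sum)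
  have "(x + y) ^ 4 = ((x + y)\<^sup>2)\<^sup>2" by (simp add: power_mult[symmetric])
  also have "\<dots> \<le> (2 * (x\<^sup>2 + y\<^sup>2))\<^sup>2" using a by (intro power_mono) auto
  also have "\<dots> \<le> 8 * ((x\<^sup>2)\<^sup>2 + (y\<^sup>2)\<^sup>2)" using b by (simp add: power_mult_distrib del: distrib_left_numeral)
  finally show ?thesis by (simp add: power_mult[symmetric])
qed

text \<open>The eighth moments are bounded by \<open>K^2\<close> so that \<open>K\<close> itself
  bounds the fourth moments. The bounds for quadratic forms are then linear in \<open>K\<close> for
  the second and quadratic for the fourth moment.\<close>

locale indep_coordinates = prob_space +
  fixes \<xi> :: "nat \<Rightarrow> 'a \<Rightarrow> real" and n :: nat and K :: real
  assumes indep: "indep_vars (\<lambda>_. borel) \<xi> {..<n}"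
    and int8: "\<And>i. i < n \<Longrightarrow> integrable M (\<lambda>\<omega>. \<xi> i \<omega> ^ 8)"
    and mean: "\<And>i. i < n \<Longrightarrow> expectation (\<xi> i) = 0"
    and var: "\<And>i. i < n \<Longrightarrow> expectation (\<lambda>\<omega>. \<xi> i \<omega> ^ 2) = 1"
    and m8: "\<And>i. i < n \<Longrightarrow> expectation (\<lambda>\<omega>. \<xi> i \<omega> ^ 8) \<le> K\<^sup>2"
    and K: "1 \<le> K"
begin

lemma measurable_coord [measurable]: "i < n \<Longrightarrow> \<xi> i \<in> borel_measurable M"
  using indep unfolding indep_vars_def by auto

lemma int_power: "i < n \<Longrightarrow> k \<le> 8 \<Longrightarrow> integrable M (\<lambda>\<omega>. \<xi> i \<omega> ^ k)"
  by (rule integrable_lower_power[OF measurable_coord int8]) auto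

lemma int_coord: "i < n \<Longrightarrow> integrable M (\<xi> i)"
  using int_power[of i 1] by simp

lemma m4: assumes "i < n" shows "expectation (\<lambda>\<omega>. \<xi> i \<omega> ^ 4) \<le> K"
proof -
  define g where "g \<omega> = \<xi> i \<omega> ^ 2" for \<omega>
  have "integrable M (\<lambda>\<omega>. g \<omega> ^ 2)" "integrable M (\<lambda>\<omega>. g \<omega> ^ 4)"
    "expectation (\<lambda>\<omega>. g \<omega> ^ 4) \<le> K\<^sup>2"
    using int_power[OF assms, of 4] int_power[OF assms, of 8] m8[OF assms]
    by (simp_all add: g_def power_mult[symmetric])
  from second_moment_le_fourth[OF this(1,2) _ this(3)] K show ?thesis
    by (simp add: g_def power_mult[symmetric])
qed

lemma indep_past:
  assumes "i < n" "\<phi> \<in> borel_measurable (Pi\<^sub>M {..<i} (\<lambda>_. borel :: real measure))"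
    "\<psi> \<in> borel_measurable (borel :: real measure)"
  shows "indep_var borel (\<lambda>\<omega>. \<phi> (\<lambda>j\<in>{..<i}. \<xi> j \<omega>) :: real) borel (\<lambda>\<omega>. \<psi> (\<xi> i \<omega>) :: real)"
proof -
  have "indep_var (PiM {..<i} (\<lambda>_. borel)) (\<lambda>\<omega>. restrict (\<lambda>j. \<xi> j \<omega>) {..<i})
      (PiM {i} (\<lambda>_. borel)) (\<lambda>\<omega>. restrict (\<lambda>j. \<xi> j \<omega>) {i})"
    by (rule indep_var_restrict[OF indep]) (use assms in auto)
  then have "indep_var borel (\<phi> \<circ> (\<lambda>\<omega>. restrict (\<lambda>j. \<xi> j \<omega>) {..<i}))
     borel ((\<lambda>x. \<psi> (x i)) \<circ> (\<lambda>\<omega>. restrict (\<lambda>j. \<xi> j \<omega>) {i}))"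
    by (rule indep_var_compose) (use assms in auto)
  then show ?thesis by (simp add: o_def)
qed

text \<open>This takes the place of conditioning on the coordinates before \<open>i\<close>:
  \<open>\<phi>\<close> is a value of the martingale so far, and the expectation of the product
  vanishes when \<open>\<psi> (\<xi> i)\<close> is centred.\<close>

lemma expectation_past_mult:
  fixes \<phi> :: "(nat \<Rightarrow> real) \<Rightarrow> real" and \<psi> :: "real \<Rightarrow> real"
  assumes "i < n" "\<phi> \<in> borel_measurable (Pi\<^sub>M {..<i} (\<lambda>_. borel :: real measure))"
    "\<psi> \<in> borel_measurable (borel :: real measure)"
    "integrable M (\<lambda>\<omega>. \<phi> (\<lambda>j\<in>{..<i}. \<xi> j \<omega>))" "integrable M (\<lambda>\<omega>. \<psi> (\<xi> i \<omega>))"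
  shows "integrable M (\<lambda>\<omega>. \<phi> (\<lambda>j\<in>{..<i}. \<xi> j \<omega>) * \<psi> (\<xi> i \<omega>))"
    "expectation (\<lambda>\<omega>. \<phi> (\<lambda>j\<in>{..<i}. \<xi> j \<omega>) * \<psi> (\<xi> i \<omega>)) =
     expectation (\<lambda>\<omega>. \<phi> (\<lambda>j\<in>{..<i}. \<xi> j \<omega>)) * expectation (\<lambda>\<omega>. \<psi> (\<xi> i \<omega>))"
  using indep_var_integrable[OF indep_past[OF assms(1-3)] assms(4,5)]
    indep_var_lebesgue_integral[OF indep_past[OF assms(1-3)] assms(4,5)] by auto

text \<open>The partial sums form a martingale. The summand \<open>q i * \<xi> i\<close> has fourth
  moment at most \<open>(sqrt K * (q i)^2)^2\<close>, so \<open>fourth_moment_add\<close> increases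
  the bound by \<open>4 * sqrt K * (q i)^2\<close>.\<close>

lemma linear_form_fourth_moment:
  assumes "i \<le> n"
  shows "integrable M (\<lambda>\<omega>. (\<Sum>j<i. q j * \<xi> j \<omega>) ^ 4) \<and>
    expectation (\<lambda>\<omega>. (\<Sum>j<i. q j * \<xi> j \<omega>) ^ 4) \<le> (4 * sqrt K * (\<Sum>j<i. (q j)\<^sup>2))\<^sup>2"
  using assms
proof (induction i)
  case 0
  then show ?case by simp
next
  case (Suc i)
  then have i: "i < n" by simp
  let ?f = "\<lambda>\<omega>. \<Sum>j<i. q j * \<xi> j \<omega>"
  let ?\<phi> = "\<lambda>x. \<Sum>j<i. q j * x j"
  have eq: "?\<phi> (\<lambda>j\<in>{..<i}. \<xi> j \<omega>) = ?f \<omega>" for \<omega> by simp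
  have IH: "integrable M (\<lambda>\<omega>. ?f \<omega> ^ 4)"
    "expectation (\<lambda>\<omega>. ?f \<omega> ^ 4) \<le> (4 * sqrt K * (\<Sum>j<i. (q j)\<^sup>2))\<^sup>2"
    using Suc by auto
  have mc [measurable]: "\<xi> j \<in> borel_measurable M" if "j \<in> {..<i}" for j using i that by simp
  have [measurable]: "?f \<in> borel_measurable M" by measurable
  have f3: "integrable M (\<lambda>\<omega>. ?f \<omega> ^ 3)"
    by (rule integrable_lower_power[OF _ IH(1)]) auto
  have phi: "(\<lambda>x. (?\<phi> x) ^ 3) \<in> borel_measurable (Pi\<^sub>M {..<i} (\<lambda>_. borel :: real measure))"
    by measurable
  have "expectation (\<lambda>\<omega>. ?f \<omega> ^ 3 * \<xi> i \<omega>) = 0"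
    using expectation_past_mult(2)[OF i phi, of "\<lambda>x. x"] f3 int_coord[OF i] mean[OF i] eq
    by simp
  then have orth: "expectation (\<lambda>\<omega>. ?f \<omega> ^ 3 * (q i * \<xi> i \<omega>)) = 0"
    by (simp add: mult.left_commute)
  have D4: "integrable M (\<lambda>\<omega>. (q i * \<xi> i \<omega>) ^ 4)"
    using int_power[OF i, of 4] by (simp add: power_mult_distrib)
  have "expectation (\<lambda>\<omega>. (q i * \<xi> i \<omega>) ^ 4) = q i ^ 4 * expectation (\<lambda>\<omega>. \<xi> i \<omega> ^ 4)"
    by (simp add: power_mult_distrib)
  also have "\<dots> \<le> q i ^ 4 * K" using m4[OF i] by (intro mult_left_mono) auto
  also have "\<dots> = (sqrt K * (q i)\<^sup>2)\<^sup>2" using K by (simp add: power_mult_distrib power_mult[symmetric])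
  finally have dd: "expectation (\<lambda>\<omega>. (q i * \<xi> i \<omega>) ^ 4) \<le> (sqrt K * (q i)\<^sup>2)\<^sup>2" .
  have nn: "0 \<le> 4 * sqrt K * (\<Sum>j<i. (q j)\<^sup>2)" "0 \<le> sqrt K * (q i)\<^sup>2"
    using K by (auto intro!: mult_nonneg_nonneg sum_nonneg)
  have mD: "(\<lambda>\<omega>. q i * \<xi> i \<omega>) \<in> borel_measurable M" using i by measurable
  have "(4 * sqrt K * (\<Sum>j<i. (q j)\<^sup>2)) + 4 * (sqrt K * (q i)\<^sup>2) = 4 * sqrt K * (\<Sum>j<Suc i. (q j)\<^sup>2)"
    by (simp add: algebra_simps)
  with fourth_moment_add[OF _ mD IH(1) D4 orth nn(1) IH(2) nn(2) dd] show ?case by simp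
qed

definition qform :: "(nat \<Rightarrow> nat \<Rightarrow> real) \<Rightarrow> nat \<Rightarrow> 'a \<Rightarrow> real" where
  "qform B i \<omega> = (\<Sum>j<i. \<Sum>k<i. B j k * \<xi> j \<omega> * \<xi> k \<omega>)"

text \<open>The increment is a martingale difference: its mixed part contains the factor
  \<open>\<xi> i\<close>, and \<open>\<xi> i ^ 2 - 1\<close> is centred because the variance is 1.
  Symmetry merges the new row and the new column into the factor 2.\<close>

lemma qform_Suc:
  assumes "\<And>j k. B j k = B k j"
  shows "qform B (Suc i) \<omega> - (\<Sum>j<Suc i. B j j) = (qform B i \<omega> - (\<Sum>j<i. B j j)) +
    (2 * ((\<Sum>j<i. B i j * \<xi> j \<omega>) * \<xi> i \<omega>) + B i i * (\<xi> i \<omega> ^ 2 - 1))"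
proof -
  have "qform B (Suc i) \<omega> = qform B i \<omega> + (\<Sum>j<i. B j i * \<xi> j \<omega> * \<xi> i \<omega>)
     + (\<Sum>k<i. B i k * \<xi> i \<omega> * \<xi> k \<omega>) + B i i * \<xi> i \<omega> * \<xi> i \<omega>"
    by (simp add: qform_def sum.distrib)
  also have "(\<Sum>j<i. B j i * \<xi> j \<omega> * \<xi> i \<omega>) = (\<Sum>j<i. B i j * \<xi> j \<omega>) * \<xi> i \<omega>"
    using assms by (simp add: sum_distrib_right)
  also have "(\<Sum>k<i. B i k * \<xi> i \<omega> * \<xi> k \<omega>) = (\<Sum>j<i. B i j * \<xi> j \<omega>) * \<xi> i \<omega>"
    by (simp add: sum_distrib_left mult_ac)
  finally show ?thesis by (simp add: algebra_simps power2_eq_square)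
qed

lemma measurable_qform [measurable]: "i \<le> n \<Longrightarrow> qform B i \<in> borel_measurable M"
  unfolding qform_def by measurable

text \<open>Decoupling the last coordinate writes the centred form as a sum of martingale differences, to
  which the previous estimate applies.\<close>

lemma quadratic_form_moments_aux:
  assumes sym: "\<And>j k. B j k = B k j" and "i \<le> n"
  shows "integrable M (\<lambda>\<omega>. (qform B i \<omega> - (\<Sum>j<i. B j j)) ^ 4) \<and>
    expectation (\<lambda>\<omega>. qform B i \<omega> - (\<Sum>j<i. B j j)) = 0 \<and>
    expectation (\<lambda>\<omega>. (qform B i \<omega> - (\<Sum>j<i. B j j)) ^ 4) \<le> (184 * K * (\<Sum>j<i. \<Sum>k<i. (B j k)\<^sup>2))\<^sup>2"
  using assms(2)
proof (induction i)
  case 0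
  then show ?case by (simp add: qform_def)
next
  case (Suc i)
  then have i: "i < n" by simp
  let ?f = "\<lambda>\<omega>. qform B i \<omega> - (\<Sum>j<i. B j j)"
  let ?\<phi> = "\<lambda>x. (\<Sum>j<i. \<Sum>k<i. B j k * x j * x k) - (\<Sum>j<i. B j j)"
  let ?g = "\<lambda>\<omega>. \<Sum>j<i. B i j * \<xi> j \<omega>"
  let ?\<gamma> = "\<lambda>x. \<Sum>j<i. B i j * x j"
  let ?s = "\<lambda>\<omega>. \<xi> i \<omega> ^ 2 - 1"
  let ?D = "\<lambda>\<omega>. 2 * (?g \<omega> * \<xi> i \<omega>) + B i i * ?s \<omega>"
  let ?S = "\<Sum>j<i. (B i j)\<^sup>2"
  have eqf: "?\<phi> (\<lambda>j\<in>{..<i}. \<xi> j \<omega>) = ?f \<omega>" for \<omega> by (simp add: qform_def)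
  have eqg: "?\<gamma> (\<lambda>j\<in>{..<i}. \<xi> j \<omega>) = ?g \<omega>" for \<omega> by simp
  have IH: "integrable M (\<lambda>\<omega>. ?f \<omega> ^ 4)" "expectation ?f = 0"
    "expectation (\<lambda>\<omega>. ?f \<omega> ^ 4) \<le> (184 * K * (\<Sum>j<i. \<Sum>k<i. (B j k)\<^sup>2))\<^sup>2"
    using Suc by auto
  have mc [measurable]: "\<xi> j \<in> borel_measurable M" if "j \<in> {..<i}" for j using i that by simp
  have [measurable]: "qform B i \<in> borel_measurable M" using i by simp
  have [measurable]: "?f \<in> borel_measurable M" "?g \<in> borel_measurable M"
    by measurable
  have [measurable]: "\<xi> i \<in> borel_measurable M" using i by simp
  have g4: "integrable M (\<lambda>\<omega>. ?g \<omega> ^ 4)"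
    "expectation (\<lambda>\<omega>. ?g \<omega> ^ 4) \<le> (4 * sqrt K * ?S)\<^sup>2"
    using linear_form_fourth_moment[of i "B i"] i by auto
  have f1: "integrable M ?f" using integrable_lower_power[OF _ IH(1), of 1] by simp
  have g1: "integrable M ?g" using integrable_lower_power[OF _ g4(1), of 1] by simp
  have f3: "integrable M (\<lambda>\<omega>. ?f \<omega> ^ 3)" by (rule integrable_lower_power[OF _ IH(1)]) auto
  have f3g: "integrable M (\<lambda>\<omega>. ?f \<omega> ^ 3 * ?g \<omega>)"
    by (rule Bochner_Integration.integrable_bound[of M "\<lambda>\<omega>. ?f \<omega> ^ 4 + ?g \<omega> ^ 4"])
      (use IH(1) g4(1) abs_mult_powers_le(1) in auto)
  have s1: "integrable M ?s" "expectation ?s = 0"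
    using int_power[OF i, of 2] var[OF i] by (auto simp: prob_space)
  have s4: "integrable M (\<lambda>\<omega>. ?s \<omega> ^ 4)" "expectation (\<lambda>\<omega>. ?s \<omega> ^ 4) \<le> 16 * K\<^sup>2"
  proof -
    have e: "?s \<omega> ^ 4 = \<xi> i \<omega> ^ 8 - 4 * \<xi> i \<omega> ^ 6 + 6 * \<xi> i \<omega> ^ 4 - 4 * \<xi> i \<omega> ^ 2 + 1" for \<omega>
      by (simp add: eval_nat_numeral algebra_simps)
    show i4: "integrable M (\<lambda>\<omega>. ?s \<omega> ^ 4)"
      unfolding e using int_power[OF i, of 8] int_power[OF i, of 6] int_power[OF i, of 4]
        int_power[OF i, of 2] by simp
    have "expectation (\<lambda>\<omega>. ?s \<omega> ^ 4) \<le> expectation (\<lambda>\<omega>. 8 * (\<xi> i \<omega> ^ 8 + 1))"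
    proof (rule integral_mono[OF i4])
      show "integrable M (\<lambda>\<omega>. 8 * (\<xi> i \<omega> ^ 8 + 1))" using int_power[OF i, of 8] by simp
      show "?s \<omega> ^ 4 \<le> 8 * (\<xi> i \<omega> ^ 8 + 1)" for \<omega>
        using quartic_sum_le[of "\<xi> i \<omega> ^ 2" "-1"] by (simp add: power_mult[symmetric])
    qed
    also have "\<dots> = 8 * (expectation (\<lambda>\<omega>. \<xi> i \<omega> ^ 8) + 1)"
      using int_power[OF i, of 8] by (simp add: prob_space)
    also have "\<dots> \<le> 8 * (K\<^sup>2 + K\<^sup>2)" using m8[OF i] K by (intro mult_left_mono add_mono) auto
    finally show "expectation (\<lambda>\<omega>. ?s \<omega> ^ 4) \<le> 16 * K\<^sup>2" by simp
  qed
  have mg: "?\<gamma> \<in> borel_measurable (Pi\<^sub>M {..<i} (\<lambda>_. borel :: real measure))"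
    and mg4: "(\<lambda>x. ?\<gamma> x ^ 4) \<in> borel_measurable (Pi\<^sub>M {..<i} (\<lambda>_. borel :: real measure))"
    and mf3: "(\<lambda>x. ?\<phi> x ^ 3) \<in> borel_measurable (Pi\<^sub>M {..<i} (\<lambda>_. borel :: real measure))"
    and mfg: "(\<lambda>x. ?\<phi> x ^ 3 * ?\<gamma> x) \<in> borel_measurable (Pi\<^sub>M {..<i} (\<lambda>_. borel :: real measure))"
    by measurable
  have gx: "integrable M (\<lambda>\<omega>. ?g \<omega> * \<xi> i \<omega>)" "expectation (\<lambda>\<omega>. ?g \<omega> * \<xi> i \<omega>) = 0"
    using expectation_past_mult[OF i mg, of "\<lambda>x. x"] g1 int_coord[OF i] mean[OF i]
    unfolding eqg by simp_all
  have gx4: "integrable M (\<lambda>\<omega>. ?g \<omega> ^ 4 * \<xi> i \<omega> ^ 4)"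
    "expectation (\<lambda>\<omega>. ?g \<omega> ^ 4 * \<xi> i \<omega> ^ 4) \<le> (4 * sqrt K * ?S)\<^sup>2 * K"
    using expectation_past_mult[OF i mg4, of "\<lambda>x. x ^ 4"] g4 int_power[OF i, of 4] m4[OF i]
    unfolding eqg by (auto intro!: mult_mono)
  have f3gx: "integrable M (\<lambda>\<omega>. ?f \<omega> ^ 3 * ?g \<omega> * \<xi> i \<omega>)"
    "expectation (\<lambda>\<omega>. ?f \<omega> ^ 3 * ?g \<omega> * \<xi> i \<omega>) = 0"
    using expectation_past_mult[OF i mfg, of "\<lambda>x. x"] f3g int_coord[OF i] mean[OF i]
    unfolding eqg eqf by simp_all
  have f3s: "integrable M (\<lambda>\<omega>. ?f \<omega> ^ 3 * ?s \<omega>)"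
    "expectation (\<lambda>\<omega>. ?f \<omega> ^ 3 * ?s \<omega>) = 0"
    using expectation_past_mult[OF i mf3, of "\<lambda>x. x ^ 2 - 1"] f3 s1
    unfolding eqg eqf by simp_all
  have mD: "?D \<in> borel_measurable M" by measurable
  have orth: "expectation (\<lambda>\<omega>. ?f \<omega> ^ 3 * ?D \<omega>) = 0"
  proof -
    have "expectation (\<lambda>\<omega>. ?f \<omega> ^ 3 * ?D \<omega>) =
      expectation (\<lambda>\<omega>. 2 * (?f \<omega> ^ 3 * ?g \<omega> * \<xi> i \<omega>) + B i i * (?f \<omega> ^ 3 * ?s \<omega>))"
      by (simp add: algebra_simps)
    also have "\<dots> = 0" using f3gx f3s by (subst Bochner_Integration.integral_add) auto
    finally show ?thesis .
  qed
  \<comment> \<open>The squared entries of the new row up to the diagonal. They pay for the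
    increment; the new column above the diagonal is discarded in \<open>sumle\<close>.\<close>
  define \<Delta> where "\<Delta> = ?S + (B i i)\<^sup>2"
  have Sn: "0 \<le> ?S" by (intro sum_nonneg) auto
  have ptD: "?D \<omega> ^ 4 \<le> 128 * (?g \<omega> ^ 4 * \<xi> i \<omega> ^ 4) + 8 * B i i ^ 4 * ?s \<omega> ^ 4" for \<omega>
    using quartic_sum_le[of "2 * (?g \<omega> * \<xi> i \<omega>)" "B i i * ?s \<omega>"] by (simp add: power_mult_distrib)
  have iD: "integrable M (\<lambda>\<omega>. 128 * (?g \<omega> ^ 4 * \<xi> i \<omega> ^ 4) + 8 * B i i ^ 4 * ?s \<omega> ^ 4)"
    using gx4 s4 by simp
  have D4: "integrable M (\<lambda>\<omega>. ?D \<omega> ^ 4)"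
    by (rule Bochner_Integration.integrable_bound[OF iD]) (use ptD in \<open>auto intro: order.trans\<close>)
  \<comment> \<open>The constants are \<open>128 * 16 = 2048\<close> for the mixed part and
    \<open>8 * 16 = 128\<close> for the diagonal part, and \<open>46^2 = 2116\<close> dominates
    both. Four times 46 is the 184 of the statement.\<close>
  have dd: "expectation (\<lambda>\<omega>. ?D \<omega> ^ 4) \<le> (46 * K * \<Delta>)\<^sup>2"
  proof -
    have "expectation (\<lambda>\<omega>. ?D \<omega> ^ 4) \<le>
       expectation (\<lambda>\<omega>. 128 * (?g \<omega> ^ 4 * \<xi> i \<omega> ^ 4) + 8 * B i i ^ 4 * ?s \<omega> ^ 4)"
      by (rule integral_mono[OF D4 iD ptD])
    also have "\<dots> = 128 * expectation (\<lambda>\<omega>. ?g \<omega> ^ 4 * \<xi> i \<omega> ^ 4)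
        + 8 * B i i ^ 4 * expectation (\<lambda>\<omega>. ?s \<omega> ^ 4)"
      using gx4 s4 by simp
    also have "\<dots> \<le> 128 * ((4 * sqrt K * ?S)\<^sup>2 * K) + 8 * B i i ^ 4 * (16 * K\<^sup>2)"
      using gx4 s4 by (intro add_mono mult_left_mono) auto
    also have "(4 * sqrt K * ?S)\<^sup>2 = 16 * K * ?S\<^sup>2"
      using K by (simp add: power_mult_distrib)
    also have "128 * (16 * K * ?S\<^sup>2 * K) + 8 * B i i ^ 4 * (16 * K\<^sup>2)
        = K\<^sup>2 * (2048 * ?S\<^sup>2 + 128 * ((B i i)\<^sup>2)\<^sup>2)"
      by (simp add: eval_nat_numeral algebra_simps)
    also have "\<dots> \<le> K\<^sup>2 * (2116 * \<Delta>\<^sup>2)"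
    proof (intro mult_left_mono)
      have "0 \<le> ?S * (B i i)\<^sup>2" using Sn by simp
      moreover have "0 \<le> ?S\<^sup>2" "0 \<le> ((B i i)\<^sup>2)\<^sup>2" by simp_all
      moreover have "\<Delta>\<^sup>2 = ?S\<^sup>2 + 2 * (?S * (B i i)\<^sup>2) + ((B i i)\<^sup>2)\<^sup>2"
        by (simp add: \<Delta>_def power2_sum)
      ultimately show "2048 * ?S\<^sup>2 + 128 * ((B i i)\<^sup>2)\<^sup>2 \<le> 2116 * \<Delta>\<^sup>2" by linarith
    qed simp
    also have "\<dots> = (46 * K * \<Delta>)\<^sup>2" by (simp add: power_mult_distrib power2_eq_square)
    finally show ?thesis .
  qed
  have nn: "0 \<le> 184 * K * (\<Sum>j<i. \<Sum>k<i. (B j k)\<^sup>2)" "0 \<le> 46 * K * \<Delta>"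
    using K Sn by (auto intro!: mult_nonneg_nonneg sum_nonneg simp: \<Delta>_def)
  note res = fourth_moment_add[OF _ mD IH(1) D4 orth nn(1) IH(3) nn(2) dd]
  have sumle: "184 * K * (\<Sum>j<i. \<Sum>k<i. (B j k)\<^sup>2) + 4 * (46 * K * \<Delta>)
     \<le> 184 * K * (\<Sum>j<Suc i. \<Sum>k<Suc i. (B j k)\<^sup>2)"
  proof -
    have "(\<Sum>j<Suc i. \<Sum>k<Suc i. (B j k)\<^sup>2) = (\<Sum>j<i. \<Sum>k<i. (B j k)\<^sup>2) + (\<Sum>j<i. (B j i)\<^sup>2) + \<Delta>"
      by (simp add: sum.distrib \<Delta>_def)
    moreover have "0 \<le> (\<Sum>j<i. (B j i)\<^sup>2)" by (intro sum_nonneg) auto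
    ultimately have "184 * K * ((\<Sum>j<i. \<Sum>k<i. (B j k)\<^sup>2) + \<Delta>) \<le> 184 * K * (\<Sum>j<Suc i. \<Sum>k<Suc i. (B j k)\<^sup>2)"
      using K by (intro mult_left_mono) auto
    then show ?thesis by (simp add: algebra_simps)
  qed
  show ?case
    unfolding qform_Suc[of B, OF sym]
  proof (intro conjI)
    show "integrable M (\<lambda>\<omega>. (?f \<omega> + ?D \<omega>) ^ 4)" by (rule res(1)) measurable
    have "expectation (\<lambda>\<omega>. (?f \<omega> + ?D \<omega>) ^ 4) \<le>
      (184 * K * (\<Sum>j<i. \<Sum>k<i. (B j k)\<^sup>2) + 4 * (46 * K * \<Delta>))\<^sup>2"
      by (rule res(2)) measurable
    also have "\<dots> \<le> (184 * K * (\<Sum>j<Suc i. \<Sum>k<Suc i. (B j k)\<^sup>2))\<^sup>2"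
      by (rule power_mono[OF sumle]) (use nn in linarith)
    finally show "expectation (\<lambda>\<omega>. (?f \<omega> + ?D \<omega>) ^ 4) \<le> \<dots>" .
    have "integrable M ?D" using gx s1 by simp
    moreover have "expectation ?D = 0" using gx s1 by simp
    ultimately show "expectation (\<lambda>\<omega>. ?f \<omega> + ?D \<omega>) = 0"
      using f1 IH(2) by (subst Bochner_Integration.integral_add) auto
  qed
qed

lemma quadratic_form_moments:
  fixes B :: "nat \<Rightarrow> nat \<Rightarrow> real"
  assumes sym: "\<And>j k. B j k = B k j"
  defines "f \<equiv> \<lambda>\<omega>. (\<Sum>j<n. \<Sum>k<n. B j k * \<xi> j \<omega> * \<xi> k \<omega>) - (\<Sum>j<n. B j j)"
    and "b \<equiv> \<Sum>j<n. \<Sum>k<n. (B j k)\<^sup>2"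
  shows "k \<le> 4 \<Longrightarrow> integrable M (\<lambda>\<omega>. f \<omega> ^ k)" "integrable M f" "expectation f = 0"
    "expectation (\<lambda>\<omega>. f \<omega> ^ 4) \<le> (184 * K * b)\<^sup>2" "expectation (\<lambda>\<omega>. f \<omega> ^ 2) \<le> 184 * K * b"
proof -
  have f: "f = (\<lambda>\<omega>. qform B n \<omega> - (\<Sum>j<n. B j j))" by (simp add: f_def qform_def)
  have [measurable]: "f \<in> borel_measurable M" unfolding f by measurable
  have 1: "integrable M (\<lambda>\<omega>. f \<omega> ^ 4)" "expectation f = 0"
    "expectation (\<lambda>\<omega>. f \<omega> ^ 4) \<le> (184 * K * b)\<^sup>2"
    using quadratic_form_moments_aux[of B n] sym unfolding f b_def by auto
  show i: "integrable M (\<lambda>\<omega>. f \<omega> ^ k)" if "k \<le> 4" for k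
    by (rule integrable_lower_power[OF _ 1(1)]) (use that in auto)
  show "integrable M f" using i[of 1] by simp
  show "expectation f = 0" "expectation (\<lambda>\<omega>. f \<omega> ^ 4) \<le> (184 * K * b)\<^sup>2" by fact+
  show "expectation (\<lambda>\<omega>. f \<omega> ^ 2) \<le> 184 * K * b"
    by (rule second_moment_le_fourth) (use i 1 K in \<open>auto simp: b_def intro!: mult_nonneg_nonneg sum_nonneg\<close>)
qed

end

subsection \<open>Symmetric matrices, rank-one updates and shifts\<close>

definition dot :: "nat \<Rightarrow> (nat \<Rightarrow> real) \<Rightarrow> (nat \<Rightarrow> real) \<Rightarrow> real" where
  "dot n u v = (\<Sum>i<n. u i * v i)"

definition mv :: "nat \<Rightarrow> (nat \<Rightarrow> nat \<Rightarrow> real) \<Rightarrow> (nat \<Rightarrow> real) \<Rightarrow> nat \<Rightarrow> real" where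
  "mv n R v = (\<lambda>i. \<Sum>j<n. R i j * v j)"

lemma dot_linear:
  "dot n (\<lambda>i. u i + v i) w = dot n u w + dot n v w" "dot n w (\<lambda>i. u i + v i) = dot n w u + dot n w v"
  "dot n (\<lambda>i. u i - v i) w = dot n u w - dot n v w" "dot n w (\<lambda>i. u i - v i) = dot n w u - dot n w v"
  "dot n (\<lambda>i. c * u i) w = c * dot n u w" "dot n w (\<lambda>i. c * u i) = c * dot n w u"
  "dot n (\<lambda>i. u i * c) w = dot n u w * c" "dot n w (\<lambda>i. u i * c) = dot n w u * c"
  "dot n (\<lambda>i. u i / c) w = dot n u w / c" "dot n w (\<lambda>i. u i / c) = dot n w u / c"
  "dot n (\<lambda>i. 0) w = 0" "dot n w (\<lambda>i. 0) = 0"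
  by (simp_all add: dot_def algebra_simps sum.distrib sum_subtractf sum_distrib_left sum_divide_distrib)

lemma mv_linear:
  "mv n R (\<lambda>i. u i + v i) = (\<lambda>i. mv n R u i + mv n R v i)"
  "mv n R (\<lambda>i. u i - v i) = (\<lambda>i. mv n R u i - mv n R v i)"
  "mv n R (\<lambda>i. c * u i) = (\<lambda>i. c * mv n R u i)"
  "mv n R (\<lambda>i. 0) = (\<lambda>i. 0)"
  by (simp_all add: mv_def algebra_simps sum.distrib sum_subtractf sum_distrib_left)

lemmas lin = dot_linear mv_linear

lemma dot_commute: "dot n u v = dot n v u"
  by (simp add: dot_def mult.commute)

lemma dot_self_nonneg [simp]: "0 \<le> dot n u u"
  by (simp add: dot_def sum_nonneg)

lemma dot_cong: "(\<And>i. i < n \<Longrightarrow> u i = u' i) \<Longrightarrow> (\<And>i. i < n \<Longrightarrow> v i = v' i) \<Longrightarrow> dot n u v = dot n u' v'"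
  by (simp add: dot_def)

lemma dot_delta: "i < n \<Longrightarrow> dot n (\<lambda>j. if i = j then 1 else 0) v = v i"
  "i < n \<Longrightarrow> dot n v (\<lambda>j. if i = j then 1 else 0) = v i"
  by (simp_all add: dot_def if_distrib[of "\<lambda>x. x * _"] if_distrib[of "\<lambda>x. _ * x"] cong: if_cong)

text \<open>Symmetry is demanded at all indices, although sums run below \<open>n\<close> only: rows
  and columns can then be exchanged without index bounds, and all constructions below preserve
  it.\<close>

definition symm :: "(nat \<Rightarrow> nat \<Rightarrow> real) \<Rightarrow> bool" where
  "symm R \<longleftrightarrow> (\<forall>i j. R i j = R j i)"

definition psd :: "nat \<Rightarrow> (nat \<Rightarrow> nat \<Rightarrow> real) \<Rightarrow> bool" where
  "psd n R \<longleftrightarrow> (\<forall>z. 0 \<le> dot n z (mv n R z))"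

lemma dot_mv: "symm R \<Longrightarrow> dot n (mv n R u) v = dot n u (mv n R v)"
proof -
  assume s: "symm R"
  have "dot n (mv n R u) v = (\<Sum>i<n. \<Sum>j<n. R i j * u j * v i)"
    by (simp add: dot_def mv_def sum_distrib_right)
  also have "\<dots> = (\<Sum>j<n. \<Sum>i<n. R i j * u j * v i)" by (rule sum.swap)
  also have "\<dots> = (\<Sum>j<n. \<Sum>i<n. u j * (R j i * v i))"
    using s by (intro sum.cong refl) (auto simp: symm_def)
  also have "\<dots> = dot n u (mv n R v)" by (simp add: dot_def mv_def sum_distrib_left)
  finally show ?thesis .
qed

lemma dot_mv_commute: "symm R \<Longrightarrow> dot n u (mv n R v) = dot n v (mv n R u)"
  by (subst dot_commute) (rule dot_mv)

lemma dot_cauchy: "(dot n u v)\<^sup>2 \<le> dot n u u * dot n v v"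
proof (rule discriminant_le)
  fix t
  have "0 \<le> dot n (\<lambda>i. u i + t * v i) (\<lambda>i. u i + t * v i)" by simp
  then show "0 \<le> dot n u u + 2 * t * dot n u v + t\<^sup>2 * dot n v v"
    by (simp add: lin dot_commute[of n v u] power2_eq_square algebra_simps)
qed

lemma psd_cauchy:
  assumes "symm R" "psd n R"
  shows "(dot n u (mv n R v))\<^sup>2 \<le> dot n u (mv n R u) * dot n v (mv n R v)"
proof (rule discriminant_le)
  fix t
  have "0 \<le> dot n (\<lambda>i. u i + t * v i) (mv n R (\<lambda>i. u i + t * v i))" using assms by (simp add: psd_def)
  moreover have "dot n v (mv n R u) = dot n u (mv n R v)"
    by (rule dot_mv_commute[OF assms(1)])
  ultimately show "0 \<le> dot n u (mv n R u) + 2 * t * dot n u (mv n R v) + t\<^sup>2 * dot n v (mv n R v)"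
    by (simp add: lin power2_eq_square algebra_simps)
qed

text \<open>For symmetric \<open>R\<close> these are the traces of \<open>R, R\<^sup>2, R\<^sup>3, R\<^sup>4\<close>.\<close>

definition tr1 :: "nat \<Rightarrow> (nat \<Rightarrow> nat \<Rightarrow> real) \<Rightarrow> real" where
  "tr1 n R = (\<Sum>i<n. R i i)"
definition tr2 :: "nat \<Rightarrow> (nat \<Rightarrow> nat \<Rightarrow> real) \<Rightarrow> real" where
  "tr2 n R = (\<Sum>i<n. dot n (R i) (R i))"
definition tr3 :: "nat \<Rightarrow> (nat \<Rightarrow> nat \<Rightarrow> real) \<Rightarrow> real" where
  "tr3 n R = (\<Sum>i<n. dot n (R i) (mv n R (R i)))"
definition tr4 :: "nat \<Rightarrow> (nat \<Rightarrow> nat \<Rightarrow> real) \<Rightarrow> real" where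
  "tr4 n R = (\<Sum>i<n. dot n (mv n R (R i)) (mv n R (R i)))"

lemma mv_row: "mv n R (R i) j = dot n (R j) (R i)"
  by (simp add: mv_def dot_def)

lemma mv_delta: "symm R \<Longrightarrow> i < n \<Longrightarrow> mv n R (\<lambda>j. if i = j then 1 else 0) = R i"
  by (auto simp: mv_def symm_def fun_eq_iff if_distrib[of "\<lambda>x. _ * x"] cong: if_cong)

lemma tr2_nonneg: "0 \<le> tr2 n R"
  by (auto simp: tr2_def intro: sum_nonneg)

lemma tr3_nonneg: "psd n R \<Longrightarrow> 0 \<le> tr3 n R"
  by (auto simp: tr3_def psd_def intro: sum_nonneg)

lemma tr1_nonneg:
  assumes "symm R" "psd n R" shows "0 \<le> tr1 n R"
  unfolding tr1_def
proof (rule sum_nonneg)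
  fix i assume "i \<in> {..<n}"
  then have i: "i < n" by simp
  have "0 \<le> dot n (\<lambda>j. if i = j then 1 else 0) (mv n R (\<lambda>j. if i = j then 1 else 0))"
    using assms by (simp add: psd_def)
  then show "0 \<le> R i i" by (simp add: mv_delta[OF assms(1) i] dot_delta i)
qed

text \<open>The trace of \<open>(I + t R) R (I + t R)\<close> is nonnegative for every
  \<open>t\<close>, row by row, and as a polynomial in \<open>t\<close> it has the coefficients
  \<open>tr1\<close>, \<open>2 * tr2\<close> and \<open>tr3\<close>.\<close>

lemma tr2_sq_le:
  assumes "symm R" "psd n R"
  shows "(tr2 n R)\<^sup>2 \<le> tr1 n R * tr3 n R"
proof (rule discriminant_le)
  fix t
  let ?e = "\<lambda>i j. if i = j then 1 else 0 :: real"
  have d: "mv n R (R i) i = dot n (R i) (R i)" for i by (rule mv_row)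
  have "0 \<le> (\<Sum>i<n. dot n (\<lambda>j. ?e i j + t * R i j) (mv n R (\<lambda>j. ?e i j + t * R i j)))"
    using assms by (intro sum_nonneg) (auto simp: psd_def)
  also have "\<dots> = (\<Sum>i<n. R i i + 2 * t * dot n (R i) (R i) + t\<^sup>2 * dot n (R i) (mv n R (R i)))"
    by (intro sum.cong refl)
      (simp add: lin mv_delta[OF assms(1)] dot_delta d power2_eq_square algebra_simps)
  finally show "0 \<le> tr1 n R + 2 * t * tr2 n R + t\<^sup>2 * tr3 n R"
    by (simp add: tr1_def tr2_def tr3_def sum.distrib sum_distrib_left)
qed

text \<open>The Frobenius norm \<open>sqrt (tr2 n R)\<close> stands in for the operator norm
  throughout, because it is an explicit function of the entries whose evolution can be
  computed.\<close>

lemma mv_norm_le: "dot n (mv n R u) (mv n R u) \<le> tr2 n R * dot n u u"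
proof -
  have "dot n (mv n R u) (mv n R u) = (\<Sum>i<n. (dot n (R i) u)\<^sup>2)"
    by (simp add: dot_def[of n "mv n R u"] mv_def dot_def[symmetric] power2_eq_square)
  also have "\<dots> \<le> (\<Sum>i<n. dot n (R i) (R i) * dot n u u)" by (intro sum_mono dot_cauchy)
  finally show ?thesis by (simp add: tr2_def sum_distrib_right)
qed

lemma form_le: "dot n u (mv n R u) \<le> sqrt (tr2 n R) * dot n u u"
proof -
  have "(dot n u (mv n R u))\<^sup>2 \<le> dot n u u * dot n (mv n R u) (mv n R u)" by (rule dot_cauchy)
  also have "\<dots> \<le> dot n u u * (tr2 n R * dot n u u)" by (intro mult_left_mono mv_norm_le) simp
  also have "\<dots> = (sqrt (tr2 n R) * dot n u u)\<^sup>2"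
    by (simp add: power_mult_distrib tr2_nonneg power2_eq_square)
  finally show ?thesis
    by (rule power2_le_imp_le) (simp add: tr2_nonneg)
qed

text \<open>This is \<open>R^2 \<le> |R| R\<close> for positive semidefinite \<open>R\<close>,
  without a square root of the matrix: Cauchy-Schwarz for the form of \<open>R\<close> at
  \<open>u\<close> and \<open>R u\<close>, then division by \<open>|R u|^2\<close>.\<close>

lemma psd_mv_norm_le:
  assumes "symm R" "psd n R"
  shows "dot n (mv n R u) (mv n R u) \<le> sqrt (tr2 n R) * dot n u (mv n R u)"
proof -
  let ?\<beta> = "dot n (mv n R u) (mv n R u)" and ?\<alpha> = "dot n u (mv n R u)"
  have a: "0 \<le> ?\<alpha>" using assms by (simp add: psd_def)
  have "?\<beta>\<^sup>2 = (dot n u (mv n R (mv n R u)))\<^sup>2" by (simp add: dot_mv[OF assms(1)])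
  also have "\<dots> \<le> ?\<alpha> * dot n (mv n R u) (mv n R (mv n R u))" by (rule psd_cauchy[OF assms])
  also have "\<dots> \<le> ?\<alpha> * (sqrt (tr2 n R) * ?\<beta>)" by (intro mult_left_mono form_le a)
  finally have "?\<beta> * ?\<beta> \<le> (sqrt (tr2 n R) * ?\<alpha>) * ?\<beta>" by (simp add: power2_eq_square mult_ac)
  then have "?\<beta> \<le> sqrt (tr2 n R) * ?\<alpha>" if "0 < ?\<beta>"
    using that by (rule mult_right_le_imp_le)
  moreover have "0 \<le> ?\<beta>" "0 \<le> sqrt (tr2 n R) * ?\<alpha>" using a tr2_nonneg[of n R] by simp_all
  ultimately show ?thesis by linarith
qed

lemma tr4_le:
  assumes "symm R" "psd n R"
  shows "tr4 n R \<le> sqrt (tr2 n R) * tr3 n R"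
  unfolding tr4_def tr3_def sum_distrib_left by (intro sum_mono psd_mv_norm_le assms)

section \<open>Rank-one updates and their effect on the traces\<close>

definition rank1 :: "(nat \<Rightarrow> nat \<Rightarrow> real) \<Rightarrow> (nat \<Rightarrow> real) \<Rightarrow> real \<Rightarrow> nat \<Rightarrow> nat \<Rightarrow> real" where
  "rank1 R y s = (\<lambda>i j. R i j + y i * y j / s)"

lemma symm_rank1: "symm R \<Longrightarrow> symm (rank1 R y s)"
  by (simp add: symm_def rank1_def mult.commute)

lemma mv_rank1: "mv n (rank1 R y s) z = (\<lambda>i. mv n R z i + dot n y z / s * y i)"
proof
  fix i
  have "mv n (rank1 R y s) z i = (\<Sum>j<n. R i j * z j + y i / s * (y j * z j))"
    unfolding mv_def rank1_def by (intro sum.cong refl) (simp add: distrib_right)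
  also have "\<dots> = mv n R z i + y i / s * dot n y z"
    by (simp only: sum.distrib sum_distrib_left[symmetric] mv_def dot_def)
  finally show "mv n (rank1 R y s) z i = mv n R z i + dot n y z / s * y i" by simp
qed

lemma form_rank1: "dot n z (mv n (rank1 R y s) z) = dot n z (mv n R z) + (dot n y z)\<^sup>2 / s"
proof -
  have "dot n z (mv n (rank1 R y s) z) = dot n z (mv n R z) + dot n y z / s * dot n z y"
    by (simp only: mv_rank1 lin)
  then show ?thesis by (simp add: dot_commute[of n z y] power2_eq_square)
qed

lemma psd_rank1: "psd n R \<Longrightarrow> 0 < s \<Longrightarrow> psd n (rank1 R y s)"
  unfolding psd_def form_rank1 by (auto intro!: add_nonneg_nonneg divide_nonneg_nonneg)

lemma tr1_rank1: "tr1 n (rank1 R y s) = tr1 n R + dot n y y / s"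
  by (simp add: tr1_def rank1_def dot_def sum.distrib sum_divide_distrib)

lemma rank1_row: "rank1 R y s i = (\<lambda>j. R i j + (y i / s) * y j)"
  by (simp add: rank1_def)

lemma sum_row: "(\<Sum>i<n. y i * dot n (R i) v) = dot n y (mv n R v)"
  by (simp add: dot_def mv_def)

lemma tr2_rank1: "tr2 n (rank1 R y s) = tr2 n R + 2 * dot n y (mv n R y) / s + (dot n y y)\<^sup>2 / s\<^sup>2"
proof -
  have row: "dot n (rank1 R y s i) (rank1 R y s i) =
      dot n (R i) (R i) + 2 / s * (y i * dot n (R i) y) + dot n y y / s\<^sup>2 * (y i * y i)" for i
  proof -
    have c: "dot n y (R i) = dot n (R i) y" by (rule dot_commute)
    show ?thesis unfolding rank1_row by (simp add: lin c power2_eq_square algebra_simps)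
  qed
  have "tr2 n (rank1 R y s) = tr2 n R + 2 / s * (\<Sum>i<n. y i * dot n (R i) y)
      + dot n y y / s\<^sup>2 * (\<Sum>i<n. y i * y i)"
    by (simp add: tr2_def row sum.distrib sum_distrib_left)
  also have "\<dots> = tr2 n R + 2 / s * dot n y (mv n R y) + dot n y y / s\<^sup>2 * dot n y y"
    unfolding sum_row by (simp add: dot_def[of n y y])
  finally show ?thesis by (simp add: power2_eq_square)
qed

text \<open>The triangle inequality for the Frobenius norm, in which the rank-one term has norm
  \<open>dot n y y / s\<close>; \<open>form_le\<close> bounds the cross term.\<close>

lemma sqrt_tr2_rank1:
  assumes "0 < s"
  shows "sqrt (tr2 n (rank1 R y s)) \<le> sqrt (tr2 n R) + dot n y y / s"
proof (rule real_le_lsqrt)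
  have "2 * dot n y (mv n R y) / s \<le> 2 * (sqrt (tr2 n R) * dot n y y) / s"
    using assms form_le[of n y R] by (intro divide_right_mono mult_left_mono) auto
  then show "tr2 n (rank1 R y s) \<le> (sqrt (tr2 n R) + dot n y y / s)\<^sup>2"
    using tr2_nonneg[of n R] by (simp add: tr2_rank1 power2_sum power_divide)
qed (use assms tr2_nonneg[of n R] in auto)

text \<open>In the product of three matrices the two outer factors are replaced first, which adds
  only nonnegative terms, and then the middle one, whose form only grows. Because of this
  monotonicity the gain of a later shift can be expressed by the matrix before the update.\<close>

lemma tr3_rank1:
  assumes "symm R" "psd n R" "0 < s"
  shows "tr3 n R \<le> tr3 n (rank1 R y s)"
proof -
  let ?P = "rank1 R y s"
  have "0 \<le> 2 / s * dot n (mv n R y) (mv n R y)" using assms by simp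
  also have "\<dots> = 2 / s * dot n y (mv n R (mv n R y))" by (simp add: dot_mv[OF assms(1)])
  also have "\<dots> = (\<Sum>i<n. 2 / s * (y i * dot n (R i) (mv n R y)))"
    by (simp only: sum_row[symmetric] sum_distrib_left)
  finally have 1: "0 \<le> (\<Sum>i<n. 2 / s * (y i * dot n (R i) (mv n R y)))" .
  have 2: "0 \<le> (\<Sum>i<n. (y i / s)\<^sup>2 * dot n y (mv n R y))"
    using assms by (intro sum_nonneg mult_nonneg_nonneg) (auto simp: psd_def)
  have "tr3 n R \<le> (\<Sum>i<n. dot n (R i) (mv n R (R i)) + 2 / s * (y i * dot n (R i) (mv n R y))
      + (y i / s)\<^sup>2 * dot n y (mv n R y))"
    unfolding sum.distrib using 1 2 by (simp only: tr3_def)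
  also have "\<dots> = (\<Sum>i<n. dot n (?P i) (mv n R (?P i)))"
  proof (intro sum.cong refl)
    fix i
    have "dot n y (mv n R (R i)) = dot n (R i) (mv n R y)"
      by (rule dot_mv_commute[OF assms(1)])
    then show "dot n (R i) (mv n R (R i)) + 2 / s * (y i * dot n (R i) (mv n R y))
      + (y i / s)\<^sup>2 * dot n y (mv n R y) = dot n (?P i) (mv n R (?P i))"
      unfolding rank1_row by (simp only: lin) (simp add: power2_eq_square algebra_simps)
  qed
  also have "\<dots> \<le> tr3 n ?P"
    unfolding tr3_def using assms by (intro sum_mono) (simp add: form_rank1)
  finally show ?thesis .
qed

text \<open>With \<open>Q = I - R\<close> this is \<open>I - (1 - h) (Q + h Q\<^sup>2 / 2)\<close>, a polynomial bound for the effect on the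
  resolvent of lowering the spectral parameter \<open>l\<close> to \<open>(1 - h) l\<close>.\<close>

definition shift :: "nat \<Rightarrow> real \<Rightarrow> (nat \<Rightarrow> nat \<Rightarrow> real) \<Rightarrow> nat \<Rightarrow> nat \<Rightarrow> real" where
  "shift n h R = (\<lambda>i j. (h + h\<^sup>2) / 2 * (if i = j then 1 else 0) + (1 - h\<^sup>2) * R i j
      - h * (1 - h) / 2 * dot n (R i) (R j))"

lemma symm_shift: "symm R \<Longrightarrow> symm (shift n h R)"
  by (auto simp: symm_def shift_def dot_commute)

lemma mv_shift:
  assumes "symm R" "i < n"
  shows "mv n (shift n h R) z i = (h + h\<^sup>2) / 2 * z i + (1 - h\<^sup>2) * mv n R z i
      - h * (1 - h) / 2 * mv n R (mv n R z) i"
proof -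
  have "mv n R (mv n R z) i = dot n (R i) (mv n R z)" by (simp add: mv_def dot_def)
  also have "\<dots> = dot n z (mv n R (R i))" by (rule dot_mv_commute[OF assms(1)])
  also have "\<dots> = (\<Sum>j<n. dot n (R i) (R j) * z j)"
    by (simp add: dot_def[of n z] mv_row dot_commute[of n "R i"] mult.commute)
  finally have *: "mv n R (mv n R z) i = (\<Sum>j<n. dot n (R i) (R j) * z j)" .
  have "mv n (shift n h R) z i = (\<Sum>j<n. (h + h\<^sup>2) / 2 * ((if i = j then 1 else 0) * z j)
     + (1 - h\<^sup>2) * (R i j * z j) - h * (1 - h) / 2 * (dot n (R i) (R j) * z j))"
    unfolding mv_def shift_def by (intro sum.cong refl) (simp add: algebra_simps)
  also have "\<dots> = (h + h\<^sup>2) / 2 * dot n (\<lambda>j. if i = j then 1 else 0) z + (1 - h\<^sup>2) * mv n R z i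
      - h * (1 - h) / 2 * mv n R (mv n R z) i"
    unfolding * by (simp only: sum.distrib sum_subtractf sum_distrib_left[symmetric] dot_def mv_def)
  finally show ?thesis by (simp add: dot_delta assms)
qed

lemma tr1_shift: "tr1 n (shift n h R) =
    (h + h\<^sup>2) / 2 * n + (1 - h\<^sup>2) * tr1 n R - h * (1 - h) / 2 * tr2 n R"
  by (simp add: tr1_def tr2_def shift_def sum.distrib sum_subtractf sum_distrib_left sum_divide_distrib)

lemma tr2_double: "tr2 n R = (\<Sum>i<n. \<Sum>j<n. (R i j)\<^sup>2)"
  by (simp add: tr2_def dot_def power2_eq_square)

lemma tr3_double: "tr3 n R = (\<Sum>i<n. \<Sum>j<n. R i j * dot n (R i) (R j))"
  unfolding tr3_def dot_def[of n "R _" "mv n R _"] by (simp add: mv_row dot_commute)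

lemma tr4_double: "tr4 n R = (\<Sum>i<n. \<Sum>j<n. (dot n (R i) (R j))\<^sup>2)"
  unfolding tr4_def dot_def[of n "mv n R _"] by (simp add: mv_row dot_commute power2_eq_square)

text \<open>The squared Frobenius norm of \<open>a I + b R - c R^2\<close>. It serves
  \<open>shift\<close> and, with other coefficients, \<open>I - R\<close> and its square.\<close>

lemma sum_combination_sq:
  fixes a b c :: real and R :: "nat \<Rightarrow> nat \<Rightarrow> real"
  shows "(\<Sum>i<n. \<Sum>j<n. (a * (if i = j then 1 else 0) + b * R i j - c * dot n (R i) (R j))\<^sup>2) =
    a\<^sup>2 * n + b\<^sup>2 * tr2 n R + c\<^sup>2 * tr4 n R + 2 * a * b * tr1 n R - 2 * a * c * tr2 n R - 2 * b * c * tr3 n R"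
proof -
  let ?e = "\<lambda>i j. if i = j then 1 else 0 :: real"
  have *: "(a * ?e i j + b * R i j - c * dot n (R i) (R j))\<^sup>2 =
      a\<^sup>2 * ?e i j + b\<^sup>2 * (R i j)\<^sup>2 + c\<^sup>2 * (dot n (R i) (R j))\<^sup>2 + 2 * a * b * (?e i j * R i j)
      - 2 * a * c * (?e i j * dot n (R i) (R j)) - 2 * b * c * (R i j * dot n (R i) (R j))" for i j
    by (simp add: power2_eq_square algebra_simps)
  have e: "(\<Sum>i<n. \<Sum>j<n. ?e i j * f i j) = (\<Sum>i<n. f i i)" for f :: "nat \<Rightarrow> nat \<Rightarrow> real"
    by (intro sum.cong refl) (auto simp: if_distrib[of "\<lambda>x. x * _"] cong: if_cong)
  have e1: "(\<Sum>i<n. \<Sum>j<n. ?e i j) = real n" using e[of "\<lambda>_ _. 1"] by simp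
  show ?thesis
    unfolding * sum.distrib sum_subtractf sum_distrib_left[symmetric] e e1
    by (simp add: tr1_def tr2_def[symmetric] tr2_double[of n R, symmetric] tr3_double[symmetric]
        tr4_double[of n R, symmetric])
qed

text \<open>The cross term \<open>- 2 * b * c * tr3\<close> is the gain. One half of it pays for
  \<open>c^2 * tr4\<close>, since \<open>tr4 \<le> sqrt tr2 * tr3\<close> and
  \<open>c * sqrt tr2 \<le> 1 / 2 \<le> b\<close>. The other half is at least
  \<open>h / 4 * tr3\<close>, because \<open>15 / 16 * 3 / 8\<close> exceeds
  \<open>1 / 4\<close>.\<close>

lemma tr2_shift:
  assumes "symm R" "psd n R" "0 < h" "h \<le> 1 / 4" "h * sqrt (tr2 n R) \<le> 1"
  shows "tr2 n (shift n h R) \<le> h\<^sup>2 * n + tr2 n R + 2 * h * tr1 n R - h / 4 * tr3 n R"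
proof -
  define a b c where "a = (h + h\<^sup>2) / 2" and "b = 1 - h\<^sup>2" and "c = h * (1 - h) / 2"
  have h2: "h\<^sup>2 \<le> h / 4" "0 \<le> h\<^sup>2" using assms(3,4) by (auto simp: power2_eq_square)
  have a: "0 \<le> a" "a \<le> h" using h2 assms(3) by (auto simp: a_def)
  have b: "15 / 16 \<le> b" "b \<le> 1" using h2 assms(3,4) by (auto simp: b_def)
  have c: "3 / 8 * h \<le> c" "c \<le> h / 2"
  proof -
    have "c = (h - h\<^sup>2) / 2" by (simp add: c_def power2_eq_square algebra_simps)
    then show "3 / 8 * h \<le> c" "c \<le> h / 2" using h2 by simp_all
  qed
  have t: "0 \<le> tr1 n R" "0 \<le> tr2 n R" "0 \<le> tr3 n R"
    using tr1_nonneg tr2_nonneg tr3_nonneg assms by blast+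
  have c4: "c\<^sup>2 * tr4 n R \<le> b * c * tr3 n R"
  proof -
    have "c\<^sup>2 * tr4 n R \<le> c\<^sup>2 * (sqrt (tr2 n R) * tr3 n R)"
      by (intro mult_left_mono tr4_le assms) simp
    also have "\<dots> = c * (c * sqrt (tr2 n R)) * tr3 n R" by (simp add: power2_eq_square)
    also have "\<dots> \<le> c * b * tr3 n R"
    proof (intro mult_right_mono mult_left_mono t)
      have "c * sqrt (tr2 n R) \<le> h / 2 * sqrt (tr2 n R)" using c t by (intro mult_right_mono) auto
      also have "\<dots> \<le> 1 / 2" using assms(5) by simp
      finally show "c * sqrt (tr2 n R) \<le> b" using b by simp
      show "0 \<le> c" using c assms(3) by simp
    qed
    finally show ?thesis by (simp add: mult_ac)
  qed
  have "tr2 n (shift n h R) = a\<^sup>2 * n + b\<^sup>2 * tr2 n R + c\<^sup>2 * tr4 n R + 2 * a * b * tr1 n R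
      - 2 * a * c * tr2 n R - 2 * b * c * tr3 n R"
    unfolding tr2_double[of n "shift n h R"]
    unfolding shift_def a_def[symmetric] b_def[symmetric] c_def[symmetric]
    by (rule sum_combination_sq)
  also have "\<dots> \<le> h\<^sup>2 * n + 1 * tr2 n R + b * c * tr3 n R + 2 * h * 1 * tr1 n R - 0 - 2 * b * c * tr3 n R"
    using a b c t assms(3)
    by (intro add_mono diff_mono mult_right_mono c4 power_mono mult_mono) (auto intro: power_le_one)
  also have "\<dots> = h\<^sup>2 * n + tr2 n R + 2 * h * tr1 n R - (b * c) * tr3 n R" by simp
  also have "\<dots> \<le> h\<^sup>2 * n + tr2 n R + 2 * h * tr1 n R - h / 4 * tr3 n R"
  proof -
    have "h / 4 \<le> 15 / 16 * (3 / 8 * h)" using assms(3) by simp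
    also have "\<dots> \<le> b * c" using b c assms(3) by (intro mult_mono) auto
    finally have "h / 4 * tr3 n R \<le> b * c * tr3 n R" by (rule mult_right_mono[OF _ t(3)])
    then show ?thesis by simp
  qed
  finally show ?thesis .
qed

text \<open>With \<open>w = X v\<close> and \<open>L = l |v|\<^sup>2\<close> the condition says that \<open>|z|\<^sup>2 - z\<^sup>T R z\<close> is at most
  \<open>|z - X v|\<^sup>2 - l |v|\<^sup>2\<close>; its instance \<open>z = 0\<close> is the bound on the singular value.\<close>

definition lower :: "nat \<Rightarrow> (nat \<Rightarrow> nat \<Rightarrow> real) \<Rightarrow> (nat \<Rightarrow> real) \<Rightarrow> real \<Rightarrow> bool" where
  "lower n R w L \<longleftrightarrow> (\<forall>z. 2 * dot n z w - dot n w w + L \<le> dot n z (mv n R z))"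

lemma psd_iff_lower: "psd n R \<longleftrightarrow> lower n R (\<lambda>_. 0) 0"
  by (simp add: psd_def lower_def lin)

lemma lower_norm: "lower n R w L \<Longrightarrow> L \<le> dot n w w"
  unfolding lower_def by (drule spec[of _ "\<lambda>_. 0"]) (simp add: lin)

text \<open>The hypothesis is used at \<open>z - a * x\<close>. The right-hand side is then a
  quadratic in the coefficient \<open>a\<close> of the new column, with leading coefficient minus
  the Schur complement of that column.\<close>

lemma lower_shift_column:
  assumes "symm R" "lower n R w L"
  shows "2 * dot n z (\<lambda>i. w i + a * x i) - dot n (\<lambda>i. w i + a * x i) (\<lambda>i. w i + a * x i) + (L + l * a\<^sup>2)
    \<le> dot n z (mv n R z) + 2 * a * dot n (\<lambda>i. x i - mv n R x i) z
       - a\<^sup>2 * (dot n x (\<lambda>i. x i - mv n R x i) - l)"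
proof -
  have "2 * dot n (\<lambda>i. z i - a * x i) w - dot n w w + L
     \<le> dot n (\<lambda>i. z i - a * x i) (mv n R (\<lambda>i. z i - a * x i))"
    using assms(2) unfolding lower_def by blast
  moreover have "dot n x (mv n R z) = dot n z (mv n R x)" "dot n (mv n R x) z = dot n z (mv n R x)"
    by (rule dot_mv_commute[OF assms(1)], rule dot_commute)
  ultimately show ?thesis
    by (simp add: lin dot_commute[of n x z] dot_commute[of n x w] power2_eq_square algebra_simps)
qed

text \<open>Maximising over \<open>a\<close> leaves \<open>(dot n y z)^2 / s\<close>, which is the
  form of the rank-one term. The updated matrix does not depend on \<open>a\<close>, so it serves
  all coefficient vectors at once.\<close>

lemma lower_rank1:
  fixes l a :: real and x :: "nat \<Rightarrow> real"
  assumes "symm R" "lower n R w L"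
  defines "y \<equiv> \<lambda>i. x i - mv n R x i"
  assumes s: "s = dot n x y - l" "0 < s"
  shows "lower n (rank1 R y s) (\<lambda>i. w i + a * x i) (L + l * a\<^sup>2)"
  unfolding lower_def
proof
  fix z
  have "0 \<le> (dot n y z - a * s)\<^sup>2 / s" using s by simp
  also have "\<dots> = (dot n y z)\<^sup>2 / s - 2 * a * dot n y z + a\<^sup>2 * s"
    using s(2) by (simp add: power2_eq_square field_simps)
  finally show "2 * dot n z (\<lambda>i. w i + a * x i) - dot n (\<lambda>i. w i + a * x i) (\<lambda>i. w i + a * x i) + (L + l * a\<^sup>2)
      \<le> dot n z (mv n (rank1 R y s) z)"
    using lower_shift_column[OF assms(1,2), of z a x l] unfolding form_rank1 y_def[symmetric] s(1)[symmetric]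
    by linarith
qed

text \<open>The witness \<open>y = z + h (z - R z)\<close> is a first-order approximation of the optimal one.\<close>

lemma lower_shift:
  assumes "symm R" "lower n R w L" and h: "0 < h" "h < 1"
    and bound: "\<And>q. 2 * h * dot n q (mv n R q) \<le> (2 * h + 1) * dot n q q"
  shows "lower n (shift n h R) w ((1 - h) * L)"
  unfolding lower_def
proof
  fix z
  define q where "q = (\<lambda>i. z i - mv n R z i)"
  define y where "y = (\<lambda>i. z i + h * q i)"
  \<comment> \<open>\<open>z\<close> is the convex combination \<open>(1 - h) y + h g\<close>. The
    hypothesis at \<open>y\<close> with weight \<open>1 - h\<close> and the trivial bound
    \<open>2 g w - |w|^2 \<le> |g|^2\<close> with weight \<open>h\<close> add up to the claim, and
    \<open>L\<close> receives the factor \<open>1 - h\<close>.\<close>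
  define g where "g = (\<lambda>i. z i - (1 - h) * q i)"
  have Rz: "mv n R z = (\<lambda>i. z i - q i)" by (simp add: q_def)
  let ?\<alpha> = "dot n z z" and ?\<beta> = "dot n z q" and ?\<gamma> = "dot n q q" and ?\<kappa> = "dot n q (mv n R q)"
  have qRz: "dot n z (mv n R q) = ?\<beta> - ?\<gamma>"
    using dot_mv_commute[OF assms(1), of n z q] by (simp add: Rz lin dot_commute[of n q z])
  have RRz: "dot n z (mv n R (mv n R z)) = ?\<alpha> - 2 * ?\<beta> + ?\<gamma>"
  proof -
    have "dot n z (mv n R (mv n R z)) = dot n (mv n R z) (mv n R z)"
      by (rule dot_mv[OF assms(1), symmetric])
    also have "\<dots> = ?\<alpha> - 2 * ?\<beta> + ?\<gamma>" by (simp add: Rz lin dot_commute[of n q z])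
    finally show ?thesis .
  qed
  have form: "2 * dot n z (mv n (shift n h R) z) =
     (h + h\<^sup>2) * ?\<alpha> + 2 * (1 - h\<^sup>2) * (?\<alpha> - ?\<beta>) - h * (1 - h) * (?\<alpha> - 2 * ?\<beta> + ?\<gamma>)"
  proof -
    have "dot n z (mv n (shift n h R) z) = dot n z (\<lambda>i. (h + h\<^sup>2) / 2 * z i + (1 - h\<^sup>2) * mv n R z i
      - h * (1 - h) / 2 * mv n R (mv n R z) i)"
      by (intro dot_cong refl mv_shift assms(1))
    also have "\<dots> = (h + h\<^sup>2) / 2 * ?\<alpha> + (1 - h\<^sup>2) * dot n z (mv n R z)
      - h * (1 - h) / 2 * dot n z (mv n R (mv n R z))" by (simp only: lin)
    also have "dot n z (mv n R z) = ?\<alpha> - ?\<beta>" by (simp add: Rz lin)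
    finally show ?thesis by (simp add: RRz)
  qed
  have yRy: "dot n y (mv n R y) = ?\<alpha> - ?\<beta> + 2 * h * (?\<beta> - ?\<gamma>) + h\<^sup>2 * ?\<kappa>"
    by (simp add: y_def lin qRz Rz dot_commute[of n q z] power2_eq_square algebra_simps)
  have gg: "dot n g g = ?\<alpha> - 2 * (1 - h) * ?\<beta> + (1 - h)\<^sup>2 * ?\<gamma>"
    by (simp add: g_def lin dot_commute[of n q z] power2_eq_square algebra_simps)
  \<comment> \<open>This explains the coefficients of \<open>shift\<close>: its form at
    \<open>z\<close> exceeds the weighted sum by exactly \<open>h (1 - h) / 2\<close> times the
    quantity that \<open>bound\<close> makes nonnegative.\<close>
  have key: "(1 - h) * dot n y (mv n R y) + h * dot n g g \<le> dot n z (mv n (shift n h R) z)"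
  proof -
    have "2 * dot n z (mv n (shift n h R) z) - 2 * ((1 - h) * dot n y (mv n R y) + h * dot n g g)
      = (1 - h) * h * ((2 * h + 1) * ?\<gamma> - 2 * h * ?\<kappa>)"
      unfolding form yRy gg by algebra
    also have "\<dots> \<ge> 0" using h bound[of q] by (intro mult_nonneg_nonneg) auto
    finally show ?thesis by simp
  qed
  have zy: "dot n z w - (1 - h) * dot n y w = h * dot n g w"
    by (simp add: y_def g_def lin algebra_simps)
  have cs: "0 \<le> h * dot n (\<lambda>i. w i - g i) (\<lambda>i. w i - g i)" using h by simp
  have "(1 - h) * (2 * dot n y w - dot n w w + L) \<le> (1 - h) * dot n y (mv n R y)"
    using assms(2) h unfolding lower_def by (intro mult_left_mono) auto
  with key cs zy show "2 * dot n z w - dot n w w + (1 - h) * L \<le> dot n z (mv n (shift n h R) z)"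
    by (simp add: lin dot_commute[of n w g] algebra_simps)
qed

lemma bound_if_tr2_small:
  assumes "0 < h" "2 * h * sqrt (tr2 n R) \<le> 1"
  shows "2 * h * dot n q (mv n R q) \<le> (2 * h + 1) * dot n q q"
proof -
  have "2 * h * dot n q (mv n R q) \<le> 2 * h * (sqrt (tr2 n R) * dot n q q)"
    using assms(1) by (intro mult_left_mono form_le) auto
  also have "\<dots> = (2 * h * sqrt (tr2 n R)) * dot n q q" by simp
  also have "\<dots> \<le> (2 * h + 1) * dot n q q"
    using assms by (intro mult_right_mono) auto
  finally show ?thesis .
qed

subsection \<open>Adding one column\<close>

definition resid :: "nat \<Rightarrow> (nat \<Rightarrow> nat \<Rightarrow> real) \<Rightarrow> (nat \<Rightarrow> real) \<Rightarrow> nat \<Rightarrow> real" where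
  "resid n R x = (\<lambda>i. x i - mv n R x i)"

definition step :: "nat \<Rightarrow> real \<Rightarrow> real \<Rightarrow> (nat \<Rightarrow> nat \<Rightarrow> real) \<Rightarrow> (nat \<Rightarrow> real) \<Rightarrow> nat \<Rightarrow> nat \<Rightarrow> real" where
  "step n h l R x = shift n h (rank1 R (resid n R x) (dot n x (resid n R x) - l))"

text \<open>The first condition keeps the divisor of the rank-one update away from 0: the mean
  \<open>n - tr1 n R\<close> will be at least \<open>3 r / 4\<close>, from which
  \<open>l \<le> r / 8\<close> and a fluctuation of \<open>r / 8\<close> are subtracted. The second
  keeps the Frobenius norm after the update small enough for the shift.\<close>

definition good :: "nat \<Rightarrow> real \<Rightarrow> real \<Rightarrow> real \<Rightarrow> (nat \<Rightarrow> nat \<Rightarrow> real) \<Rightarrow> (nat \<Rightarrow> real) \<Rightarrow> bool" where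
  "good n r h l R x \<longleftrightarrow> r / 2 \<le> dot n x (resid n R x) - l \<and>
     dot n (resid n R x) (resid n R x) \<le> r / (8 * h)"

text \<open>The conditions for the shift reduce to \<open>2 h |P| \<le> 1\<close> for the Frobenius
  norm of the updated matrix \<open>P\<close>: the old matrix and the rank-one term contribute at
  most \<open>1 / (4 h)\<close> each. In the trace bounds the divisor is replaced by its lower bound
  \<open>r / 2\<close>, which gives the factors \<open>4 / r\<close> and
  \<open>4 / r^2\<close>.\<close>

lemma step_bounds:
  assumes R: "symm R" "psd n R" and h: "0 < h" "h \<le> 1 / 4" and r: "0 < r"
    and A: "tr2 n R \<le> A" "sqrt A \<le> 1 / (4 * h)"
    and g: "good n r h l R x"
  defines "y \<equiv> resid n R x"
  shows "symm (step n h l R x)" (is ?sym)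
    and "psd n (step n h l R x)" (is ?psd)
    and "lower n R w L \<Longrightarrow> lower n (step n h l R x) (\<lambda>i. w i + a * x i) ((1 - h) * (L + l * a\<^sup>2))"
    and "tr2 n (step n h l R x) \<le> tr2 n R + h\<^sup>2 * n + 4 / r * dot n y (mv n R y) + 4 / r\<^sup>2 * (dot n y y)\<^sup>2
       + 2 * h * tr1 n R + 4 * h / r * dot n y y - h / 4 * tr3 n R" (is ?tr2)
    and "tr1 n (step n h l R x) \<le> h * n + tr1 n R + 2 / r * dot n y y - h / 4 * tr2 n R" (is ?tr1)
proof -
  define s where "s = dot n x y - l"
  define P where "P = rank1 R y s"
  have stp: "step n h l R x = shift n h P" by (simp add: step_def P_def s_def y_def)
  have s: "r / 2 \<le> s" "0 < s" and u: "dot n y y \<le> r / (8 * h)"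
    using g r by (auto simp: good_def s_def y_def)
  have inv: "1 / s \<le> 2 / r" using s r by (simp add: field_simps)
  have P: "symm P" "psd n P" using R s by (auto simp: P_def symm_rank1 psd_rank1)
  have us: "dot n y y / s \<le> 2 / r * dot n y y"
    using mult_right_mono[OF inv, of "dot n y y"] by simp
  have sq: "sqrt (tr2 n P) \<le> sqrt A + 2 / r * dot n y y"
    using sqrt_tr2_rank1[OF s(2), of n R y] us real_sqrt_le_mono[OF A(1)] unfolding P_def by linarith
  have "2 / r * dot n y y \<le> 2 / r * (r / (8 * h))" using u r by (intro mult_left_mono) auto
  also have "\<dots> = 1 / (4 * h)" using r h by (simp add: field_simps)
  finally have "2 * h * sqrt (tr2 n P) \<le> 2 * h * (1 / (4 * h) + 1 / (4 * h))"
    using sq A(2) h by (intro mult_left_mono) auto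
  also have "\<dots> = 1" using h by (simp add: field_simps)
  finally have hP: "2 * h * sqrt (tr2 n P) \<le> 1" .
  note bd = bound_if_tr2_small[OF h(1) hP]
  have h1: "h < 1" using h by simp
  show ?sym unfolding stp by (rule symm_shift[OF P(1)])
  have "lower n (shift n h P) (\<lambda>_. 0) ((1 - h) * 0)"
    by (rule lower_shift[OF P(1) _ h(1) h1 bd]) (use P psd_iff_lower in auto)
  then show ?psd unfolding stp psd_iff_lower by simp
  show "lower n (step n h l R x) (\<lambda>i. w i + a * x i) ((1 - h) * (L + l * a\<^sup>2))" if "lower n R w L"
    unfolding stp
  proof (rule lower_shift[OF P(1) _ h(1) h1 bd])
    show "lower n P (\<lambda>i. w i + a * x i) (L + l * a\<^sup>2)"
      using lower_rank1[OF R(1) that, of s x l a] s(2)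
      unfolding P_def y_def[unfolded resid_def] s_def by simp
  qed
  have t1: "tr1 n P \<le> tr1 n R + 2 / r * dot n y y" using us by (simp add: P_def tr1_rank1)
  have yRy: "0 \<le> dot n y (mv n R y)" using R by (simp add: psd_def)
  have inv2: "1 / s\<^sup>2 \<le> 4 / r\<^sup>2"
    using power_mono[OF inv, of 2] s(2) r by (simp add: power_divide)
  have t2: "tr2 n P \<le> tr2 n R + 4 / r * dot n y (mv n R y) + 4 / r\<^sup>2 * (dot n y y)\<^sup>2"
    using mult_right_mono[OF inv, of "2 * dot n y (mv n R y)"] mult_right_mono[OF inv2, of "(dot n y y)\<^sup>2"] yRy
    by (simp add: P_def tr2_rank1)
  have t3: "tr3 n R \<le> tr3 n P" unfolding P_def by (rule tr3_rank1[OF R s(2)])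
  have "h * sqrt (tr2 n P) \<le> 1"
    using hP mult_nonneg_nonneg[of h "sqrt (tr2 n P)"] tr2_nonneg[of n P] h by simp
  from tr2_shift[OF P h this]
  have "tr2 n (step n h l R x) \<le> h\<^sup>2 * n + tr2 n P + 2 * h * tr1 n P - h / 4 * tr3 n P"
    by (simp add: stp)
  also have "\<dots> \<le> h\<^sup>2 * n + (tr2 n R + 4 / r * dot n y (mv n R y) + 4 / r\<^sup>2 * (dot n y y)\<^sup>2)
      + 2 * h * (tr1 n R + 2 / r * dot n y y) - h / 4 * tr3 n R"
    using t1 t2 t3 h by (intro add_mono diff_mono mult_left_mono) auto
  also have "\<dots> = tr2 n R + h\<^sup>2 * n + 4 / r * dot n y (mv n R y) + 4 / r\<^sup>2 * (dot n y y)\<^sup>2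
       + 2 * h * tr1 n R + 4 * h / r * dot n y y - h / 4 * tr3 n R"
    by (simp add: algebra_simps)
  finally show ?tr2 .
  have GP: "tr2 n R \<le> tr2 n P"
    using yRy s(2) by (simp add: P_def tr2_rank1 add_nonneg_nonneg)
  have h2: "0 \<le> h\<^sup>2" "h\<^sup>2 \<le> h / 4" using h by (auto simp: power2_eq_square)
  have "tr1 n (step n h l R x) = (h + h\<^sup>2) / 2 * n + (1 - h\<^sup>2) * tr1 n P - h * (1 - h) / 2 * tr2 n P"
    by (simp add: stp tr1_shift)
  also have "\<dots> \<le> h * n + 1 * tr1 n P - h / 4 * tr2 n R"
  proof (intro add_mono diff_mono mult_right_mono mult_mono GP)
    have "h * (1 - h) = h - h\<^sup>2" by (simp add: power2_eq_square algebra_simps)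
    then show "h / 4 \<le> h * (1 - h) / 2" "0 \<le> h * (1 - h) / 2" using h2 h by auto
  qed (use h2 h tr1_nonneg[OF P] tr2_nonneg in auto)
  also have "\<dots> \<le> h * n + (tr1 n R + 2 / r * dot n y y) - h / 4 * tr2 n R" using t1 by simp
  finally show ?tr1 by simp
qed

text \<open>The value of \<open>h\<close> makes the term \<open>- h / 8 * tr3\<close> gained by the shift absorb the growth of \<open>tr2\<close>
  caused by the rank-one update; \<open>D\<close> bounds the expected growth of \<open>tr1\<close> and \<open>b\<close> the failure
  probability and the loss in the Lyapunov function per column.\<close>

locale barrier =
  fixes n :: nat and r A h \<Gamma> b D :: real
  assumes r: "0 < r" "r \<le> n" and h_def: "h = 128 * n / r\<^sup>2" and h: "h \<le> 1 / 4"
    and A: "n \<le> A" "A \<le> n * r" "sqrt A \<le> 1 / (4 * h)" "4 * A \<le> r / (8 * h)"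
    and \<Gamma>: "1 \<le> \<Gamma>" "\<Gamma> * (3 + sqrt A) \<le> n"
    and small: "16384 * \<Gamma>\<^sup>2 * A\<^sup>2 / r ^ 4 + 1024 * \<Gamma> * A\<^sup>2 * h\<^sup>2 / r\<^sup>2 \<le> 1 / 2"
    and b_def: "b = 16384 * \<Gamma>\<^sup>2 * A\<^sup>2 / r ^ 4 + 1024 * \<Gamma> * A\<^sup>2 * h\<^sup>2 / r\<^sup>2 + 1330 * (n / r)\<^sup>2 / A
        + 1024 * \<Gamma> * A\<^sup>2 / r ^ 4"
    and D_def: "D = h * n + 2 * n / r"
begin

text \<open>An upper bound for the probability that one of the next \<open>k\<close> columns fails, given the state \<open>R\<close>.\<close>

definition lyap :: "real \<Rightarrow> nat \<Rightarrow> (nat \<Rightarrow> nat \<Rightarrow> real) \<Rightarrow> real" where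
  "lyap \<theta> k R = tr2 n R / A + 64 / r\<^sup>2 * (max 0 (tr1 n R + D * k - \<theta>))\<^sup>2 + k * b"

lemma pos: "0 < real n" "0 < h" "0 < A" "0 \<le> b" "0 \<le> D"
proof -
  show n: "0 < real n" using r by linarith
  show hp: "0 < h" using n r by (simp add: h_def)
  show "0 < A" using n A by linarith
  then show "0 \<le> b" using \<Gamma> by (auto simp: b_def intro!: add_nonneg_nonneg divide_nonneg_nonneg mult_nonneg_nonneg)
  show "0 \<le> D" using hp r n by (simp add: D_def)
qed

lemma lyap_nonneg: "0 \<le> lyap \<theta> k R"
  using pos tr2_nonneg[of n R] by (simp add: lyap_def)

text \<open>The weights \<open>1 / A\<close> and \<open>64 / r^2\<close> are normalised for this. As
  soon as a trace leaves its range the claimed probability bound is trivial, which replaces a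
  stopping time.\<close>

lemma lyap_ge_1:
  assumes "A < tr2 n R \<or> r / 8 < tr1 n R + D * k - \<theta>"
  shows "1 \<le> lyap \<theta> k R"
  using assms
proof
  assume "A < tr2 n R"
  then have "1 \<le> tr2 n R / A" using pos by simp
  then show ?thesis using pos unfolding lyap_def by (smt (verit) mult_nonneg_nonneg of_nat_0_le_iff divide_nonneg_nonneg zero_le_power2)
next
  assume "r / 8 < tr1 n R + D * k - \<theta>"
  then have "(r / 8)\<^sup>2 \<le> (max 0 (tr1 n R + D * k - \<theta>))\<^sup>2" using r by (intro power_mono) auto
  then have "64 / r\<^sup>2 * (r / 8)\<^sup>2 \<le> 64 / r\<^sup>2 * (max 0 (tr1 n R + D * k - \<theta>))\<^sup>2"
    by (intro mult_left_mono) auto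
  moreover have "64 / r\<^sup>2 * (r / 8)\<^sup>2 = 1" using r by (simp add: power_divide)
  moreover have "0 \<le> tr2 n R / A" "0 \<le> k * b" using pos tr2_nonneg[of n R] by auto
  ultimately show ?thesis unfolding lyap_def by linarith
qed

end

section \<open>Quadratic forms in the new column and the supermartingale step\<close>

lemma form_as_double_sum:
  fixes q :: "nat \<Rightarrow> nat \<Rightarrow> real"
  assumes "symm q"
  shows "dot n (mv n q x) (mv n R (mv n q x)) = (\<Sum>j<n. \<Sum>k<n. dot n (q j) (mv n R (q k)) * x j * x k)"
proof -
  have e: "mv n q x = (\<lambda>i. \<Sum>j<n. x j * q j i)"
    using assms by (auto simp: mv_def symm_def mult.commute)
  have sl: "dot n (\<lambda>i. \<Sum>j<m. x j * q j i) v = (\<Sum>j<m. x j * dot n (q j) v)" for m v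
    by (induction m) (simp_all add: lin)
  have sa: "dot n v (mv n R (\<lambda>i. \<Sum>j<m. x j * q j i)) = (\<Sum>j<m. x j * dot n v (mv n R (q j)))" for m v
    by (induction m) (simp_all add: lin)
  show ?thesis unfolding e sl sa
    by (simp add: sum_distrib_left mult_ac)
qed

definition compl :: "(nat \<Rightarrow> nat \<Rightarrow> real) \<Rightarrow> nat \<Rightarrow> nat \<Rightarrow> real" where
  "compl R = (\<lambda>i j. (if i = j then 1 else 0) - R i j)"

lemma symm_compl: "symm R \<Longrightarrow> symm (compl R)"
  by (auto simp: symm_def compl_def)

lemma mv_compl: "i < n \<Longrightarrow> mv n (compl R) x i = resid n R x i"
  by (simp add: mv_def compl_def resid_def left_diff_distrib sum_subtractf
      if_distrib[of "\<lambda>x. x * _"] cong: if_cong)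

lemma mv_cong: "(\<And>i. i < n \<Longrightarrow> u i = v i) \<Longrightarrow> mv n R u = mv n R v"
  by (auto simp: mv_def)

lemma mv_identity: "i < n \<Longrightarrow> mv n (\<lambda>i j. if i = j then 1 else 0) v i = v i"
  by (simp add: mv_def if_distrib[of "\<lambda>x. x * _"] cong: if_cong)

text \<open>With \<open>Q = I - R\<close> the matrices of the three forms are \<open>Q\<close>,
  \<open>Q^2\<close> and \<open>Q R Q\<close>. They do not involve \<open>x\<close>, so the moment
  bounds apply to a column that is independent of \<open>R\<close>.\<close>

lemma resid_forms:
  assumes "symm R"
  shows "dot n x (resid n R x) = (\<Sum>j<n. \<Sum>k<n. compl R j k * x j * x k)"
    and "dot n (resid n R x) (resid n R x) = (\<Sum>j<n. \<Sum>k<n. dot n (compl R j) (compl R k) * x j * x k)"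
    and "dot n (resid n R x) (mv n R (resid n R x)) =
      (\<Sum>j<n. \<Sum>k<n. dot n (compl R j) (mv n R (compl R k)) * x j * x k)"
proof -
  note s = symm_compl[OF assms]
  have "dot n x (resid n R x) = dot n x (mv n (compl R) x)"
    by (intro dot_cong refl) (simp add: mv_compl)
  also have "\<dots> = (\<Sum>j<n. \<Sum>k<n. compl R j k * x j * x k)"
    by (simp add: dot_def mv_def sum_distrib_left mult_ac)
  finally show "dot n x (resid n R x) = (\<Sum>j<n. \<Sum>k<n. compl R j k * x j * x k)" .
  have "dot n (resid n R x) (mv n R (resid n R x)) = dot n (mv n (compl R) x) (mv n R (mv n (compl R) x))"
    by (intro dot_cong) (simp_all add: mv_compl cong: mv_cong)
  then show "dot n (resid n R x) (mv n R (resid n R x)) =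
      (\<Sum>j<n. \<Sum>k<n. dot n (compl R j) (mv n R (compl R k)) * x j * x k)"
    unfolding form_as_double_sum[OF s] .
  let ?I = "\<lambda>i j. if i = j then 1 else 0 :: real"
  have "dot n (resid n R x) (resid n R x) = dot n (mv n (compl R) x) (mv n ?I (mv n (compl R) x))"
    by (intro dot_cong) (simp_all add: mv_compl mv_identity)
  also have "\<dots> = (\<Sum>j<n. \<Sum>k<n. dot n (compl R j) (mv n ?I (compl R k)) * x j * x k)"
    by (rule form_as_double_sum[OF s])
  also have "\<dots> = (\<Sum>j<n. \<Sum>k<n. dot n (compl R j) (compl R k) * x j * x k)"
  proof (intro sum.cong refl)
    fix j k
    have "dot n (compl R j) (mv n ?I (compl R k)) = dot n (compl R j) (compl R k)"
      by (intro dot_cong refl mv_identity)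
    then show "dot n (compl R j) (mv n ?I (compl R k)) * x j * x k = dot n (compl R j) (compl R k) * x j * x k"
      by simp
  qed
  finally show "dot n (resid n R x) (resid n R x) =
    (\<Sum>j<n. \<Sum>k<n. dot n (compl R j) (compl R k) * x j * x k)" .
qed

text \<open>The first, second and last formula are the means of the three forms in
  \<open>resid_forms\<close>. Moreover \<open>tr2\<close> and \<open>tr4\<close> of
  \<open>I - R\<close> are the squared Frobenius norms that bound the fluctuations of the first
  two.\<close>

lemma compl_traces:
  assumes "symm R"
  shows "(\<Sum>i<n. compl R i i) = n - tr1 n R"
    and "tr2 n (compl R) = n - 2 * tr1 n R + tr2 n R"
    and "tr4 n (compl R) = n - 4 * tr1 n R + 6 * tr2 n R - 4 * tr3 n R + tr4 n R"
    and "(\<Sum>i<n. dot n (compl R i) (mv n R (compl R i))) = tr1 n R - 2 * tr2 n R + tr3 n R"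
proof -
  show "(\<Sum>i<n. compl R i i) = n - tr1 n R"
    by (simp add: compl_def tr1_def sum_subtractf)
  have c: "compl R = (\<lambda>i j. 1 * (if i = j then 1 else 0) + (- 1) * R i j - 0 * dot n (R i) (R j))"
    by (simp add: compl_def)
  show "tr2 n (compl R) = n - 2 * tr1 n R + tr2 n R"
    unfolding tr2_double[of n "compl R"] unfolding c sum_combination_sq by simp
  have row: "compl R i = (\<lambda>j. (if i = j then 1 else 0) - R i j)" for i by (simp add: compl_def)
  have ipc: "dot n (compl R i) (compl R j) =
     1 * (if i = j then 1 else 0) + (- 2) * R i j - (- 1) * dot n (R i) (R j)" if "i < n" "j < n" for i j
  proof -
    have c: "R j i = R i j" using assms by (simp add: symm_def)
    show ?thesis using that by (simp add: row lin dot_delta c)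
  qed
  have "tr4 n (compl R) = (\<Sum>i<n. \<Sum>j<n. (1 * (if i = j then 1 else 0) + (- 2) * R i j
      - (- 1) * dot n (R i) (R j))\<^sup>2)"
    unfolding tr4_double[of n "compl R"] by (intro sum.cong refl) (simp only: ipc lessThan_iff)
  also have "\<dots> = n - 4 * tr1 n R + 6 * tr2 n R - 4 * tr3 n R + tr4 n R"
    unfolding sum_combination_sq by simp
  finally show "tr4 n (compl R) = n - 4 * tr1 n R + 6 * tr2 n R - 4 * tr3 n R + tr4 n R" .
  have "dot n (compl R i) (mv n R (compl R i)) = R i i - 2 * dot n (R i) (R i) + dot n (R i) (mv n R (R i))"
    if "i < n" for i
  proof -
    have d: "mv n R (R i) i = dot n (R i) (R i)" by (rule mv_row)
    show ?thesis using that unfolding row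
      by (simp only: lin mv_delta[OF assms]) (simp add: dot_delta d)
  qed
  then show "(\<Sum>i<n. dot n (compl R i) (mv n R (compl R i))) = tr1 n R - 2 * tr2 n R + tr3 n R"
    by (simp add: tr1_def tr2_def tr3_def sum.distrib sum_subtractf sum_distrib_left)
qed

lemma tr4_le_tr2_sq: "tr4 n R \<le> (tr2 n R)\<^sup>2"
proof -
  have "tr4 n R \<le> (\<Sum>i<n. \<Sum>j<n. dot n (R i) (R i) * dot n (R j) (R j))"
    unfolding tr4_double by (intro sum_mono dot_cauchy)
  then show ?thesis by (simp add: tr2_def power2_eq_square sum_product)
qed

locale barrier_column = indep_coordinates M \<xi> n K + barrier n r A h "184 * K" b D
  for M :: "'a measure" and \<xi> n K r A h b D
begin

text \<open>Each quantity gets the moments that the drift estimate requires: the fourth for the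
  Schur complement, whose failures must be rare; the second for \<open>|y|^2\<close>, which enters
  squared; the mean alone for the form of \<open>R\<close> at \<open>y\<close>, which enters
  linearly.\<close>

lemma residual_moments:
  assumes R: "symm R"
  defines "x \<equiv> \<lambda>\<omega> i. \<xi> i \<omega>"
  defines "s \<equiv> \<lambda>\<omega>. dot n (x \<omega>) (resid n R (x \<omega>)) - (n - tr1 n R)"
    and "u \<equiv> \<lambda>\<omega>. dot n (resid n R (x \<omega>)) (resid n R (x \<omega>)) - tr2 n (compl R)"
    and "w \<equiv> \<lambda>\<omega>. dot n (resid n R (x \<omega>)) (mv n R (resid n R (x \<omega>))) - (tr1 n R - 2 * tr2 n R + tr3 n R)"
  shows "integrable M (\<lambda>\<omega>. s \<omega> ^ 4)" "expectation (\<lambda>\<omega>. s \<omega> ^ 4) \<le> (184 * K * tr2 n (compl R))\<^sup>2"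
    and "integrable M u" "expectation u = 0"
    and "integrable M (\<lambda>\<omega>. u \<omega> ^ 2)" "expectation (\<lambda>\<omega>. u \<omega> ^ 2) \<le> 184 * K * tr4 n (compl R)"
    and "integrable M w" "expectation w = 0"
proof -
  note sc = symm_compl[OF R]
  have s: "s = (\<lambda>\<omega>. (\<Sum>j<n. \<Sum>k<n. compl R j k * \<xi> j \<omega> * \<xi> k \<omega>) - (\<Sum>j<n. compl R j j))"
    by (simp add: s_def resid_forms[OF R] compl_traces[OF R] x_def)
  have u: "u = (\<lambda>\<omega>. (\<Sum>j<n. \<Sum>k<n. dot n (compl R j) (compl R k) * \<xi> j \<omega> * \<xi> k \<omega>)
      - (\<Sum>j<n. dot n (compl R j) (compl R j)))"
    by (simp add: u_def resid_forms[OF R] tr2_def x_def)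
  have w: "w = (\<lambda>\<omega>. (\<Sum>j<n. \<Sum>k<n. dot n (compl R j) (mv n R (compl R k)) * \<xi> j \<omega> * \<xi> k \<omega>)
      - (\<Sum>j<n. dot n (compl R j) (mv n R (compl R j))))"
    by (simp add: w_def resid_forms[OF R] compl_traces[OF R] x_def)
  have 1: "compl R j k = compl R k j" for j k using sc by (simp add: symm_def)
  have 2: "dot n (compl R j) (compl R k) = dot n (compl R k) (compl R j)" for j k by (rule dot_commute)
  have 3: "dot n (compl R j) (mv n R (compl R k)) = dot n (compl R k) (mv n R (compl R j))" for j k
    by (rule dot_mv_commute[OF R])
  note q1 = quadratic_form_moments[of "compl R", OF 1, folded s tr2_double]
  note q2 = quadratic_form_moments[of "\<lambda>j k. dot n (compl R j) (compl R k)", OF 2, folded u tr4_double]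
  note q3 = quadratic_form_moments[of "\<lambda>j k. dot n (compl R j) (mv n R (compl R k))", OF 3, folded w]
  show "integrable M (\<lambda>\<omega>. s \<omega> ^ 4)" "expectation (\<lambda>\<omega>. s \<omega> ^ 4) \<le> (184 * K * tr2 n (compl R))\<^sup>2"
    using q1(1)[of 4] q1(4) by (simp_all add: s)
  show "integrable M u" "expectation u = 0" by (rule q2(2), rule q2(3))
  show "integrable M (\<lambda>\<omega>. u \<omega> ^ 2)" "expectation (\<lambda>\<omega>. u \<omega> ^ 2) \<le> 184 * K * tr4 n (compl R)"
    using q2(1)[of 2] q2(5) by (simp_all add: u)
  show "integrable M w" "expectation w = 0" by (rule q3(2), rule q3(3))
qed

text \<open>One integrable majorant \<open>g\<close> covers good and bad columns alike. It is a
  polynomial in the centred quantities \<open>s\<close>, \<open>u\<close> and \<open>w\<close>, so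
  the terms linear in \<open>u\<close> and \<open>w\<close> vanish in its mean, whereas they would
  survive a restriction to the good event.\<close>

lemma lyap_step:
  assumes R: "symm R" "psd n R" and l: "l \<le> r / 8"
    and alive: "tr2 n R \<le> A" "tr1 n R \<le> n - 3 * r / 4"
  shows "\<exists>g. integrable M g \<and> expectation g \<le> lyap \<theta> (Suc k) R \<and>
    (\<forall>\<omega>. (if good n r h l R (\<lambda>i. \<xi> i \<omega>) then lyap \<theta> k (step n h l R (\<lambda>i. \<xi> i \<omega>)) else 1) \<le> g \<omega>)"
proof -
  define \<tau> G N F H where "\<tau> = tr1 n R" and "G = tr2 n R" and "N = tr3 n R"
    and "F = tr2 n (compl R)" and "H = tr4 n (compl R)"
  define \<Gamma>' where "\<Gamma>' = 184 * K"
  define x where "x \<omega> = (\<lambda>i. \<xi> i \<omega>)" for \<omega>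
  define y where "y \<omega> = resid n R (x \<omega>)" for \<omega>
  define s where "s \<omega> = dot n (x \<omega>) (y \<omega>) - (n - \<tau>)" for \<omega>
  define u where "u \<omega> = dot n (y \<omega>) (y \<omega>) - F" for \<omega>
  define w where "w \<omega> = dot n (y \<omega>) (mv n R (y \<omega>)) - (\<tau> - 2 * G + N)" for \<omega>
  note mom = residual_moments[OF R(1), folded F_def H_def \<tau>_def G_def N_def, folded x_def,
    folded y_def, folded s_def u_def w_def \<Gamma>'_def]
  have nn: "0 \<le> \<tau>" "0 \<le> G" "0 \<le> N" "0 \<le> F" "0 \<le> H" "1 \<le> \<Gamma>'"
    using tr1_nonneg[OF R] tr2_nonneg tr3_nonneg[OF R(2)] \<Gamma>(1)
    by (auto simp: \<tau>_def G_def N_def F_def H_def \<Gamma>'_def tr4_def intro: sum_nonneg)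
  note ps = pos r
  have nr: "1 \<le> real n" using ps by simp
  have FF: "F = n - 2 * \<tau> + G" and HH: "H = n - 4 * \<tau> + 6 * G - 4 * N + tr4 n R"
    by (simp_all add: F_def H_def \<tau>_def G_def N_def compl_traces[OF R(1)])
  have \<tau>n: "\<tau> \<le> n" using alive(2) r by (simp add: \<tau>_def)
  have GA: "G \<le> A" using alive by (simp add: G_def)
  have F_le: "F \<le> n + G" "F \<le> 2 * A" using FF nn GA A(1) by linarith+
  have G2: "G\<^sup>2 \<le> n * N"
    using tr2_sq_le[OF R] mult_right_mono[OF \<tau>n nn(3)] by (simp add: G_def \<tau>_def N_def)
  have G_le: "2 * G \<le> n + N"
  proof (rule power2_le_imp_le)
    have "4 * (n * N) \<le> (n + N)\<^sup>2"
      using sum_squares_ge_zero[of "n - N" 0] by (simp add: power2_eq_square algebra_simps)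
    then show "(2 * G)\<^sup>2 \<le> (n + N)\<^sup>2" using G2 by (simp add: power_mult_distrib)
  qed (use nn in simp)
  have "tr4 n R \<le> sqrt G * N" using tr4_le[OF R] by (simp add: G_def N_def)
  also have "\<dots> \<le> sqrt A * N" using GA nn by (intro mult_right_mono) auto
  finally have H_le: "H \<le> 4 * n + (3 + sqrt A) * N"
    using HH G_le nn by (simp add: algebra_simps)
  have \<Gamma>'n: "\<Gamma>' * (3 + sqrt A) \<le> n" using \<Gamma>(2) by (simp add: \<Gamma>'_def)
  have \<Gamma>'4: "4 * \<Gamma>' \<le> n"
  proof -
    have "1 \<le> sqrt A" using nr A(1) by simp
    then have "\<Gamma>' * 4 \<le> \<Gamma>' * (3 + sqrt A)" using nn(6) by (intro mult_left_mono) auto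
    then show ?thesis using \<Gamma>'n by simp
  qed
  have \<Gamma>H: "\<Gamma>' * H \<le> n\<^sup>2 + n * N"
  proof -
    have "\<Gamma>' * H \<le> \<Gamma>' * (4 * n + (3 + sqrt A) * N)" using H_le nn by (intro mult_left_mono) auto
    also have "\<dots> = (4 * \<Gamma>') * n + (\<Gamma>' * (3 + sqrt A)) * N" by (simp add: algebra_simps)
    also have "\<dots> \<le> n * n + n * N" using \<Gamma>'4 \<Gamma>'n nn ps by (intro add_mono mult_right_mono) auto
    finally show ?thesis by (simp add: power2_eq_square)
  qed
  have F2: "F\<^sup>2 \<le> 2 * n\<^sup>2 + 2 * (n * N)"
  proof -
    have "F\<^sup>2 \<le> (n + G)\<^sup>2" using F_le nn by (intro power_mono) auto
    also have "\<dots> \<le> 2 * n\<^sup>2 + 2 * G\<^sup>2" using sum_squares_bound[of "real n" G] by (simp add: power2_sum)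
    finally show ?thesis using G2 by simp
  qed
  have F2A: "F\<^sup>2 \<le> 4 * A\<^sup>2" using power_mono[OF F_le(2) nn(4), of 2] by (simp add: power_mult_distrib)
  have H2A: "H \<le> 4 * A\<^sup>2" using tr4_le_tr2_sq[of n "compl R"] F2A by (simp add: F_def H_def)
  define Y where "Y = r / (8 * h)"
  have Y: "0 < Y" "F \<le> Y / 2" using ps A(4) F_le(2) by (auto simp: Y_def)
  \<comment> \<open>A majorant of the indicator of failure. If the Schur complement is too small
    then \<open>s < - r / 8\<close>, because \<open>n - \<tau> \<ge> 3 r / 4\<close> and
    \<open>l \<le> r / 8\<close>; if \<open>|y|^2\<close> is too large then
    \<open>u > Y / 2\<close>, because its mean \<open>F\<close> is at most
    \<open>Y / 2\<close>.\<close>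
  define \<beta> where "\<beta> \<omega> = (8 / r) ^ 4 * s \<omega> ^ 4 + 4 / Y\<^sup>2 * u \<omega> ^ 2" for \<omega>
  have bad: "1 \<le> \<beta> \<omega>" if ng: "\<not> good n r h l R (x \<omega>)" for \<omega>
  proof -
    consider "s \<omega> < - r / 8" | "Y / 2 < u \<omega>"
      using ng Y(2) alive(2) l unfolding good_def y_def[symmetric] s_def u_def Y_def[symmetric] \<tau>_def[symmetric]
      by linarith
    then show ?thesis
    proof cases
      case 1
      then have "1 \<le> 8 / r * (- s \<omega>)" using r by (simp add: field_simps)
      then have "1 ^ 4 \<le> (8 / r * (- s \<omega>)) ^ 4" by (intro power_mono) auto
      then have "1 \<le> (8 / r) ^ 4 * s \<omega> ^ 4" by (simp add: power_mult_distrib power_divide)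
      moreover have "0 \<le> 4 / Y\<^sup>2 * u \<omega> ^ 2" by simp
      ultimately show ?thesis unfolding \<beta>_def by linarith
    next
      case 2
      then have "1 \<le> 2 / Y * u \<omega>" using Y by (simp add: field_simps)
      then have "1 ^ 2 \<le> (2 / Y * u \<omega>) ^ 2" by (intro power_mono) auto
      then have "1 \<le> 4 / Y\<^sup>2 * u \<omega> ^ 2" by (simp add: power_mult_distrib power_divide)
      moreover have "0 \<le> (8 / r) ^ 4 * s \<omega> ^ 4" by simp
      ultimately show ?thesis unfolding \<beta>_def by linarith
    qed
  qed
  have \<beta>0: "0 \<le> \<beta> \<omega>" for \<omega> by (simp add: \<beta>_def)
  define B where "B = (8 / r) ^ 4 * (\<Gamma>' * F)\<^sup>2 + 4 / Y\<^sup>2 * (\<Gamma>' * H)"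
  define B' where "B' = 16384 * \<Gamma>'\<^sup>2 * A\<^sup>2 / r ^ 4 + 1024 * \<Gamma>' * A\<^sup>2 * h\<^sup>2 / r\<^sup>2"
  have BB': "B \<le> B'"
  proof -
    have "(8 / r) ^ 4 * (\<Gamma>' * F)\<^sup>2 \<le> (8 / r) ^ 4 * (\<Gamma>'\<^sup>2 * (4 * A\<^sup>2))"
      using F2A unfolding power_mult_distrib by (intro mult_left_mono) auto
    moreover have "(8 / r) ^ 4 * (\<Gamma>'\<^sup>2 * (4 * A\<^sup>2)) = 16384 * \<Gamma>'\<^sup>2 * A\<^sup>2 / r ^ 4"
      by (simp add: power_divide)
    moreover have "4 / Y\<^sup>2 * (\<Gamma>' * H) \<le> 4 / Y\<^sup>2 * (\<Gamma>' * (4 * A\<^sup>2))"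
      using H2A nn by (intro mult_left_mono) auto
    moreover have "4 / Y\<^sup>2 * (\<Gamma>' * (4 * A\<^sup>2)) = 1024 * \<Gamma>' * A\<^sup>2 * h\<^sup>2 / r\<^sup>2"
      using ps by (simp add: Y_def power_divide power_mult_distrib)
    ultimately show ?thesis by (simp add: B_def B'_def)
  qed
  have B'2: "B' \<le> 1 / 2" using small by (simp add: B'_def \<Gamma>'_def)
  define e where "e = max 0 (\<tau> + D * Suc k - \<theta>)"
  define E where "E \<omega> = G + h\<^sup>2 * n + 4 / r * dot n (y \<omega>) (mv n R (y \<omega>)) + 4 / r\<^sup>2 * (dot n (y \<omega>) (y \<omega>))\<^sup>2
       + 2 * h * \<tau> + 4 * h / r * dot n (y \<omega>) (y \<omega>)" for \<omega>
  \<comment> \<open>On the bad event \<open>g\<close> must be at least 1 although the gain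
    \<open>h / 4 * N / A\<close> is subtracted there too; the factor next to \<open>\<beta>\<close>
    compensates for this.\<close>
  define g where "g \<omega> = \<beta> \<omega> * (1 + h / 4 * N / A) + (E \<omega> - h / 4 * N) / A
      + 64 / r\<^sup>2 * (e + 2 / r * u \<omega>)\<^sup>2 + k * b" for \<omega>
  have En: "0 \<le> E \<omega>" for \<omega>
  proof -
    have "0 \<le> dot n (y \<omega>) (mv n R (y \<omega>))" using R(2) by (simp add: psd_def)
    then show ?thesis unfolding E_def using nn ps by (intro add_nonneg_nonneg mult_nonneg_nonneg) auto
  qed
  have dom: "(if good n r h l R (x \<omega>) then lyap \<theta> k (step n h l R (x \<omega>)) else 1) \<le> g \<omega>" for \<omega>
  proof (cases "good n r h l R (x \<omega>)")
    case True
    note sb = step_bounds(4,5)[OF R ps(2) h ps(6) alive(1) A(3) True, folded y_def, folded \<tau>_def G_def N_def]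
    have 1: "tr2 n (step n h l R (x \<omega>)) / A \<le> (E \<omega> - h / 4 * N) / A"
      using sb(1) ps by (intro divide_right_mono) (auto simp: E_def)
    \<comment> \<open>The mean growth \<open>2 / r * F\<close> of the trace is at most
      \<open>2 / r * (n + G)\<close>. The shift takes back the part with \<open>G\<close>, so that
      only the constant \<open>D\<close> and a centred term remain.\<close>
    have "2 / r \<le> h / 4"
    proof -
      have "2 / r = 2 * r / r\<^sup>2" using ps by (simp add: power2_eq_square)
      also have "\<dots> \<le> 32 * n / r\<^sup>2" using ps by (intro divide_right_mono) auto
      also have "\<dots> = h / 4" by (simp add: h_def)
      finally show ?thesis .
    qed
    then have "2 / r * G \<le> h / 4 * G" using nn by (intro mult_right_mono) auto
    moreover have "2 / r * dot n (y \<omega>) (y \<omega>) = 2 / r * F + 2 / r * u \<omega>" by (simp add: u_def algebra_simps)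
    moreover have "2 / r * F \<le> 2 / r * (n + G)" using F_le ps by (intro mult_left_mono) auto
    moreover have "2 / r * (n + G) = 2 * n / r + 2 / r * G" by (simp add: distrib_left)
    ultimately have "tr1 n (step n h l R (x \<omega>)) \<le> \<tau> + D + 2 / r * u \<omega>"
      using sb(2) unfolding D_def by linarith
    then have "max 0 (tr1 n (step n h l R (x \<omega>)) + D * k - \<theta>) \<le> \<bar>e + 2 / r * u \<omega>\<bar>"
      by (auto simp: e_def algebra_simps)
    then have "(max 0 (tr1 n (step n h l R (x \<omega>)) + D * k - \<theta>))\<^sup>2 \<le> \<bar>e + 2 / r * u \<omega>\<bar>\<^sup>2"
      by (rule power_mono) simp
    then have 2: "64 / r\<^sup>2 * (max 0 (tr1 n (step n h l R (x \<omega>)) + D * k - \<theta>))\<^sup>2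
        \<le> 64 / r\<^sup>2 * (e + 2 / r * u \<omega>)\<^sup>2"
      by (intro mult_left_mono) auto
    have 3: "0 \<le> \<beta> \<omega> * (1 + h / 4 * N / A)" using \<beta>0 nn ps by (intro mult_nonneg_nonneg) auto
    show ?thesis using 1 2 3 True by (simp add: lyap_def g_def)
  next
    case False
    define c q t where "c = h / 4 * N / A" and "q = 64 / r\<^sup>2 * (e + 2 / r * u \<omega>)\<^sup>2 + k * b"
      and "t = E \<omega> / A"
    have "0 \<le> c" "0 \<le> q" "0 \<le> t" using nn ps En by (auto simp: c_def q_def t_def)
    moreover have "1 + c \<le> \<beta> \<omega> + \<beta> \<omega> * c"
      using bad[OF False] mult_right_mono[OF bad[OF False] \<open>0 \<le> c\<close>] by simp
    moreover have "g \<omega> = \<beta> \<omega> + \<beta> \<omega> * c + (t - c) + q"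
      unfolding g_def c_def q_def t_def diff_divide_distrib distrib_left by simp
    ultimately have "1 \<le> g \<omega>" by linarith
    then show ?thesis using False by simp
  qed
  have uy: "dot n (y \<omega>) (y \<omega>) = u \<omega> + F" and wy: "dot n (y \<omega>) (mv n R (y \<omega>)) = w \<omega> + (\<tau> - 2 * G + N)" for \<omega>
    by (simp_all add: u_def w_def)
  define c0 where "c0 = (G + h\<^sup>2 * n + 4 / r * (\<tau> - 2 * G + N) + 4 / r\<^sup>2 * F\<^sup>2 + 2 * h * \<tau> + 4 * h / r * F
      - h / 4 * N) / A + 64 / r\<^sup>2 * e\<^sup>2 + k * b"
  define c1 where "c1 = (8 / r) ^ 4 * (1 + h / 4 * N / A)"
  define c2 where "c2 = 4 / Y\<^sup>2 * (1 + h / 4 * N / A) + 4 / r\<^sup>2 / A + 256 / r ^ 4"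
  define c3 where "c3 = (8 / r\<^sup>2 * F + 4 * h / r) / A + 256 / r ^ 3 * e"
  define c4 where "c4 = 4 / r / A"
  have r34: "r ^ 4 = r\<^sup>2 * r\<^sup>2" "r ^ 3 = r\<^sup>2 * r" by (simp_all add: eval_nat_numeral)
  have g: "g \<omega> = c0 + c1 * s \<omega> ^ 4 + c2 * u \<omega> ^ 2 + c3 * u \<omega> + c4 * w \<omega>" for \<omega>
    unfolding g_def \<beta>_def E_def uy wy c0_def c1_def c2_def c3_def c4_def r34
    by (simp add: power2_eq_square algebra_simps add_divide_distrib diff_divide_distrib)
  have ig: "integrable M g" unfolding g using mom by simp
  have "expectation g = c0 + c1 * expectation (\<lambda>\<omega>. s \<omega> ^ 4) + c2 * expectation (\<lambda>\<omega>. u \<omega> ^ 2)"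
    unfolding g using mom by (simp add: prob_space)
  also have "\<dots> \<le> c0 + c1 * (\<Gamma>' * F)\<^sup>2 + c2 * (\<Gamma>' * H)"
    using mom nn ps by (intro add_mono mult_left_mono) (auto simp: c1_def c2_def intro!: add_nonneg_nonneg)
  also have "\<dots> = B * (1 + h / 4 * N / A) + (256 / r ^ 4) * (\<Gamma>' * H) + 64 / r\<^sup>2 * e\<^sup>2 + k * b + G / A
     + (h\<^sup>2 * n + 4 / r * (\<tau> - 2 * G + N) + 4 / r\<^sup>2 * (F\<^sup>2 + \<Gamma>' * H) + 2 * h * \<tau> + 4 * h / r * F - h / 4 * N) / A"
    unfolding c0_def c1_def c2_def B_def
    by (simp add: algebra_simps add_divide_distrib diff_divide_distrib)
  also have "\<dots> \<le> (B' + h / 8 * N / A) + 1024 * \<Gamma>' * A\<^sup>2 / r ^ 4 + 64 / r\<^sup>2 * e\<^sup>2 + k * b + G / A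
     + (1330 * (n / r)\<^sup>2 - h / 8 * N) / A"
  proof (intro add_mono divide_right_mono order.refl)
    \<comment> \<open>As \<open>B' \<le> 1 / 2\<close>, failures consume at most half of the gain
      \<open>h / 4 * N / A\<close>; the other half is left for the growth of
      \<open>tr2\<close>.\<close>
    have "B * (1 + h / 4 * N / A) \<le> B' * (1 + h / 4 * N / A)"
      using BB' nn ps by (intro mult_right_mono) auto
    also have "\<dots> = B' + B' * (h / 4 * N / A)" by (simp add: algebra_simps)
    also have "\<dots> \<le> B' + 1 / 2 * (h / 4 * N / A)"
      using B'2 nn ps by (intro add_left_mono mult_right_mono) auto
    finally show "B * (1 + h / 4 * N / A) \<le> B' + h / 8 * N / A" by simp
    have "(256 / r ^ 4) * (\<Gamma>' * H) \<le> (256 / r ^ 4) * (\<Gamma>' * (4 * A\<^sup>2))"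
      using H2A nn by (intro mult_left_mono) auto
    then show "(256 / r ^ 4) * (\<Gamma>' * H) \<le> 1024 * \<Gamma>' * A\<^sup>2 / r ^ 4" by simp
    define \<nu> where "\<nu> = (n / r)\<^sup>2"
    have \<nu>: "1 \<le> \<nu>" using power_mono[of 1 "n / r" 2] ps by (simp add: \<nu>_def)
    have hn: "h * n = 128 * \<nu>" by (simp add: h_def \<nu>_def power_divide power2_eq_square)
    have n2: "4 / r\<^sup>2 * (3 * n\<^sup>2) = 12 * \<nu>" by (simp add: \<nu>_def power_divide)
    have nr1: "4 / r * n \<le> 4 * \<nu>"
    proof -
      have "1 * (n / r) \<le> n / r * (n / r)" using ps by (intro mult_right_mono) auto
      then show ?thesis by (simp add: \<nu>_def power2_eq_square)
    qed
    have a1: "h\<^sup>2 * n \<le> 32 * \<nu>"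
    proof -
      have "h\<^sup>2 * n = h * (h * n)" by (simp add: power2_eq_square)
      also have "\<dots> \<le> 1 / 4 * (h * n)" using h ps by (intro mult_right_mono) auto
      finally show ?thesis using hn by simp
    qed
    have a2: "4 / r * (\<tau> - 2 * G + N) \<le> 4 / r * n + 4 / r * N"
      using mult_left_mono[of "\<tau> - 2 * G + N" "n + N" "4 / r"] \<tau>n nn ps by (simp add: distrib_left)
    have a3: "4 / r\<^sup>2 * (F\<^sup>2 + \<Gamma>' * H) \<le> 4 / r\<^sup>2 * (3 * n\<^sup>2) + 4 / r\<^sup>2 * (3 * (n * N))"
      using mult_left_mono[of "F\<^sup>2 + \<Gamma>' * H" "3 * n\<^sup>2 + 3 * (n * N)" "4 / r\<^sup>2"] F2 \<Gamma>H
      by (simp add: distrib_left)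
    have a4: "2 * h * \<tau> \<le> 2 * (h * n)"
      using mult_left_mono[OF \<tau>n, of "2 * h"] ps by simp
    have a5: "4 * h / r * F \<le> 8 * (h * n)"
    proof -
      have "4 * h / r * F \<le> 4 * h / r * (2 * (n * r))"
        using F_le(2) A(2) ps by (intro mult_left_mono) auto
      also have "\<dots> = 8 * (h * n)" using ps by simp
      finally show ?thesis .
    qed
    \<comment> \<open>Here the constant in \<open>h\<close> is fixed: \<open>N\<close> enters the
      growth of \<open>tr2\<close> with a coefficient of at most
      \<open>4 / r + 12 n / r^2 \<le> 16 n / r^2\<close>, which is \<open>h / 8\<close>.\<close>
    have a6: "4 / r * N + 4 / r\<^sup>2 * (3 * (n * N)) \<le> h / 8 * N"
    proof -
      have "4 / r = 4 * r / r\<^sup>2" using ps by (simp add: power2_eq_square)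
      also have "\<dots> \<le> 4 * n / r\<^sup>2" using ps by (intro divide_right_mono) auto
      finally have "4 / r * N \<le> 4 * n / r\<^sup>2 * N" using nn by (intro mult_right_mono) auto
      moreover have "4 / r\<^sup>2 * (3 * (n * N)) = 12 * n / r\<^sup>2 * N" by simp
      moreover have "4 * n / r\<^sup>2 * N + 12 * n / r\<^sup>2 * N = h / 8 * N"
        by (simp add: h_def field_simps)
      ultimately show ?thesis by linarith
    qed
    \<comment> \<open>One half of the gain is used up by \<open>a6\<close>, the other is kept. The
      multiples of \<open>\<nu>\<close> collected above are
      \<open>32 + 4 + 12 + 256 + 1024 = 1328\<close>, rounded up to 1330.\<close>
    have hN: "h / 4 * N = h / 8 * N + h / 8 * N" by simp
    have "h\<^sup>2 * n + 4 / r * (\<tau> - 2 * G + N) + 4 / r\<^sup>2 * (F\<^sup>2 + \<Gamma>' * H) + 2 * h * \<tau> + 4 * h / r * F - h / 4 * N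
       \<le> 1330 * \<nu> - h / 8 * N"
      using a1 a2 a3 a4 a5 a6 nr1 n2 hn \<nu> hN by linarith
    then show "h\<^sup>2 * n + 4 / r * (\<tau> - 2 * G + N) + 4 / r\<^sup>2 * (F\<^sup>2 + \<Gamma>' * H) + 2 * h * \<tau> + 4 * h / r * F - h / 4 * N
       \<le> 1330 * (n / r)\<^sup>2 - h / 8 * N" by (simp add: \<nu>_def)
  qed (use ps in auto)
  also have "\<dots> = lyap \<theta> (Suc k) R"
    unfolding lyap_def e_def \<tau>_def[symmetric] G_def[symmetric]
    by (simp add: b_def B'_def \<Gamma>'_def power_mult_distrib algebra_simps add_divide_distrib diff_divide_distrib)
  finally have "expectation g \<le> lyap \<theta> (Suc k) R" .
  with ig dom show ?thesis unfolding x_def by blast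
qed

end

subsection \<open>Adding a block of columns\<close>

text \<open>If a column lies in the span of the previous ones then the divisor is \<open>0\<close>, and so is the update.\<close>

primrec gram_schmidt :: "nat \<Rightarrow> nat list \<Rightarrow> (nat \<Rightarrow> nat \<Rightarrow> real) \<Rightarrow> (nat \<times> nat \<Rightarrow> real) \<Rightarrow> nat \<Rightarrow> nat \<Rightarrow> real" where
  "gram_schmidt n [] R x = R"
| "gram_schmidt n (c # cs) R x = gram_schmidt n cs
     (rank1 R (resid n R (\<lambda>i. x (i, c))) (dot n (\<lambda>i. x (i, c)) (resid n R (\<lambda>i. x (i, c))))) x"

definition idem :: "nat \<Rightarrow> (nat \<Rightarrow> nat \<Rightarrow> real) \<Rightarrow> bool" where
  "idem n R \<longleftrightarrow> (\<forall>i<n. \<forall>j<n. dot n (R i) (R j) = R i j)"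

lemma mv_idem:
  assumes "symm R" "idem n R" "i < n"
  shows "mv n R (mv n R z) i = mv n R z i"
proof -
  have "mv n R (mv n R z) i = dot n (R i) (mv n R z)" by (simp add: mv_def dot_def)
  also have "\<dots> = dot n z (mv n R (R i))" by (rule dot_mv_commute[OF assms(1)])
  also have "\<dots> = (\<Sum>j<n. R i j * z j)"
    unfolding dot_def[of n z] using assms
    by (intro sum.cong refl) (simp add: mv_row idem_def symm_def)
  finally show ?thesis by (simp add: mv_def)
qed

lemma idem_psd: "symm R \<Longrightarrow> idem n R \<Longrightarrow> psd n R"
  unfolding psd_def
proof
  fix z assume R: "symm R" "idem n R"
  have "dot n z (mv n R z) = dot n z (mv n R (mv n R z))"
    by (intro dot_cong refl mv_idem[OF R, symmetric])
  also have "\<dots> = dot n (mv n R z) (mv n R z)" by (rule dot_mv[OF R(1), symmetric])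
  finally show "0 \<le> dot n z (mv n R z)" by simp
qed

text \<open>The rank-one update with \<open>l = 0\<close>. A projection annihilates
  \<open>y\<close>, so the divisor is \<open>|y|^2\<close>; the trace grows by 1 or, for a dependent
  column, by 0, and the result is again a projection.\<close>

lemma projection_step:
  fixes c :: "nat \<Rightarrow> real"
  assumes R: "symm R" "idem n R"
  defines "y \<equiv> resid n R c" and "R' \<equiv> rank1 R (resid n R c) (dot n c (resid n R c))"
  shows "symm R'" "idem n R'" "tr1 n R' \<le> tr1 n R + 1"
    and "lower n R w 0 \<Longrightarrow> lower n R' (\<lambda>i. w i + a * c i) 0"
proof -
  have Ry: "mv n R y i = 0" if "i < n" for i
    using mv_idem[OF R that, of c] by (simp add: y_def resid_def lin)
  have "dot n (mv n R c) y = dot n c (mv n R y)" by (rule dot_mv[OF R(1)])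
  also have "\<dots> = dot n c (\<lambda>_. 0)" by (intro dot_cong refl Ry)
  also have "\<dots> = 0" by (simp add: lin)
  finally have cy: "dot n c y = dot n y y"
    unfolding y_def[unfolded resid_def] by (simp add: lin)
  have R': "R' = rank1 R y (dot n c y)" by (simp add: R'_def y_def)
  show "symm R'" unfolding R'_def by (rule symm_rank1[OF R(1)])
  show "tr1 n R' \<le> tr1 n R + 1"
    unfolding R' tr1_rank1 cy by simp
  have lsc: "2 * dot n z (\<lambda>i. w i + a * c i) - dot n (\<lambda>i. w i + a * c i) (\<lambda>i. w i + a * c i)
    \<le> dot n z (mv n R z) + 2 * a * dot n y z - a\<^sup>2 * dot n y y" if "lower n R w 0" for z
    using lower_shift_column[OF R(1) that, of z a c 0] cy unfolding y_def resid_def by simp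
  show "idem n R'" unfolding idem_def
  proof (intro allI impI)
    fix i j assume ij: "i < n" "j < n"
    have Ry': "dot n (R k) y = 0" "dot n y (R k) = 0" if "k < n" for k
      using Ry[OF that] by (simp_all add: mv_def dot_def mult.commute)
    have "dot n (R' i) (R' j) = R i j + y i * y j * (dot n y y / (dot n y y * dot n y y))"
      unfolding R' rank1_row cy using R(2) ij by (simp add: lin Ry' idem_def)
    then show "dot n (R' i) (R' j) = R' i j"
      unfolding R' rank1_def cy by (cases "dot n y y = 0") simp_all
  qed
  show "lower n R' (\<lambda>i. w i + a * c i) 0" if "lower n R w 0"
  proof (cases "dot n y y = 0")
    case True
    then have "\<forall>i<n. y i = 0"
      unfolding dot_def by (subst (asm) sum_nonneg_eq_0_iff) auto
    then have "dot n y z = 0" for z by (simp add: dot_def)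
    then show ?thesis using lsc[OF that] True unfolding lower_def R' by (simp add: cy rank1_def)
  next
    case False
    then have "0 < dot n c y" unfolding cy using dot_self_nonneg[of n y] by linarith
    then show ?thesis
      using lower_rank1[OF R(1) that, where s = "dot n c y" and x = c and l = 0 and a = a]
      unfolding R' by (simp add: y_def resid_def)
  qed
qed

lemma gram_schmidt_props:
  assumes "symm R" "idem n R"
  shows "symm (gram_schmidt n cs R x)" "idem n (gram_schmidt n cs R x)"
    "tr1 n (gram_schmidt n cs R x) \<le> tr1 n R + length cs"
    "lower n R w 0 \<Longrightarrow> lower n (gram_schmidt n cs R x) (\<lambda>i. w i + (\<Sum>c\<leftarrow>cs. v c * x (i, c))) 0"
proof -
  have "symm (gram_schmidt n cs R x) \<and> idem n (gram_schmidt n cs R x) \<and>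
    tr1 n (gram_schmidt n cs R x) \<le> tr1 n R + length cs \<and>
    (lower n R w 0 \<longrightarrow> lower n (gram_schmidt n cs R x) (\<lambda>i. w i + (\<Sum>c\<leftarrow>cs. v c * x (i, c))) 0)"
    using assms
  proof (induction cs arbitrary: R w)
    case Nil
    then show ?case by simp
  next
    case (Cons c cs)
    let ?R = "rank1 R (resid n R (\<lambda>i. x (i, c))) (dot n (\<lambda>i. x (i, c)) (resid n R (\<lambda>i. x (i, c))))"
    note ps = projection_step[OF Cons.prems, where c = "\<lambda>i. x (i, c)"]
    from Cons.IH[OF ps(1,2), of "\<lambda>i. w i + v c * x (i, c)"] ps(3) ps(4)[where w = w and a = "v c"]
    show ?case by (auto simp: add.assoc)
  qed
  then show "symm (gram_schmidt n cs R x)" "idem n (gram_schmidt n cs R x)"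
    "tr1 n (gram_schmidt n cs R x) \<le> tr1 n R + length cs"
    "lower n R w 0 \<Longrightarrow> lower n (gram_schmidt n cs R x) (\<lambda>i. w i + (\<Sum>c\<leftarrow>cs. v c * x (i, c))) 0"
    by auto
qed

lemma gram_schmidt_cong:
  "(\<And>i c. c \<in> set cs \<Longrightarrow> x (i, c) = x' (i, c)) \<Longrightarrow> gram_schmidt n cs R x = gram_schmidt n cs R x'"
  by (induction cs arbitrary: R) auto

lemma zero_matrix: "symm (\<lambda>_ _. 0)" "idem n (\<lambda>_ _. 0)" "tr1 n (\<lambda>_ _. 0) = 0" "lower n (\<lambda>_ _. 0) (\<lambda>_. 0) 0"
  by (auto simp: symm_def idem_def tr1_def lower_def lin dot_def mv_def)

lemma tr2_idem: "idem n R \<Longrightarrow> tr2 n R = tr1 n R"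
  by (auto simp: tr1_def tr2_def idem_def)

section \<open>Measurability of the matrix recursions in the entries\<close>

lemma measurable_dot:
  assumes "\<And>i. i < n \<Longrightarrow> (\<lambda>y. u y i) \<in> borel_measurable N" "\<And>i. i < n \<Longrightarrow> (\<lambda>y. v y i) \<in> borel_measurable N"
  shows "(\<lambda>y. dot n (u y) (v y)) \<in> borel_measurable N"
  unfolding dot_def using assms by (intro borel_measurable_sum borel_measurable_times) auto

lemma measurable_mv:
  assumes "\<And>j. j < n \<Longrightarrow> (\<lambda>y. R y i j) \<in> borel_measurable N" "\<And>i. i < n \<Longrightarrow> (\<lambda>y. v y i) \<in> borel_measurable N"
  shows "(\<lambda>y. mv n (R y) (v y) i) \<in> borel_measurable N"
  unfolding mv_def using assms by (intro borel_measurable_sum borel_measurable_times) auto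

lemma measurable_resid:
  assumes "\<And>i j. i < n \<Longrightarrow> j < n \<Longrightarrow> (\<lambda>y. R y i j) \<in> borel_measurable N"
    "\<And>i. i < n \<Longrightarrow> (\<lambda>y. v y i) \<in> borel_measurable N" "i < n"
  shows "(\<lambda>y. resid n (R y) (v y) i) \<in> borel_measurable N"
  unfolding resid_def using assms by (intro borel_measurable_diff measurable_mv) auto

lemma measurable_rank1:
  assumes "(\<lambda>y. R y i j) \<in> borel_measurable N" "(\<lambda>y. v y i) \<in> borel_measurable N"
    "(\<lambda>y. v y j) \<in> borel_measurable N" "s \<in> borel_measurable N"
  shows "(\<lambda>y. rank1 (R y) (v y) (s y) i j) \<in> borel_measurable N"
  unfolding rank1_def using assms by measurable

lemma measurable_step:
  assumes R: "\<And>i j. i < n \<Longrightarrow> j < n \<Longrightarrow> (\<lambda>y. R y i j) \<in> borel_measurable N"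
    and v: "\<And>i. i < n \<Longrightarrow> (\<lambda>y. v y i) \<in> borel_measurable N" and ij: "i < n" "j < n"
  shows "(\<lambda>y. step n h l (R y) (v y) i j) \<in> borel_measurable N"
proof -
  have r: "(\<lambda>y. resid n (R y) (v y) i) \<in> borel_measurable N" if "i < n" for i
    by (rule measurable_resid[OF R v that])
  have s: "(\<lambda>y. dot n (v y) (resid n (R y) (v y)) - l) \<in> borel_measurable N"
    by (rule borel_measurable_diff, rule measurable_dot, erule v, erule r, rule borel_measurable_const)
  have P: "(\<lambda>y. rank1 (R y) (resid n (R y) (v y)) (dot n (v y) (resid n (R y) (v y)) - l) i j) \<in> borel_measurable N"
    if "i < n" "j < n" for i j
    by (rule measurable_rank1, rule R[OF that], rule r[OF that(1)], rule r[OF that(2)], rule s)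
  show ?thesis unfolding step_def shift_def
    using ij by (intro borel_measurable_add borel_measurable_diff borel_measurable_times borel_measurable_const
        measurable_dot P)
qed

lemma measurable_gram_schmidt:
  assumes "\<And>i j. i < n \<Longrightarrow> j < n \<Longrightarrow> (\<lambda>y. R y i j) \<in> borel_measurable N"
    "\<And>i c. i < n \<Longrightarrow> c \<in> set cs \<Longrightarrow> (\<lambda>y. X y (i, c)) \<in> borel_measurable N" "i < n" "j < n"
  shows "(\<lambda>y. gram_schmidt n cs (R y) (X y) i j) \<in> borel_measurable N"
  using assms
proof (induction cs arbitrary: R i j)
  case Nil
  then show ?case by simp
next
  case (Cons c cs)
  have v: "(\<lambda>y. X y (i, c)) \<in> borel_measurable N" if "i < n" for i using Cons.prems(2) that by simp
  have r: "(\<lambda>y. resid n (R y) (\<lambda>i. X y (i, c)) i) \<in> borel_measurable N" if "i < n" for i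
    by (rule measurable_resid[OF Cons.prems(1) v that])
  show ?case unfolding gram_schmidt.simps
  proof (rule Cons.IH)
    show "(\<lambda>y. rank1 (R y) (resid n (R y) (\<lambda>i. X y (i, c)))
        (dot n (\<lambda>i. X y (i, c)) (resid n (R y) (\<lambda>i. X y (i, c)))) i j) \<in> borel_measurable N"
      if "i < n" "j < n" for i j
      by (rule measurable_rank1, rule Cons.prems(1)[OF that], rule r[OF that(1)], rule r[OF that(2)],
          rule measurable_dot, erule v, erule r)
  qed (use Cons.prems in auto)
qed

section \<open>Survival of a block of columns\<close>

context barrier
begin

text \<open>The matrix inequalities for a step rest on \<open>tr2\<close> and on
  \<open>good\<close>, so these are what the event records; \<open>tr1\<close> is confined to the
  probability estimate. The level \<open>l\<close> shrinks by the factor that the shift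
  imposes.\<close>

primrec survives :: "nat list \<Rightarrow> (nat \<Rightarrow> nat \<Rightarrow> real) \<Rightarrow> real \<Rightarrow> (nat \<times> nat \<Rightarrow> real) \<Rightarrow> bool" where
  "survives [] R l x \<longleftrightarrow> True"
| "survives (c # cs) R l x \<longleftrightarrow> tr2 n R \<le> A \<and> good n r h l R (\<lambda>i. x (i, c)) \<and>
     survives cs (step n h l R (\<lambda>i. x (i, c))) ((1 - h) * l) x"

text \<open>\<open>s\<close> is the sum of the squared coefficients of the block columns added so
  far. With it the hypothesis on \<open>l * s\<close> reproduces itself for
  \<open>(1 - h) * l\<close> and \<open>s + (v c)^2\<close>.\<close>

lemma survives_lower:
  assumes "survives cs R l x" "symm R" "psd n R" "lower n R w (l * s)"
  shows "(1 - h) ^ length cs * l * (s + (\<Sum>c\<leftarrow>cs. (v c)\<^sup>2)) \<le>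
     dot n (\<lambda>i. w i + (\<Sum>c\<leftarrow>cs. v c * x (i, c))) (\<lambda>i. w i + (\<Sum>c\<leftarrow>cs. v c * x (i, c)))"
  using assms
proof (induction cs arbitrary: R l w s)
  case Nil
  then show ?case using lower_norm[of n R w "l * s"] by simp
next
  case (Cons c cs)
  have sv: "tr2 n R \<le> A" "good n r h l R (\<lambda>i. x (i, c))"
    "survives cs (step n h l R (\<lambda>i. x (i, c))) ((1 - h) * l) x"
    using Cons.prems(1) by auto
  note sb = step_bounds[OF Cons.prems(2,3) pos(2) h r(1) sv(1) A(3) sv(2)]
  have e: "(1 - h) * l * (s + (v c)\<^sup>2) = (1 - h) * (l * s + l * (v c)\<^sup>2)"
    by (simp only: distrib_left mult.assoc)
  have "lower n (step n h l R (\<lambda>i. x (i, c))) (\<lambda>i. w i + v c * x (i, c)) ((1 - h) * l * (s + (v c)\<^sup>2))"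
    unfolding e by (rule sb(3)[OF Cons.prems(4)])
  note IH = Cons.IH[OF sv(3) sb(1,2) this]
  have e1: "(1 - h) ^ length (c # cs) * l * (s + (\<Sum>c\<leftarrow>c # cs. (v c)\<^sup>2)) =
      (1 - h) ^ length cs * ((1 - h) * l) * (s + (v c)\<^sup>2 + (\<Sum>c\<leftarrow>cs. (v c)\<^sup>2))"
    by simp
  have e2: "(\<lambda>i. w i + (\<Sum>c\<leftarrow>c # cs. v c * x (i, c))) =
      (\<lambda>i. w i + v c * x (i, c) + (\<Sum>c\<leftarrow>cs. v c * x (i, c)))"
    by (simp add: add.assoc)
  show ?case unfolding e1 e2 by (rule IH)
qed

lemma survives_cong:
  "(\<And>i c. c \<in> set cs \<Longrightarrow> x (i, c) = x' (i, c)) \<Longrightarrow> survives cs R l x = survives cs R l x'"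
  by (induction cs arbitrary: R l) auto

lemma measurable_survives:
  assumes "\<And>i j. i < n \<Longrightarrow> j < n \<Longrightarrow> (\<lambda>y. R y i j) \<in> borel_measurable N"
    "\<And>i c. i < n \<Longrightarrow> c \<in> set cs \<Longrightarrow> (\<lambda>y. X y (i, c)) \<in> borel_measurable N"
  shows "Measurable.pred N (\<lambda>y. survives cs (R y) l (X y))"
  using assms
proof (induction cs arbitrary: R l)
  case Nil
  then show ?case by simp
next
  case (Cons c cs)
  have v: "(\<lambda>y. X y (i, c)) \<in> borel_measurable N" if "i < n" for i using Cons.prems(2) that by simp
  have r: "(\<lambda>y. resid n (R y) (\<lambda>i. X y (i, c)) i) \<in> borel_measurable N" if "i < n" for i
    by (rule measurable_resid[OF Cons.prems(1) v that])
  have [measurable]: "(\<lambda>y. tr2 n (R y)) \<in> borel_measurable N"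
    unfolding tr2_def by (intro borel_measurable_sum measurable_dot Cons.prems(1)) auto
  have [measurable]: "(\<lambda>y. dot n (\<lambda>i. X y (i, c)) (resid n (R y) (\<lambda>i. X y (i, c)))) \<in> borel_measurable N"
    "(\<lambda>y. dot n (resid n (R y) (\<lambda>i. X y (i, c))) (resid n (R y) (\<lambda>i. X y (i, c)))) \<in> borel_measurable N"
    by (rule measurable_dot, erule v, erule r) (rule measurable_dot, erule r, erule r)
  have [measurable]: "Measurable.pred N (\<lambda>y. survives cs (step n h l (R y) (\<lambda>i. X y (i, c))) ((1 - h) * l) (X y))"
  proof (rule Cons.IH)
    show "(\<lambda>y. step n h l (R y) (\<lambda>i. X y (i, c)) i j) \<in> borel_measurable N" if "i < n" "j < n" for i j
      by (rule measurable_step[OF Cons.prems(1) v that])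
  qed (use Cons.prems(2) in auto)
  show ?case unfolding survives.simps good_def by measurable
qed

end

text \<open>In a product measure over the positions the columns can be integrated out one at a time
  by Fubini's theorem; this replaces conditional expectations given the previous columns.\<close>

locale design_laws = barrier n r A h "184 * K" b D for n r A h K b D +
  fixes \<nu> :: "nat \<times> nat \<Rightarrow> real measure" and C :: "nat set"
  assumes K: "1 \<le> K"
    and prob_law: "\<And>q. prob_space (\<nu> q)" and sets_law [measurable_cong]: "\<And>q. sets (\<nu> q) = sets borel"
    and law: "\<And>i c. i < n \<Longrightarrow> c \<in> C \<Longrightarrow> integrable (\<nu> (i, c)) (\<lambda>t. t ^ 8)"
      "\<And>i c. i < n \<Longrightarrow> c \<in> C \<Longrightarrow> (\<integral>t. t \<partial>\<nu> (i, c)) = 0"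
      "\<And>i c. i < n \<Longrightarrow> c \<in> C \<Longrightarrow> (\<integral>t. t\<^sup>2 \<partial>\<nu> (i, c)) = 1"
      "\<And>i c. i < n \<Longrightarrow> c \<in> C \<Longrightarrow> (\<integral>t. t ^ 8 \<partial>\<nu> (i, c)) \<le> K\<^sup>2"
begin

sublocale product_prob_space \<nu>
  by (rule product_prob_spaceI) (rule prob_law)

abbreviation entries :: "nat set \<Rightarrow> (nat \<times> nat) set" where
  "entries B \<equiv> {..<n} \<times> B"

lemma measurable_entry:
  assumes "i < n" "c \<in> B"
  shows "(\<lambda>y. y (i, c)) \<in> borel_measurable (PiM (entries B) \<nu>)"
proof -
  have "(\<lambda>y. y (i, c)) \<in> measurable (PiM (entries B) \<nu>) (\<nu> (i, c))"
    by (rule measurable_component_singleton) (use assms in auto)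
  then show ?thesis by (simp cong: measurable_cong_sets add: sets_law)
qed

lemma column_coordinates:
  assumes c: "c \<in> C"
  shows "barrier_column (PiM (entries {c}) \<nu>) (\<lambda>i y. y (i, c)) n K r A h b D"
proof -
  let ?P = "PiM (entries {c}) \<nu>"
  interpret Q: prob_space ?P by (rule prob_space_PiM[OF prob_law])
  have meas: "(\<lambda>y. y (i, c)) \<in> borel_measurable ?P" if "i < n" for i
    using that by (intro measurable_entry) auto
  have dist: "distr ?P borel (\<lambda>y. y (i, c)) = \<nu> (i, c)" if "i < n" for i
  proof -
    have "distr ?P borel (\<lambda>y. y (i, c)) = distr ?P (\<nu> (i, c)) (\<lambda>y. y (i, c))"
      by (rule distr_cong) (simp_all add: sets_law)
    also have "\<dots> = \<nu> (i, c)"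
      by (rule distr_PiM_component) (use that prob_law in auto)
    finally show ?thesis .
  qed
  have ind: "Q.indep_vars (\<lambda>_. borel) (\<lambda>i y. y (i, c)) {..<n}"
  proof (subst Q.indep_vars_iff_distr_eq_PiM')
    show "{..<n} \<noteq> {}" using pos by auto
    have "distr ?P (\<Pi>\<^sub>M i\<in>{..<n}. borel) (\<lambda>y. \<lambda>i\<in>{..<n}. y (i, c)) =
        distr ?P (\<Pi>\<^sub>M i\<in>{..<n}. \<nu> (i, c)) (\<lambda>y. \<lambda>i\<in>{..<n}. y (i, c))"
      by (intro distr_cong refl sets_PiM_cong) (simp add: sets_law)
    also have "\<dots> = (\<Pi>\<^sub>M i\<in>{..<n}. \<nu> (i, c))"
      by (rule distr_PiM_reindex) (auto simp: prob_law inj_on_def)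
    also have "\<dots> = (\<Pi>\<^sub>M i\<in>{..<n}. distr ?P borel (\<lambda>y. y (i, c)))"
      by (intro PiM_cong refl) (simp add: dist)
    finally show "distr ?P (\<Pi>\<^sub>M i\<in>{..<n}. borel) (\<lambda>y. \<lambda>i\<in>{..<n}. y (i, c)) = \<dots>" .
  qed (use meas in auto)
  have int: "integrable ?P (\<lambda>y. f (y (i, c))) \<longleftrightarrow> integrable (\<nu> (i, c)) f"
    "Q.expectation (\<lambda>y. f (y (i, c))) = (\<integral>t. f t \<partial>\<nu> (i, c))"
    if "i < n" "f \<in> borel_measurable borel" for i and f :: "real \<Rightarrow> real"
    using integrable_distr_eq[OF meas[OF that(1)], of f] integral_distr[OF meas[OF that(1)], of f] that
    by (simp_all add: dist)
  show ?thesis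
  proof unfold_locales
    show "Q.indep_vars (\<lambda>_. borel) (\<lambda>i y. y (i, c)) {..<n}" by (rule ind)
    fix i assume i: "i < n"
    show "integrable ?P (\<lambda>y. y (i, c) ^ 8)" using int(1)[OF i, of "\<lambda>t. t ^ 8"] law(1)[OF i c] by simp
    show "Q.expectation (\<lambda>y. y (i, c)) = 0" using int(2)[OF i, of "\<lambda>t. t"] law(2)[OF i c] by simp
    show "Q.expectation (\<lambda>y. y (i, c) ^ 2) = 1" using int(2)[OF i, of "\<lambda>t. t ^ 2"] law(3)[OF i c] by simp
    show "Q.expectation (\<lambda>y. y (i, c) ^ 8) \<le> K\<^sup>2" using int(2)[OF i, of "\<lambda>t. t ^ 8"] law(4)[OF i c] by simp
  qed (rule K)
qed

lemma entries_insert: "entries (set (c # cs)) = entries {c} \<union> entries (set cs)"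
  by auto

text \<open>With the first column fixed the remaining ones pose the same problem for the new matrix,
  whose bound \<open>lyap_step\<close> integrates. If the Lyapunov function is not trivially at
  least 1, the trace is at most \<open>\<theta> + r / 8\<close>, and
  \<open>\<theta> \<le> n - 7 * r / 8\<close> turns this into the margin \<open>3 * r / 4\<close>
  that \<open>lyap_step\<close> asks for.\<close>

lemma survival_probability:
  assumes "distinct cs" "set cs \<subseteq> C" "symm R" "psd n R" "0 \<le> l" "l \<le> r / 8" "\<theta> \<le> n - 7 * r / 8"
  shows "emeasure (PiM (entries (set cs)) \<nu>) {y \<in> space (PiM (entries (set cs)) \<nu>). \<not> survives cs R l y}
     \<le> ennreal (lyap \<theta> (length cs) R)"
  using assms
proof (induction cs arbitrary: R l)
  case Nil
  then show ?case by simp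
next
  case (Cons c cs)
  let ?P = "PiM (entries (set (c # cs))) \<nu>" and ?P1 = "PiM (entries {c}) \<nu>" and ?P2 = "PiM (entries (set cs)) \<nu>"
  let ?bad = "{y \<in> space ?P. \<not> survives (c # cs) R l y}"
  interpret Q: prob_space ?P by (rule prob_space_PiM[OF prob_law])
  interpret P2: prob_space ?P2 by (rule prob_space_PiM[OF prob_law])
  show ?case
  proof (cases "A < tr2 n R \<or> r / 8 < tr1 n R + D * length (c # cs) - \<theta>")
    case True
    then have "1 \<le> lyap \<theta> (length (c # cs)) R" by (rule lyap_ge_1)
    then show ?thesis by (intro order.trans[OF Q.emeasure_le_1]) simp
  next
    case False
    have "0 \<le> D * length (c # cs)" using pos by simp
    then have alive: "tr2 n R \<le> A" "tr1 n R \<le> n - 3 * r / 4" using False Cons.prems(7) by auto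
    have cC: "c \<in> C" using Cons.prems by simp
    interpret X: barrier_column ?P1 "\<lambda>i y. y (i, c)" n K r A h b D by (rule column_coordinates[OF cC])
    obtain g where g: "integrable ?P1 g" "X.expectation g \<le> lyap \<theta> (Suc (length cs)) R"
      "\<And>\<omega>. (if good n r h l R (\<lambda>i. \<omega> (i, c)) then lyap \<theta> (length cs) (step n h l R (\<lambda>i. \<omega> (i, c))) else 1) \<le> g \<omega>"
      using X.lyap_step[OF Cons.prems(3,4,6) alive, of \<theta> "length cs"] by blast
    have meas: "Measurable.pred ?P (\<lambda>y. survives (c # cs) R l y)"
      by (rule measurable_survives) (auto intro!: measurable_entry)
    then have bad: "?bad \<in> sets ?P" by measurable
    have disj: "entries {c} \<inter> entries (set cs) = {}" using Cons.prems by auto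
    have "emeasure ?P ?bad = (\<integral>\<^sup>+ y. indicator ?bad y \<partial>?P)" using bad by simp
    also have "\<dots> = (\<integral>\<^sup>+ x. (\<integral>\<^sup>+ y. indicator ?bad (merge (entries {c}) (entries (set cs)) (x, y)) \<partial>?P2) \<partial>?P1)"
      unfolding entries_insert
      by (rule product_nn_integral_fold[OF disj]) (use bad in \<open>auto simp: entries_insert[symmetric]\<close>)
    also have "\<dots> \<le> (\<integral>\<^sup>+ x. ennreal (g x) \<partial>?P1)"
    proof (rule nn_integral_mono)
      fix x assume x: "x \<in> space ?P1"
      let ?m = "\<lambda>y. merge (entries {c}) (entries (set cs)) (x, y)"
      have col: "?m y (i, c) = x (i, c)" if "y \<in> space ?P2" for y i
        using x that by (auto simp: merge_def space_PiM PiE_def extensional_def)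
      have rest: "?m y (i, c') = y (i, c')" if "y \<in> space ?P2" "c' \<in> set cs" for y i c'
        using x that Cons.prems(1) by (auto simp: merge_def space_PiM PiE_def extensional_def)
      show "(\<integral>\<^sup>+ y. indicator ?bad (?m y) \<partial>?P2) \<le> ennreal (g x)"
      proof (cases "good n r h l R (\<lambda>i. x (i, c))")
        case True
        let ?R = "step n h l R (\<lambda>i. x (i, c))"
        note sb = step_bounds[OF Cons.prems(3,4) pos(2) h r(1) alive(1) A(3) True]
        have l': "0 \<le> (1 - h) * l" "(1 - h) * l \<le> r / 8"
        proof -
          show "0 \<le> (1 - h) * l" using h Cons.prems by (intro mult_nonneg_nonneg) auto
          have "(1 - h) * l \<le> 1 * l" using pos Cons.prems by (intro mult_right_mono) auto
          then show "(1 - h) * l \<le> r / 8" using Cons.prems by simp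
        qed
        have "(\<integral>\<^sup>+ y. indicator ?bad (?m y) \<partial>?P2) \<le>
          (\<integral>\<^sup>+ y. indicator {y \<in> space ?P2. \<not> survives cs ?R ((1 - h) * l) y} y \<partial>?P2)"
        proof (rule nn_integral_mono)
          fix y assume y: "y \<in> space ?P2"
          have "survives cs ?R ((1 - h) * l) (?m y) = survives cs ?R ((1 - h) * l) y"
            by (rule survives_cong) (rule rest[OF y])
          then show "(indicator ?bad (?m y) :: ennreal) \<le>
            indicator {y \<in> space ?P2. \<not> survives cs ?R ((1 - h) * l) y} y"
            using True alive y by (auto simp: col indicator_def)
        qed
        also have "\<dots> = emeasure ?P2 {y \<in> space ?P2. \<not> survives cs ?R ((1 - h) * l) y}"
        proof (rule nn_integral_indicator)
          have "Measurable.pred ?P2 (\<lambda>y. survives cs ?R ((1 - h) * l) y)"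
            by (rule measurable_survives) (auto intro!: measurable_entry)
          then show "{y \<in> space ?P2. \<not> survives cs ?R ((1 - h) * l) y} \<in> sets ?P2" by measurable
        qed
        also have "\<dots> \<le> ennreal (lyap \<theta> (length cs) ?R)"
          by (rule Cons.IH) (use Cons.prems sb l' in auto)
        also have "\<dots> \<le> ennreal (g x)" using g(3)[of x] True by (intro ennreal_leI) simp
        finally show ?thesis .
      next
        case False
        have "(\<integral>\<^sup>+ y. indicator ?bad (?m y) \<partial>?P2) \<le> (\<integral>\<^sup>+ y. 1 \<partial>?P2)"
          by (intro nn_integral_mono) (simp add: indicator_def)
        also have "\<dots> = 1" by (simp add: P2.emeasure_space_1)
        also have "\<dots> \<le> ennreal (g x)" using g(3)[of x] False by simp
        finally show ?thesis .
      qed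
    qed
    also have "\<dots> = ennreal (X.expectation g)"
    proof (rule nn_integral_eq_integral[OF g(1)])
      have "0 \<le> g x" for x using g(3)[of x] lyap_nonneg[of \<theta> "length cs"] by (smt (verit))
      then show "AE x in ?P1. 0 \<le> g x" by simp
    qed
    also have "\<dots> \<le> ennreal (lyap \<theta> (length (c # cs)) R)" using g(2) by (intro ennreal_leI) simp
    finally show ?thesis .
  qed
qed

text \<open>For a projection of rank at most \<open>n - r\<close> both traces are at most
  \<open>n - r\<close>. With \<open>\<theta> = n - 7 * r / 8\<close> the whole drift
  \<open>D * length cs\<close> fits into \<open>r / 8\<close>, so the trace term of
  \<open>lyap\<close> starts at 0. The bound is uniform in the outside columns, which are then
  integrated out.\<close>

lemma block_survival_probability:
  assumes cs: "distinct (as @ cs)" "set (as @ cs) \<subseteq> C" "length as \<le> n - r" "D * length cs \<le> r / 8"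
  defines "P \<equiv> PiM (entries (set (as @ cs))) \<nu>"
  shows "emeasure P {y \<in> space P. \<not> survives cs (gram_schmidt n as (\<lambda>_ _. 0) y) (r / 8) y}
    \<le> ennreal (n / A + length cs * b)"
proof -
  let ?P1 = "PiM (entries (set as)) \<nu>" and ?P2 = "PiM (entries (set cs)) \<nu>"
  let ?R = "\<lambda>y. gram_schmidt n as (\<lambda>_ _. 0) y"
  let ?bad = "{y \<in> space P. \<not> survives cs (?R y) (r / 8) y}"
  interpret P1: prob_space ?P1 by (rule prob_space_PiM[OF prob_law])
  interpret P2: prob_space ?P2 by (rule prob_space_PiM[OF prob_law])
  have comp: "(\<lambda>y. y (i, c)) \<in> borel_measurable P" if "i < n" "c \<in> set (as @ cs)" for i c
    unfolding P_def by (rule measurable_entry[OF that])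
  have "Measurable.pred P (\<lambda>y. survives cs (?R y) (r / 8) y)"
    by (intro measurable_survives measurable_gram_schmidt comp borel_measurable_const) auto
  then have bad: "?bad \<in> sets P" by measurable
  have un: "entries (set (as @ cs)) = entries (set as) \<union> entries (set cs)" by auto
  have disj: "entries (set as) \<inter> entries (set cs) = {}" using cs by auto
  have "emeasure P ?bad = (\<integral>\<^sup>+ y. indicator ?bad y \<partial>P)" using bad by simp
  also have "\<dots> = (\<integral>\<^sup>+ x. (\<integral>\<^sup>+ y. indicator ?bad (merge (entries (set as)) (entries (set cs)) (x, y)) \<partial>?P2) \<partial>?P1)"
    using bad unfolding P_def un by (intro product_nn_integral_fold[OF disj]) auto
  also have "\<dots> \<le> (\<integral>\<^sup>+ x. ennreal (n / A + length cs * b) \<partial>?P1)"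
  proof (rule nn_integral_mono)
    fix x assume x: "x \<in> space ?P1"
    let ?m = "\<lambda>y. merge (entries (set as)) (entries (set cs)) (x, y)"
    have left: "?m y (i, c) = x (i, c)" if "y \<in> space ?P2" "c \<in> set as" for y i c
      using x that cs(1) by (auto simp: merge_def space_PiM PiE_def extensional_def)
    have right: "?m y (i, c) = y (i, c)" if "y \<in> space ?P2" "c \<in> set cs" for y i c
      using x that cs(1) by (auto simp: merge_def space_PiM PiE_def extensional_def)
    note gs = gram_schmidt_props[OF zero_matrix(1) zero_matrix(2), where n = n and cs = as and x = x]
    have t1: "tr1 n (?R x) \<le> n - r" using gs(3) cs(3) by (simp add: zero_matrix)
    have "(\<integral>\<^sup>+ y. indicator ?bad (?m y) \<partial>?P2) \<le>
        (\<integral>\<^sup>+ y. indicator {y \<in> space ?P2. \<not> survives cs (?R x) (r / 8) y} y \<partial>?P2)"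
    proof (rule nn_integral_mono)
      fix y assume y: "y \<in> space ?P2"
      have "?R (?m y) = ?R x" by (rule gram_schmidt_cong) (rule left[OF y])
      moreover have "survives cs (?R x) (r / 8) (?m y) = survives cs (?R x) (r / 8) y"
        by (rule survives_cong) (rule right[OF y])
      ultimately show "(indicator ?bad (?m y) :: ennreal) \<le>
          indicator {y \<in> space ?P2. \<not> survives cs (?R x) (r / 8) y} y"
        using y by (auto simp: indicator_def)
    qed
    also have "\<dots> = emeasure ?P2 {y \<in> space ?P2. \<not> survives cs (?R x) (r / 8) y}"
    proof (rule nn_integral_indicator)
      have "Measurable.pred ?P2 (\<lambda>y. survives cs (?R x) (r / 8) y)"
        by (rule measurable_survives) (auto intro!: measurable_entry)
      then show "{y \<in> space ?P2. \<not> survives cs (?R x) (r / 8) y} \<in> sets ?P2" by measurable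
    qed
    also have "\<dots> \<le> ennreal (lyap (n - 7 * r / 8) (length cs) (?R x))"
      by (rule survival_probability) (use cs gs idem_psd[OF gs(1,2)] r in auto)
    also have "\<dots> \<le> ennreal (n / A + length cs * b)"
    proof (rule ennreal_leI)
      have "tr2 n (?R x) / A \<le> n / A"
        using t1 r pos by (intro divide_right_mono) (auto simp: tr2_idem[OF gs(2)])
      moreover have "max 0 (tr1 n (?R x) + D * length cs - (n - 7 * r / 8)) = 0"
        using t1 cs(4) by simp
      ultimately show "lyap (n - 7 * r / 8) (length cs) (?R x) \<le> n / A + length cs * b"
        by (simp add: lyap_def)
    qed
    finally show "(\<integral>\<^sup>+ y. indicator ?bad (?m y) \<partial>?P2) \<le> ennreal (n / A + length cs * b)" .
  qed
  also have "\<dots> = ennreal (n / A + length cs * b)" by (simp add: P1.emeasure_space_1)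
  finally show ?thesis .
qed

end

text \<open>The columns in \<open>as\<close> are projected out and enter with \<open>s = 0\<close>.
  Hence only the coefficients of the block appear on the left, while \<open>w\<close> contains all
  columns: this bounds the distance from the block part to the span of the others.\<close>

lemma (in barrier) block_lower_bound:
  fixes v :: "nat \<Rightarrow> real"
  assumes "survives cs (gram_schmidt n as (\<lambda>_ _. 0) x) (r / 8) x"
  defines "w \<equiv> \<lambda>i. \<Sum>c\<leftarrow>as @ cs. v c * x (i, c)"
  shows "(1 - h) ^ length cs * (r / 8) * (\<Sum>c\<leftarrow>cs. (v c)\<^sup>2) \<le> dot n w w"
proof -
  note gs = gram_schmidt_props[OF zero_matrix(1) zero_matrix(2), where n = n and cs = as and x = x]
  have "lower n (gram_schmidt n as (\<lambda>_ _. 0) x) (\<lambda>i. 0 + (\<Sum>c\<leftarrow>as. v c * x (i, c))) (r / 8 * 0)"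
    using gs(4)[where w = "\<lambda>_. 0" and v = v] zero_matrix(4) by simp
  from survives_lower[OF assms(1) gs(1) idem_psd[OF gs(1,2)] this, of v]
  show ?thesis by (simp add: w_def)
qed

subsection \<open>The smallest singular value of the design\<close>

text \<open>It is enough to test rectangles. A rectangle over all positions is an intersection of
  row boxes; its probability factors over the rows and then inside each row.\<close>

lemma (in prob_space) indep_entries_if_indep_rows:
  fixes X :: "nat \<Rightarrow> 'a \<Rightarrow> nat \<Rightarrow> real"
  assumes rows: "indep_vars (\<lambda>_. vec_borel p) X {..<n}"
    and entries: "\<And>i. i < n \<Longrightarrow> indep_vars (\<lambda>_. borel) (\<lambda>j \<omega>. X i \<omega> j) {..<p}"
    and np: "0 < n" "0 < p"
  shows "indep_vars (\<lambda>_. borel) (\<lambda>q \<omega>. X (fst q) \<omega> (snd q)) ({..<n} \<times> {..<p})"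
proof (subst indep_vars_finite[where E = "\<lambda>_. sets borel"])
  have mX: "random_variable (vec_borel p) (X i)" if "i < n" for i
    using rows that unfolding indep_vars_def by auto
  have mXj: "random_variable borel (\<lambda>\<omega>. X i \<omega> j)" if "i < n" "j < p" for i j
    using entries[OF that(1)] that unfolding indep_vars_def by auto
  show "random_variable borel (\<lambda>\<omega>. X (fst q) \<omega> (snd q))" if "q \<in> {..<n} \<times> {..<p}" for q
    using mXj that by auto
  show "\<forall>A\<in>{..<n} \<times> {..<p} \<rightarrow> sets borel.
      prob (\<Inter>q\<in>{..<n} \<times> {..<p}. (\<lambda>\<omega>. X (fst q) \<omega> (snd q)) -` A q \<inter> space M) =
      (\<Prod>q\<in>{..<n} \<times> {..<p}. prob ((\<lambda>\<omega>. X (fst q) \<omega> (snd q)) -` A q \<inter> space M))"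
  proof
    fix A :: "nat \<times> nat \<Rightarrow> real set" assume A: "A \<in> {..<n} \<times> {..<p} \<rightarrow> sets borel"
    define box where "box i = (\<Pi>\<^sub>E j\<in>{..<p}. A (i, j))" for i
    have box: "box i \<in> sets (vec_borel p)" if "i < n" for i
      unfolding box_def using A that by (intro sets_PiM_I_finite) auto
    have row: "X i -` box i \<inter> space M = (\<Inter>j<p. (\<lambda>\<omega>. X i \<omega> j) -` A (i, j) \<inter> space M)" if "i < n" for i
    proof -
      have "X i \<omega> \<in> extensional {..<p}" if "\<omega> \<in> space M" for \<omega>
        using measurable_space[OF mX[OF \<open>i < n\<close>] that] by (simp add: space_PiM PiE_def)
      \<comment> \<open>For \<open>p = 0\<close> the intersection over the columns would be the
        whole type instead of \<open>space M\<close>.\<close>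
      then show ?thesis using np(2) by (auto simp: box_def PiE_def)
    qed
    have "(\<Inter>q\<in>{..<n} \<times> {..<p}. (\<lambda>\<omega>. X (fst q) \<omega> (snd q)) -` A q \<inter> space M) =
        (\<Inter>i<n. \<Inter>j<p. (\<lambda>\<omega>. X i \<omega> j) -` A (i, j) \<inter> space M)"
      by auto
    also have "\<dots> = (\<Inter>i<n. X i -` box i \<inter> space M)" by (simp add: row)
    finally have eq: "(\<Inter>q\<in>{..<n} \<times> {..<p}. (\<lambda>\<omega>. X (fst q) \<omega> (snd q)) -` A q \<inter> space M) =
       (\<Inter>i<n. X i -` box i \<inter> space M)" .
    have "prob (\<Inter>q\<in>{..<n} \<times> {..<p}. (\<lambda>\<omega>. X (fst q) \<omega> (snd q)) -` A q \<inter> space M) =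
       (\<Prod>i<n. prob (X i -` box i \<inter> space M))"
      unfolding eq by (rule indep_varsD_finite[OF rows]) (use np box in auto)
    also have "\<dots> = (\<Prod>i<n. \<Prod>j<p. prob ((\<lambda>\<omega>. X i \<omega> j) -` A (i, j) \<inter> space M))"
    proof (intro prod.cong refl)
      fix i assume "i \<in> {..<n}"
      then have i: "i < n" by simp
      show "prob (X i -` box i \<inter> space M) = (\<Prod>j<p. prob ((\<lambda>\<omega>. X i \<omega> j) -` A (i, j) \<inter> space M))"
        unfolding row[OF i] using np A i by (intro indep_varsD_finite[OF entries[OF i]]) auto
    qed
    also have "\<dots> = (\<Prod>q\<in>{..<n} \<times> {..<p}. prob ((\<lambda>\<omega>. X (fst q) \<omega> (snd q)) -` A q \<inter> space M))"
      by (simp add: prod.cartesian_product case_prod_beta)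
    finally show "prob (\<Inter>q\<in>{..<n} \<times> {..<p}. (\<lambda>\<omega>. X (fst q) \<omega> (snd q)) -` A q \<inter> space M) = \<dots>" .
  qed
qed (use np in \<open>auto simp: Int_stable_def sets.sigma_sets_eq[of borel, simplified] sets.top[of borel, simplified]\<close>)

lemma card_div_eq_le: "0 < m \<Longrightarrow> card {j. j < p \<and> j div m = t} \<le> (m :: nat)"
proof -
  assume m: "0 < m"
  have "{j. j < p \<and> j div m = t} \<subseteq> {t * m..<t * m + m}"
  proof
    fix j assume "j \<in> {j. j < p \<and> j div m = t}"
    then have "j = t * m + j mod m" by (metis (mono_tags) div_mult_mod_eq mem_Collect_eq)
    then show "j \<in> {t * m..<t * m + m}" using m mod_less_divisor[OF m, of j] by auto
  qed
  from card_mono[OF _ this] show ?thesis by simp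
qed

text \<open>For each \<open>t\<close> the columns are reordered so that block \<open>t\<close> comes
  last, which the product law permits. The union bound over the blocks puts the factor
  \<open>N\<close> into the probability; adding the \<open>N\<close> blockwise bounds puts it into
  the singular value.\<close>

lemma (in prob_space) smallest_singular_value_bound:
  fixes X :: "nat \<Rightarrow> 'a \<Rightarrow> nat \<Rightarrow> real" and n p m N :: nat and r A h K b D :: real
  assumes barrier: "barrier n r A h (184 * K) b D" and K: "1 \<le> K"
    and rows: "indep_vars (\<lambda>_. vec_borel p) X {..<n}"
    and entries: "\<And>i. i < n \<Longrightarrow> indep_vars (\<lambda>_. borel) (\<lambda>j \<omega>. X i \<omega> j) {..<p}"
    and mom: "\<And>i j. i < n \<Longrightarrow> j < p \<Longrightarrow> integrable M (\<lambda>\<omega>. X i \<omega> j ^ 8)"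
      "\<And>i j. i < n \<Longrightarrow> j < p \<Longrightarrow> expectation (\<lambda>\<omega>. X i \<omega> j) = 0"
      "\<And>i j. i < n \<Longrightarrow> j < p \<Longrightarrow> expectation (\<lambda>\<omega>. (X i \<omega> j)\<^sup>2) = 1"
      "\<And>i j. i < n \<Longrightarrow> j < p \<Longrightarrow> expectation (\<lambda>\<omega>. X i \<omega> j ^ 8) \<le> K\<^sup>2"
    and p: "0 < p" "p \<le> n - r" and m: "0 < m" "D * m \<le> r / 8" "h * m \<le> 1 / 2" "p \<le> N * m"
  shows "\<exists>S\<in>sets M. prob (space M - S) \<le> N * (n / A + m * b) \<and>
    (\<forall>\<omega>\<in>S. \<forall>v. r / 16 * (\<Sum>j<p. (v j)\<^sup>2) \<le> N * (\<Sum>i<n. (\<Sum>j<p. v j * X i \<omega> j)\<^sup>2))"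
proof -
  interpret barrier n r A h "184 * K" b D by (rule barrier)
  have n: "0 < n" using pos by simp
  define I where "I = {..<n} \<times> {..<p}"
  define X' where "X' q \<omega> = X (fst q) \<omega> (snd q)" for q \<omega>
  \<comment> \<open>The point mass outside \<open>I\<close> makes every component a probability
    measure.\<close>
  define \<nu> where "\<nu> q = (if q \<in> I then distr M borel (X' q) else return borel 0)" for q
  have ind: "indep_vars (\<lambda>_. borel) X' I"
    using indep_entries_if_indep_rows[OF rows entries n p(1)] by (simp add: I_def X'_def[abs_def])
  have mX: "X' q \<in> borel_measurable M" if "q \<in> I" for q
    using ind that unfolding indep_vars_def by auto
  have pn: "prob_space (\<nu> q)" for q
    using prob_space_distr[OF mX] by (simp add: \<nu>_def prob_space_return)
  have moment: "integrable (\<nu> (i, j)) f \<longleftrightarrow> integrable M (\<lambda>\<omega>. f (X i \<omega> j))"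
    "(\<integral>t. f t \<partial>\<nu> (i, j)) = expectation (\<lambda>\<omega>. f (X i \<omega> j))"
    if "i < n" "j < p" "f \<in> borel_measurable borel" for i j and f :: "real \<Rightarrow> real"
    using that mX[of "(i, j)"] by (simp_all add: \<nu>_def I_def integrable_distr_eq integral_distr X'_def)
  interpret L: design_laws n r A h K b D \<nu> "{..<p}"
  proof (rule design_laws.intro[OF barrier], rule design_laws_axioms.intro)
    show "sets (\<nu> q) = sets borel" for q by (simp add: \<nu>_def)
    show "prob_space (\<nu> q)" for q by (rule pn)
    fix i c assume "i < n" "c \<in> {..<p}"
    then have ic: "i < n" "c < p" by auto
    show "integrable (\<nu> (i, c)) (\<lambda>t. t ^ 8)" using moment(1)[OF ic, of "\<lambda>t. t ^ 8"] mom(1)[OF ic] by simp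
    show "(\<integral>t. t \<partial>\<nu> (i, c)) = 0" using moment(2)[OF ic, of "\<lambda>t. t"] mom(2)[OF ic] by simp
    show "(\<integral>t. t\<^sup>2 \<partial>\<nu> (i, c)) = 1" using moment(2)[OF ic, of "\<lambda>t. t\<^sup>2"] mom(3)[OF ic] by simp
    show "(\<integral>t. t ^ 8 \<partial>\<nu> (i, c)) \<le> K\<^sup>2" using moment(2)[OF ic, of "\<lambda>t. t ^ 8"] mom(4)[OF ic] by simp
  qed (rule K)
  define P where "P = PiM I \<nu>"
  define Z where "Z \<omega> = (\<lambda>q\<in>I. X' q \<omega>)" for \<omega>
  have "distr M (\<Pi>\<^sub>M q\<in>I. borel) Z = (\<Pi>\<^sub>M q\<in>I. distr M borel (X' q))"
    unfolding Z_def using n p mX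
    by (intro indep_vars_iff_distr_eq_PiM'[THEN iffD1, OF _ _ ind]) (auto simp: I_def)
  also have "\<dots> = P" unfolding P_def by (intro PiM_cong) (auto simp: \<nu>_def)
  finally have law_Z: "distr M (\<Pi>\<^sub>M q\<in>I. borel) Z = P" .
  have setsP: "sets P = sets (\<Pi>\<^sub>M q\<in>I. borel)"
    unfolding P_def by (intro sets_PiM_cong refl) (simp add: \<nu>_def)
  have "Z \<in> measurable M (\<Pi>\<^sub>M q\<in>I. borel)"
    unfolding Z_def using mX by (intro measurable_restrict) auto
  then have mZ: "Z \<in> measurable M P" by (simp add: measurable_cong_sets[OF refl setsP])
  define as cs where "as t = filter (\<lambda>j. j div m \<noteq> t) [0..<p]" and "cs t = filter (\<lambda>j. j div m = t) [0..<p]" for t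
  have blocks: "distinct (as t @ cs t)" "set (as t @ cs t) = {..<p}" for t
    by (auto simp: as_def cs_def)
  have len_cs: "length (cs t) \<le> m" for t
  proof -
    have "distinct (cs t)" by (simp add: cs_def)
    then have "length (cs t) = card (set (cs t))" by (rule distinct_card[symmetric])
    also have "set (cs t) = {j. j < p \<and> j div m = t}" by (auto simp: cs_def)
    finally show ?thesis using card_div_eq_le[OF m(1)] by simp
  qed
  have len_as: "length (as t) \<le> n - r" for t
  proof -
    have "length (as t) \<le> p" using length_filter_le[of "\<lambda>j. j div m \<noteq> t" "[0..<p]"] by (simp add: as_def)
    then show ?thesis using p by linarith
  qed
  define ok where "ok t y \<longleftrightarrow> survives (cs t) (gram_schmidt n (as t) (\<lambda>_ _. 0) y) (r / 8) y" for t y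
  define T where "T t = {y \<in> space P. \<not> ok t y}" for t
  have T_sets: "T t \<in> sets P" for t
  proof -
    have "Measurable.pred P (ok t)"
      unfolding ok_def P_def I_def
      by (intro measurable_survives measurable_gram_schmidt borel_measurable_const L.measurable_entry)
        (auto simp: as_def cs_def)
    then show ?thesis unfolding T_def by measurable
  qed
  have Tp: "prob (Z -` T t \<inter> space M) \<le> n / A + m * b" for t
  proof -
    have "emeasure M (Z -` T t \<inter> space M) = emeasure (distr M (\<Pi>\<^sub>M q\<in>I. borel) Z) (T t)"
      using mZ T_sets by (subst emeasure_distr) (auto simp: measurable_cong_sets[OF refl setsP] setsP)
    also have "\<dots> = emeasure P (T t)" by (simp only: law_Z)
    also have "\<dots> \<le> ennreal (n / A + length (cs t) * b)"
    proof -
      have "D * length (cs t) \<le> D * m" using len_cs[of t] pos by (intro mult_left_mono) auto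
      then have "D * length (cs t) \<le> r / 8" using m by linarith
      from L.block_survival_probability[OF blocks(1)[of t] _ len_as this] show ?thesis
        unfolding blocks(2) by (simp add: P_def I_def T_def ok_def)
    qed
    also have "\<dots> \<le> ennreal (n / A + m * b)"
      using len_cs[of t] pos by (intro ennreal_leI add_left_mono mult_right_mono) auto
    finally have "ennreal (prob (Z -` T t \<inter> space M)) \<le> ennreal (n / A + m * b)"
      by (simp add: emeasure_eq_measure)
    then show ?thesis using pos by (subst (asm) ennreal_le_iff) auto
  qed
  have Tm: "Z -` T t \<inter> space M \<in> sets M" for t by (rule measurable_sets[OF mZ T_sets])
  define S where "S = space M - (\<Union>t<N. Z -` T t \<inter> space M)"
  have "S \<in> sets M" unfolding S_def using Tm by (intro sets.compl_sets sets.finite_UN) auto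
  moreover have "prob (space M - S) \<le> N * (n / A + m * b)"
  proof -
    have "prob (space M - S) = prob (\<Union>t<N. Z -` T t \<inter> space M)"
      unfolding S_def by (rule arg_cong[where f = prob]) auto
    also have "\<dots> \<le> (\<Sum>t<N. prob (Z -` T t \<inter> space M))"
      using Tm by (intro finite_measure_subadditive_finite) auto
    also have "\<dots> \<le> (\<Sum>t<N. n / A + m * b)" by (intro sum_mono Tp)
    finally show ?thesis by simp
  qed
  moreover have "r / 16 * (\<Sum>j<p. (v j)\<^sup>2) \<le> N * (\<Sum>i<n. (\<Sum>j<p. v j * X i \<omega> j)\<^sup>2)" if \<omega>: "\<omega> \<in> S" for \<omega> v
  proof -
    let ?w = "\<lambda>i. \<Sum>j<p. v j * X i \<omega> j"
    have Zsp: "Z \<omega> \<in> space P" using measurable_space[OF mZ] \<omega> by (auto simp: S_def)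
    have block: "r / 16 * (\<Sum>j\<in>{j. j < p \<and> j div m = t}. (v j)\<^sup>2) \<le> (\<Sum>i<n. (?w i)\<^sup>2)" if t: "t < N" for t
    proof -
      have "ok t (Z \<omega>)" using \<omega> t Zsp by (auto simp: S_def T_def)
      then have "(1 - h) ^ length (cs t) * (r / 8) * (\<Sum>c\<leftarrow>cs t. (v c)\<^sup>2) \<le>
        dot n (\<lambda>i. \<Sum>c\<leftarrow>as t @ cs t. v c * Z \<omega> (i, c)) (\<lambda>i. \<Sum>c\<leftarrow>as t @ cs t. v c * Z \<omega> (i, c))"
        unfolding ok_def by (rule block_lower_bound)
      also have "\<dots> = dot n ?w ?w"
      proof -
        have "(\<Sum>c\<leftarrow>as t @ cs t. v c * Z \<omega> (i, c)) = ?w i" if "i < n" for i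
        proof -
          have "(\<Sum>c\<leftarrow>as t @ cs t. v c * Z \<omega> (i, c)) = (\<Sum>c\<in>set (as t @ cs t). v c * Z \<omega> (i, c))"
            by (rule sum_list_distinct_conv_sum_set[OF blocks(1)])
          also have "\<dots> = ?w i"
            unfolding blocks(2) using that by (intro sum.cong refl) (auto simp: Z_def I_def X'_def)
          finally show ?thesis .
        qed
        then show ?thesis by (intro dot_cong)
      qed
      also have "\<dots> = (\<Sum>i<n. (?w i)\<^sup>2)" by (simp add: dot_def power2_eq_square)
      also have "(\<Sum>c\<leftarrow>cs t. (v c)\<^sup>2) = (\<Sum>j\<in>{j. j < p \<and> j div m = t}. (v j)\<^sup>2)"
      proof -
        have "(\<Sum>c\<leftarrow>cs t. (v c)\<^sup>2) = (\<Sum>c\<in>set (cs t). (v c)\<^sup>2)"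
          by (rule sum_list_distinct_conv_sum_set) (simp add: cs_def)
        also have "set (cs t) = {j. j < p \<and> j div m = t}" by (auto simp: cs_def)
        finally show ?thesis .
      qed
      finally have le: "(1 - h) ^ length (cs t) * (r / 8) * (\<Sum>j\<in>{j. j < p \<and> j div m = t}. (v j)\<^sup>2)
          \<le> (\<Sum>i<n. (?w i)\<^sup>2)" .
      \<comment> \<open>Lowering the level along a whole block costs at most a factor 2, which turns
        \<open>r / 8\<close> into \<open>r / 16\<close>.\<close>
      have "1 / 2 \<le> (1 - h) ^ length (cs t)"
      proof -
        have "h * length (cs t) \<le> h * m" using len_cs[of t] pos by (intro mult_left_mono) auto
        then have "1 / 2 \<le> 1 + length (cs t) * (- h)" using m(3) by (simp add: mult.commute)
        also have "\<dots> \<le> (1 + (- h)) ^ length (cs t)" by (rule Bernoulli_inequality) (use h in auto)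
        finally show ?thesis by simp
      qed
      then have "1 / 2 * (r / 8) * (\<Sum>j\<in>{j. j < p \<and> j div m = t}. (v j)\<^sup>2) \<le>
        (1 - h) ^ length (cs t) * (r / 8) * (\<Sum>j\<in>{j. j < p \<and> j div m = t}. (v j)\<^sup>2)"
        using r by (intro mult_right_mono sum_nonneg) auto
      then show ?thesis using le by simp
    qed
    have "(\<Sum>j<p. (v j)\<^sup>2) = (\<Sum>t<N. \<Sum>j\<in>{j. j < p \<and> j div m = t}. (v j)\<^sup>2)"
    proof -
      have "(\<lambda>j. j div m) ` {..<p} \<subseteq> {..<N}"
      proof
        fix t assume "t \<in> (\<lambda>j. j div m) ` {..<p}"
        then obtain j where "j < p" "t = j div m" by auto
        then show "t \<in> {..<N}" using m(1,4) by (auto simp: div_less_iff_less_mult)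
      qed
      from sum.group[OF finite_lessThan finite_lessThan this, of "\<lambda>j. (v j)\<^sup>2"] show ?thesis by simp
    qed
    then have "r / 16 * (\<Sum>j<p. (v j)\<^sup>2) = (\<Sum>t<N. r / 16 * (\<Sum>j\<in>{j. j < p \<and> j div m = t}. (v j)\<^sup>2))"
      by (simp add: sum_distrib_left)
    also have "\<dots> \<le> (\<Sum>t<N. (\<Sum>i<n. (?w i)\<^sup>2))" by (intro sum_mono block) simp
    finally show ?thesis by simp
  qed
  ultimately show ?thesis by blast
qed

text \<open>\<open>A\<close> must grow faster than \<open>n\<close>, because of \<open>n / A\<close>
  and the term with 1330, and more slowly than \<open>n^(3/2) / \<Gamma>\<close>, because of
  \<open>n * \<Gamma>^2 * A^2 / r^4\<close>. The exponent 5/4 is in the middle of this range. A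
  small power of \<open>n\<close> in \<open>\<Gamma>\<close> leaves room for moments that grow like
  powers of a logarithm.\<close>

lemma eventually_barrier:
  fixes c :: real and r A h \<Gamma> b :: "nat \<Rightarrow> real"
  assumes c: "0 < c" "c \<le> 1"
  defines "r \<equiv> \<lambda>n. c * real n" and "A \<equiv> \<lambda>n. real n powr (5 / 4)" and "h \<equiv> \<lambda>n. 128 / (c\<^sup>2 * real n)"
    and "\<Gamma> \<equiv> \<lambda>n. 184 * real n powr (1 / 16)"
  defines "b \<equiv> \<lambda>n. 16384 * (\<Gamma> n)\<^sup>2 * (A n)\<^sup>2 / r n ^ 4 + 1024 * \<Gamma> n * (A n)\<^sup>2 * (h n)\<^sup>2 / (r n)\<^sup>2
        + 1330 * (n / r n)\<^sup>2 / A n + 1024 * \<Gamma> n * (A n)\<^sup>2 / r n ^ 4"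
  shows "eventually (\<lambda>n. barrier n (r n) (A n) (h n) (\<Gamma> n) (b n) (128 / c\<^sup>2 + 2 / c)) sequentially"
    and "(\<lambda>n. n / A n + n * b n) \<longlonglongrightarrow> 0"
proof -
  have e: "eventually (\<lambda>n. 128 / (c\<^sup>2 * real n) \<le> 1 / 4) sequentially"
    "eventually (\<lambda>n. real n \<le> real n powr (5 / 4)) sequentially"
    "eventually (\<lambda>n. real n powr (5 / 4) \<le> real n * (c * real n)) sequentially"
    "eventually (\<lambda>n. real n powr (5 / 8) \<le> 1 / (4 * (128 / (c\<^sup>2 * real n)))) sequentially"
    "eventually (\<lambda>n. 4 * real n powr (5 / 4) \<le> c * real n / (8 * (128 / (c\<^sup>2 * real n)))) sequentially"
    "eventually (\<lambda>n. 1 \<le> 184 * real n powr (1 / 16)) sequentially"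
    "eventually (\<lambda>n. 184 * real n powr (1 / 16) * (3 + real n powr (5 / 8)) \<le> real n) sequentially"
    using c by real_asymp+
  have lim: "(\<lambda>n. 16384 * (184 * real n powr (1 / 16))\<^sup>2 * (real n powr (5 / 4))\<^sup>2 / (c * real n) ^ 4
      + 1024 * (184 * real n powr (1 / 16)) * (real n powr (5 / 4))\<^sup>2 * (128 / (c\<^sup>2 * real n))\<^sup>2 / (c * real n)\<^sup>2) \<longlonglongrightarrow> 0"
    using c by real_asymp
  have small: "eventually (\<lambda>n. 16384 * (\<Gamma> n)\<^sup>2 * (A n)\<^sup>2 / r n ^ 4
      + 1024 * \<Gamma> n * (A n)\<^sup>2 * (h n)\<^sup>2 / (r n)\<^sup>2 \<le> 1 / 2) sequentially"
    using order_tendstoD(2)[OF lim, of "1 / 2"] unfolding \<Gamma>_def A_def r_def h_def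
    by (auto elim!: eventually_mono)
  show "eventually (\<lambda>n. barrier n (r n) (A n) (h n) (\<Gamma> n) (b n) (128 / c\<^sup>2 + 2 / c)) sequentially"
    using e small eventually_gt_at_top[of 0]
  proof eventually_elim
    case (elim n)
    have sq: "sqrt (real n powr (5 / 4)) = real n powr (5 / 8)"
      using elim by (simp add: powr_half_sqrt[symmetric] powr_powr)
    show ?case
    proof (rule barrier.intro)
      show "0 < r n" "r n \<le> real n" using elim c by (simp_all add: r_def mult_left_le_one_le)
      show "h n = real (128 * n) / (r n)\<^sup>2" using elim c by (simp add: h_def r_def power2_eq_square)
      show "h n \<le> 1 / 4" "real n \<le> A n" "A n \<le> real n * r n" "4 * A n \<le> r n / (8 * h n)"
        using elim unfolding h_def A_def r_def by blast+
      show "sqrt (A n) \<le> 1 / (4 * h n)" using elim unfolding A_def sq h_def by blast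
      show "1 \<le> \<Gamma> n" "\<Gamma> n * (3 + sqrt (A n)) \<le> real n" using elim unfolding A_def sq \<Gamma>_def by blast+
      show "128 / c\<^sup>2 + 2 / c = h n * real n + real (2 * n) / r n" using elim c by (simp add: h_def r_def)
    qed (use elim in \<open>simp_all add: b_def\<close>)
  qed
  show "(\<lambda>n. n / A n + n * b n) \<longlonglongrightarrow> 0"
    unfolding b_def \<Gamma>_def A_def r_def h_def using c by real_asymp
qed

section \<open>Eighth moments of the entries from concentration\<close>

lemma (in prob_space) integrable_eighth_if_tail:
  fixes Y :: "'a \<Rightarrow> real"
  assumes [measurable]: "Y \<in> borel_measurable M" and c: "0 < c" and C: "0 \<le> C"
    and tail: "\<And>t. t > 0 \<Longrightarrow> prob {\<omega> \<in> space M. \<bar>Y \<omega>\<bar> > t} \<le> C * exp (- c * t\<^sup>2)"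
  shows "integrable M (\<lambda>\<omega>. Y \<omega> ^ 8)" "expectation (\<lambda>\<omega>. Y \<omega> ^ 8) \<le> 1 + 1066667 * C / c ^ 5"
proof -
  \<comment> \<open>On the layer between \<open>2^k\<close> and \<open>2^(k+1)\<close> the eighth
    power is at most \<open>256 * 2^(8 k)\<close>, and \<open>exp (- t) \<le> 3125 / t^5\<close>
    with \<open>t^5 = c^5 * 2^(10 k)\<close> leaves a geometric factor \<open>4^(-k)\<close>. Then
    \<open>800000 = 256 * 3125\<close>; summing the layers contributes 4/3.\<close>
  define a where "a = 800000 * C / c ^ 5"
  have a: "0 \<le> a" using C c by (simp add: a_def)
  let ?E = "\<lambda>k::nat. {\<omega> \<in> space M. \<bar>Y \<omega>\<bar> > 2 ^ k}"
  have tail': "2 ^ (8 * (k + 1)) * prob (?E k) \<le> a * (1 / 4) ^ k" for k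
  proof -
    define t where "t = c * (2 ^ k)\<^sup>2"
    have t: "0 < t" using c by (simp add: t_def)
    have "(t / 5) ^ 5 \<le> (1 + t / 5) ^ 5" using t by (intro power_mono) auto
    also have "\<dots> \<le> exp t" using exp_ge_one_plus_x_over_n_power_n[of 5 t] t by simp
    finally have "t ^ 5 / 3125 \<le> exp t" by (simp add: power_divide)
    then have "exp (- t) \<le> 3125 / t ^ 5"
      using t by (simp add: exp_minus field_simps)
    then have "C * exp (- t) \<le> C * (3125 / t ^ 5)" using C by (rule mult_left_mono)
    moreover have "prob (?E k) \<le> C * exp (- t)" using tail[of "2 ^ k"] by (simp add: t_def)
    ultimately have "2 ^ (8 * (k + 1)) * prob (?E k) \<le> 2 ^ (8 * (k + 1)) * (C * (3125 / t ^ 5))"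
      by (intro mult_left_mono) auto
    also have "\<dots> = a * (1 / 4) ^ k"
    proof -
      have "t ^ 5 = c ^ 5 * (2 ^ (8 * k) * 4 ^ k)"
      proof -
        have "((2::real) ^ k)\<^sup>2 ^ 5 = 2 ^ (10 * k)" by (simp add: power_mult[symmetric] mult.commute)
        also have "\<dots> = 2 ^ (8 * k) * 2 ^ (2 * k)" by (simp add: power_add[symmetric])
        also have "(2::real) ^ (2 * k) = 4 ^ k" by (simp add: power_mult)
        finally show ?thesis by (simp add: t_def power_mult_distrib)
      qed
      moreover have "(2::real) ^ (8 * (k + 1)) = 256 * 2 ^ (8 * k)" by (simp add: power_add)
      ultimately show ?thesis using c by (simp add: a_def field_simps)
    qed
    finally show ?thesis .
  qed
  have pt: "ennreal (Y \<omega> ^ 8) \<le> 1 + (\<Sum>k. ennreal (2 ^ (8 * (k + 1))) * indicator (?E k) \<omega>)"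
    if \<omega>: "\<omega> \<in> space M" for \<omega>
  proof (cases "\<bar>Y \<omega>\<bar> \<le> 1")
    case True
    then have "\<bar>Y \<omega>\<bar> ^ 8 \<le> 1" by (intro power_le_one) auto
    then have "ennreal (Y \<omega> ^ 8) \<le> 1" by (simp add: power_even_abs)
    then show ?thesis by (rule order.trans) (simp add: add_increasing2)
  next
    case False
    define k where "k = (LEAST k. \<bar>Y \<omega>\<bar> \<le> 2 ^ (k + 1))"
    obtain j where "\<bar>Y \<omega>\<bar> < 2 ^ j" using real_arch_pow[of 2 "\<bar>Y \<omega>\<bar>"] by auto
    then have "\<bar>Y \<omega>\<bar> \<le> 2 ^ (j + 1)" by simp
    then have k1: "\<bar>Y \<omega>\<bar> \<le> 2 ^ (k + 1)" unfolding k_def by (rule LeastI)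
    have k2: "2 ^ k < \<bar>Y \<omega>\<bar>"
    proof (cases k)
      case 0
      then show ?thesis using False by simp
    next
      case (Suc k')
      then have "\<not> \<bar>Y \<omega>\<bar> \<le> 2 ^ (k' + 1)" unfolding k_def by (intro not_less_Least) simp
      then show ?thesis using Suc by simp
    qed
    have "Y \<omega> ^ 8 = \<bar>Y \<omega>\<bar> ^ 8" by (simp add: power_even_abs)
    also have "\<dots> \<le> (2 ^ (k + 1)) ^ 8" using k1 by (intro power_mono) auto
    also have "\<dots> = 2 ^ (8 * (k + 1))" by (simp only: power_mult[symmetric] mult.commute)
    finally have "ennreal (Y \<omega> ^ 8) \<le> ennreal (2 ^ (8 * (k + 1))) * indicator (?E k) \<omega>"
      using \<omega> k2 by (simp add: ennreal_leI)
    also have "\<dots> \<le> (\<Sum>k. ennreal (2 ^ (8 * (k + 1))) * indicator (?E k) \<omega>)"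
    proof -
      define f where "f k = ennreal (2 ^ (8 * (k + 1))) * indicator (?E k) \<omega>" for k
      have "f k \<le> suminf f" using sum_le_suminf[of f "{k}"] by simp
      then show ?thesis unfolding f_def[abs_def] .
    qed
    finally show ?thesis by (rule order.trans) (simp add: add_increasing)
  qed
  have "(\<integral>\<^sup>+ \<omega>. ennreal (Y \<omega> ^ 8) \<partial>M) \<le>
      (\<integral>\<^sup>+ \<omega>. 1 + (\<Sum>k. ennreal (2 ^ (8 * (k + 1))) * indicator (?E k) \<omega>) \<partial>M)"
    by (rule nn_integral_mono) (rule pt)
  also have "\<dots> = 1 + (\<Sum>k. ennreal (2 ^ (8 * (k + 1))) * emeasure M (?E k))"
    by (subst nn_integral_add) (auto simp: emeasure_space_1 nn_integral_suminf nn_integral_cmult_indicator)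
  also have "\<dots> \<le> 1 + (\<Sum>k. ennreal (a * (1 / 4) ^ k))"
  proof (intro add_left_mono suminf_le summableI)
    fix k
    have "ennreal (2 ^ (8 * (k + 1))) * emeasure M (?E k) = ennreal (2 ^ (8 * (k + 1)) * prob (?E k))"
      by (simp add: emeasure_eq_measure ennreal_mult)
    then show "ennreal (2 ^ (8 * (k + 1))) * emeasure M (?E k) \<le> ennreal (a * (1 / 4) ^ k)"
      using tail'[of k] by (simp add: ennreal_leI)
  qed
  also have "(\<Sum>k. ennreal (a * (1 / 4) ^ k)) = ennreal (a * (4 / 3))"
  proof (rule suminf_ennreal_eq)
    have "(\<lambda>k. (1 / 4 :: real) ^ k) sums (1 / (1 - 1 / 4))" by (rule geometric_sums) simp
    then show "(\<lambda>k. a * (1 / 4) ^ k) sums (a * (4 / 3))" by (intro sums_mult) simp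
  qed (use a in simp)
  also have "1 + ennreal (a * (4 / 3)) = ennreal (1 + a * (4 / 3))"
    using a by (simp add: ennreal_plus)
  finally have le: "(\<integral>\<^sup>+ \<omega>. ennreal (Y \<omega> ^ 8) \<partial>M) \<le> ennreal (1 + a * (4 / 3))" .
  show int: "integrable M (\<lambda>\<omega>. Y \<omega> ^ 8)"
    by (rule integrableI_nonneg) (use le in \<open>auto simp: order.strict_trans1\<close>)
  have "ennreal (expectation (\<lambda>\<omega>. Y \<omega> ^ 8)) \<le> ennreal (1 + a * (4 / 3))"
    using le nn_integral_eq_integral[OF int] by simp
  then have "expectation (\<lambda>\<omega>. Y \<omega> ^ 8) \<le> 1 + a * (4 / 3)"
    using a by (subst (asm) ennreal_le_iff) auto
  also have "\<dots> \<le> 1 + 1066667 * C / c ^ 5"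
  proof -
    define q where "q = C / c ^ 5"
    have "0 \<le> q" using C c by (simp add: q_def)
    moreover have "a = 800000 * q" "1066667 * C / c ^ 5 = 1066667 * q" by (simp_all add: a_def q_def)
    ultimately show ?thesis by linarith
  qed
  finally show "expectation (\<lambda>\<omega>. Y \<omega> ^ 8) \<le> 1 + 1066667 * C / c ^ 5" .
qed

lemma eighth_power_add_le: "(x + y) ^ 8 \<le> 128 * (x ^ 8 + y ^ 8)" for x y :: real
proof -
  have sq: "(u + v)\<^sup>2 \<le> 2 * (u\<^sup>2 + v\<^sup>2)" for u v :: real
    using sum_squares_bound[of u v] by (simp add: power2_sum)
  have "(x + y) ^ 8 = (((x + y)\<^sup>2)\<^sup>2)\<^sup>2" by (simp add: power_mult[symmetric])
  also have "\<dots> \<le> ((2 * (x\<^sup>2 + y\<^sup>2))\<^sup>2)\<^sup>2" by (intro power_mono sq) auto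
  also have "\<dots> = 16 * ((x\<^sup>2 + y\<^sup>2)\<^sup>2)\<^sup>2" by (simp add: power_mult_distrib del: distrib_left_numeral)
  also have "\<dots> \<le> 16 * (2 * ((x\<^sup>2)\<^sup>2 + (y\<^sup>2)\<^sup>2))\<^sup>2" by (intro mult_left_mono power_mono sq) auto
  also have "\<dots> = 64 * ((x\<^sup>2)\<^sup>2 + (y\<^sup>2)\<^sup>2)\<^sup>2" by (simp add: power_mult_distrib del: distrib_left_numeral)
  also have "\<dots> \<le> 64 * (2 * (((x\<^sup>2)\<^sup>2)\<^sup>2 + ((y\<^sup>2)\<^sup>2)\<^sup>2))" by (intro mult_left_mono sq) auto
  finally show ?thesis by (simp add: power_mult[symmetric])
qed

text \<open>By Chebyshev's inequality \<open>|Y| > 2\<close> has probability at most 1/4, less than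
  the 1/2 required of a median, so either kind of centring lies in \<open>[-2, 2]\<close> and
  recentring costs \<open>m ^ 8 \<le> 256\<close>.\<close>

lemma (in prob_space) eighth_moment_if_concentrated:
  fixes Y :: "'a \<Rightarrow> real"
  assumes [measurable]: "Y \<in> borel_measurable M" and sq: "integrable M (\<lambda>\<omega>. (Y \<omega>)\<^sup>2)"
    and mean: "expectation Y = 0" and var: "expectation (\<lambda>\<omega>. (Y \<omega>)\<^sup>2) = 1"
    and c: "0 < c" and C: "0 \<le> C" and m: "m = expect M Y \<or> is_median M Y m"
    and tail: "\<And>t. t > 0 \<Longrightarrow> prob {\<omega> \<in> space M. \<bar>Y \<omega> - m\<bar> > t} \<le> C * exp (- c * t\<^sup>2)"
  shows "integrable M (\<lambda>\<omega>. Y \<omega> ^ 8)"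
    "expectation (\<lambda>\<omega>. Y \<omega> ^ 8) \<le> 128 * (257 + 1066667 * C / c ^ 5)"
proof -
  have cheb: "prob {\<omega> \<in> space M. 2 < \<bar>Y \<omega>\<bar>} \<le> 1 / 4"
  proof -
    have "prob {\<omega> \<in> space M. 2 < \<bar>Y \<omega>\<bar>} \<le> prob {\<omega> \<in> space M. 4 \<le> (Y \<omega>)\<^sup>2}"
    proof (rule finite_measure_mono)
      show "{\<omega> \<in> space M. 2 < \<bar>Y \<omega>\<bar>} \<subseteq> {\<omega> \<in> space M. 4 \<le> (Y \<omega>)\<^sup>2}"
      proof safe
        fix \<omega> assume "2 < \<bar>Y \<omega>\<bar>"
        then have "2\<^sup>2 \<le> \<bar>Y \<omega>\<bar>\<^sup>2" by (intro power_mono) auto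
        then show "4 \<le> (Y \<omega>)\<^sup>2" by simp
      qed
    qed measurable
    also have "\<dots> \<le> expectation (\<lambda>\<omega>. (Y \<omega>)\<^sup>2) / 4"
      by (rule integral_Markov_inequality_measure[OF sq]) auto
    finally show ?thesis using var by simp
  qed
  have m2: "\<bar>m\<bar> \<le> 2"
    using m
  proof
    assume "m = expect M Y"
    then show ?thesis using mean by (simp add: expect_def)
  next
    assume med: "is_median M Y m"
    show ?thesis
    proof (rule ccontr)
      assume "\<not> \<bar>m\<bar> \<le> 2"
      then have "(\<forall>y. m \<le> y \<longrightarrow> 2 < \<bar>y\<bar>) \<or> (\<forall>y. y \<le> m \<longrightarrow> 2 < \<bar>y\<bar>)" by (auto simp: abs_if split: if_splits)
      then have "{\<omega> \<in> space M. m \<le> Y \<omega>} \<subseteq> {\<omega> \<in> space M. 2 < \<bar>Y \<omega>\<bar>} \<or>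
        {\<omega> \<in> space M. Y \<omega> \<le> m} \<subseteq> {\<omega> \<in> space M. 2 < \<bar>Y \<omega>\<bar>}" by blast
      then have "1 / 2 \<le> prob {\<omega> \<in> space M. 2 < \<bar>Y \<omega>\<bar>}"
      proof
        assume "{\<omega> \<in> space M. m \<le> Y \<omega>} \<subseteq> {\<omega> \<in> space M. 2 < \<bar>Y \<omega>\<bar>}"
        then have "prob {\<omega> \<in> space M. m \<le> Y \<omega>} \<le> prob {\<omega> \<in> space M. 2 < \<bar>Y \<omega>\<bar>}"
          by (rule finite_measure_mono) measurable
        then show ?thesis using med by (auto simp: is_median_def)
      next
        assume "{\<omega> \<in> space M. Y \<omega> \<le> m} \<subseteq> {\<omega> \<in> space M. 2 < \<bar>Y \<omega>\<bar>}"
        then have "prob {\<omega> \<in> space M. Y \<omega> \<le> m} \<le> prob {\<omega> \<in> space M. 2 < \<bar>Y \<omega>\<bar>}"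
          by (rule finite_measure_mono) measurable
        then show ?thesis using med by (auto simp: is_median_def)
      qed
      then show False using cheb by simp
    qed
  qed
  have m8: "m ^ 8 \<le> 256"
  proof -
    have "m ^ 8 = \<bar>m\<bar> ^ 8" by (simp add: power_even_abs)
    also have "\<dots> \<le> 2 ^ 8" using m2 by (intro power_mono) auto
    finally show ?thesis by simp
  qed
  have mYm: "(\<lambda>\<omega>. Y \<omega> - m) \<in> borel_measurable M" by measurable
  note e = integrable_eighth_if_tail[OF mYm c C tail]
  have pt: "Y \<omega> ^ 8 \<le> 128 * ((Y \<omega> - m) ^ 8 + 256)" for \<omega>
    using eighth_power_add_le[of "Y \<omega> - m" m] m8 by simp
  have ib: "integrable M (\<lambda>\<omega>. 128 * ((Y \<omega> - m) ^ 8 + 256))" using e(1) by simp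
  show i: "integrable M (\<lambda>\<omega>. Y \<omega> ^ 8)"
  proof (rule Bochner_Integration.integrable_bound[OF ib])
    show "AE \<omega> in M. norm (Y \<omega> ^ 8) \<le> norm (128 * ((Y \<omega> - m) ^ 8 + 256))"
      using pt by (intro AE_I2) (auto intro!: order.trans[OF _ abs_ge_self])
  qed measurable
  have "expectation (\<lambda>\<omega>. Y \<omega> ^ 8) \<le> expectation (\<lambda>\<omega>. 128 * ((Y \<omega> - m) ^ 8 + 256))"
    by (rule integral_mono[OF i ib pt])
  also have "\<dots> = 128 * (expectation (\<lambda>\<omega>. (Y \<omega> - m) ^ 8) + 256)"
    using e(1) by (simp add: prob_space)
  also have "\<dots> \<le> 128 * (257 + 1066667 * C / c ^ 5)" using e(2) by simp
  finally show "expectation (\<lambda>\<omega>. Y \<omega> ^ 8) \<le> 128 * (257 + 1066667 * C / c ^ 5)" .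
qed

text \<open>A coordinate is a convex 1-Lipschitz function, so concentration applies to single
  entries. Their eighth moments grow at most like a power of \<open>ln n\<close>, hence stay below
  \<open>n^(1/8)\<close>, the square of the \<open>K\<close> used for the barrier.\<close>

lemma eventually_eighth_moments:
  fixes M :: "nat \<Rightarrow> 'a measure"
  assumes ps: "\<And>n. prob_space (M n)" and iso: "iid_isotropic_design M p X" and cc: "convex_concentration M p X"
  shows "eventually (\<lambda>n. \<forall>i<n. \<forall>j<p n. integrable (M n) (\<lambda>\<omega>. X n i \<omega> j ^ 8) \<and>
     (\<integral>\<omega>. X n i \<omega> j \<partial>M n) = 0 \<and> (\<integral>\<omega>. (X n i \<omega> j)\<^sup>2 \<partial>M n) = 1 \<and>
     (\<integral>\<omega>. X n i \<omega> j ^ 8 \<partial>M n) \<le> (real n powr (1 / 16))\<^sup>2) sequentially"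
proof -
  from cc obtain C c :: "nat \<Rightarrow> real" and \<alpha> :: real where
    H: "\<alpha> \<ge> 0 \<and> Bseq C \<and> (\<forall>n. c n > 0) \<and> (\<lambda>n. 1 / c n) \<in> O(\<lambda>n. ln (real n) powr \<alpha>) \<and>
        (\<forall>n. \<forall>i<n. \<forall>F. vec_convex (p n) F \<and> vec_1_lipschitz (p n) F \<longrightarrow>
           (\<exists>m. (m = expect (M n) (\<lambda>\<omega>. F (X n i \<omega>)) \<or> is_median (M n) (\<lambda>\<omega>. F (X n i \<omega>)) m) \<and>
                (\<forall>t>0. measure (M n) {\<omega>\<in>space (M n). \<bar>F (X n i \<omega>) - m\<bar> > t}
                        \<le> C n * exp (- c n * t\<^sup>2))))"
    unfolding convex_concentration_def by (elim exE) (rule that)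
  note conc = H[THEN conjunct2, THEN conjunct2, THEN conjunct2, THEN conjunct2, rule_format]
  have \<alpha>: "Bseq C" "\<And>n. c n > 0" "(\<lambda>n. 1 / c n) \<in> O(\<lambda>n. ln (real n) powr \<alpha>)"
    using H by simp_all
  obtain B where B: "0 < B" "\<And>n. \<bar>C n\<bar> \<le> B" using BseqE[OF \<alpha>(1)] by (metis real_norm_def)
  obtain k where k: "0 < k" "eventually (\<lambda>n. norm (1 / c n) \<le> k * norm (ln (real n) powr \<alpha>)) sequentially"
    using landau_o.bigE[OF \<alpha>(3)] by blast
  have ev: "eventually (\<lambda>n. 128 * (257 + 1066667 * B * (k * ln (real n) powr \<alpha>) ^ 5) \<le> (real n powr (1 / 16))\<^sup>2) sequentially"
    using B k(1) by real_asymp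
  show ?thesis
    using ev k(2)
  proof eventually_elim
    case (elim n)
    show ?case
    proof (intro allI impI)
      fix i j assume ij: "i < n" "j < p n"
      interpret prob_space "M n" by (rule ps)
      have "indep_vars (\<lambda>_. vec_borel (p n)) (X n) {..<n}"
        using iso by (simp add: iid_isotropic_design_def)
      then have vec: "X n i \<in> measurable (M n) (vec_borel (p n))"
        using ij by (simp add: indep_vars_def)
      have my: "(\<lambda>\<omega>. X n i \<omega> j) \<in> borel_measurable (M n)"
        using measurable_compose[OF vec measurable_component_singleton[of j "{..<p n}"]] ij by simp
      have sq: "integrable (M n) (\<lambda>\<omega>. (X n i \<omega> j)\<^sup>2)"
        and mean': "expect (M n) (\<lambda>\<omega>. X n i \<omega> j) = 0"
        and cov: "\<forall>k<p n. covariance (M n) (\<lambda>\<omega>. X n i \<omega> j) (\<lambda>\<omega>. X n i \<omega> k) = (if j = k then 1 else 0)"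
        using iso ij unfolding iid_isotropic_design_def by blast+
      have mean: "expectation (\<lambda>\<omega>. X n i \<omega> j) = 0" using mean' by (simp add: expect_def)
      have "covariance (M n) (\<lambda>\<omega>. X n i \<omega> j) (\<lambda>\<omega>. X n i \<omega> j) = 1" using cov ij by simp
      then have var: "expectation (\<lambda>\<omega>. (X n i \<omega> j)\<^sup>2) = 1"
        unfolding covariance_def mean' by (simp add: expect_def power2_eq_square)
      have vc: "vec_convex (p n) (\<lambda>x. x j)" using ij by (auto simp: vec_convex_def)
      have vl: "vec_1_lipschitz (p n) (\<lambda>x. x j)"
        unfolding vec_1_lipschitz_def
      proof (intro ballI)
        fix x y :: "nat \<Rightarrow> real"
        have "\<bar>x j - y j\<bar> = L2_set (\<lambda>j. x j - y j) {j}" by (simp add: L2_set_def)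
        also have "\<dots> \<le> L2_set (\<lambda>j. x j - y j) {..<p n}"
          unfolding L2_set_def using ij by (intro real_sqrt_le_mono sum_mono2) auto
        finally show "\<bar>x j - y j\<bar> \<le> L2_set (\<lambda>j. x j - y j) {..<p n}" .
      qed
      obtain m where m: "m = expect (M n) (\<lambda>\<omega>. X n i \<omega> j) \<or> is_median (M n) (\<lambda>\<omega>. X n i \<omega> j) m"
        and tail: "\<And>t. t > 0 \<Longrightarrow> prob {\<omega>\<in>space (M n). \<bar>X n i \<omega> j - m\<bar> > t} \<le> C n * exp (- c n * t\<^sup>2)"
        using conc[OF ij(1) conjI[OF vc vl]] by (elim exE conjE) (rule that, auto)
      have tailB: "prob {\<omega>\<in>space (M n). \<bar>X n i \<omega> j - m\<bar> > t} \<le> B * exp (- c n * t\<^sup>2)" if "t > 0" for t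
      proof -
        have "C n * exp (- c n * t\<^sup>2) \<le> B * exp (- c n * t\<^sup>2)"
          using B(2)[of n] by (intro mult_right_mono) auto
        then show ?thesis using tail[OF that] by linarith
      qed
      note e = eighth_moment_if_concentrated[OF my sq mean var \<alpha>(2)[of n] less_imp_le[OF B(1)] m tailB]
      have "1066667 * B / c n ^ 5 = 1066667 * B * (1 / c n) ^ 5" by (simp add: power_one_over)
      also have "\<dots> \<le> 1066667 * B * (k * ln (real n) powr \<alpha>) ^ 5"
        using elim(2) B(1) \<alpha>(2)[of n] by (intro mult_left_mono power_mono) auto
      finally have "expectation (\<lambda>\<omega>. X n i \<omega> j ^ 8) \<le> (real n powr (1 / 16))\<^sup>2"
        using e(2) elim(1) by simp
      then show "integrable (M n) (\<lambda>\<omega>. X n i \<omega> j ^ 8) \<and> expectation (\<lambda>\<omega>. X n i \<omega> j) = 0 \<and>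
         expectation (\<lambda>\<omega>. (X n i \<omega> j)\<^sup>2) = 1 \<and> expectation (\<lambda>\<omega>. X n i \<omega> j ^ 8) \<le> (real n powr (1 / 16))\<^sup>2"
        using e(1) mean var by simp
    qed
  qed
qed

lemma smallest_singular_value_linear:
  fixes M :: "nat \<Rightarrow> 'a measure"
  assumes ps: "\<And>n. prob_space (M n)" and iso: "iid_isotropic_design M p X" and cc: "convex_concentration M p X"
    and ent: "iid_entries M p X"
    and ratio: "(\<lambda>n. real (p n) / real n) \<longlonglongrightarrow> \<kappa>" "0 < \<kappa>" "\<kappa> < 1"
  shows "\<exists>\<mu>>0. \<exists>S. (\<forall>n. S n \<in> sets (M n)) \<and> (\<lambda>n. measure (M n) (space (M n) - S n)) \<longlonglongrightarrow> 0 \<and>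
    (\<forall>n. \<forall>\<omega>\<in>S n. \<forall>v. \<mu> * real n * (\<Sum>j<p n. (v j)\<^sup>2) \<le> (\<Sum>i<n. (\<Sum>j<p n. v j * X n i \<omega> j)\<^sup>2))"
proof -
  \<comment> \<open>Half of the gap between \<open>\<kappa>\<close> and 1, so that eventually
    \<open>p \<le> n - r\<close> with \<open>r = c * n\<close>.\<close>
  define c where "c = (1 - \<kappa>) / 2"
  have c: "0 < c" "c \<le> 1" using ratio by (auto simp: c_def)
  define r A h \<Gamma> where "r n = c * real n" and "A n = real n powr (5 / 4)" and "h n = 128 / (c\<^sup>2 * real n)"
    and "\<Gamma> n = 184 * real n powr (1 / 16)" for n
  define b where "b n = 16384 * (\<Gamma> n)\<^sup>2 * (A n)\<^sup>2 / r n ^ 4 + 1024 * \<Gamma> n * (A n)\<^sup>2 * (h n)\<^sup>2 / (r n)\<^sup>2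
        + 1330 * (n / r n)\<^sup>2 / A n + 1024 * \<Gamma> n * (A n)\<^sup>2 / r n ^ 4" for n
  define D where "D = 128 / c\<^sup>2 + 2 / c"
  note eb = eventually_barrier[OF c, folded r_def A_def h_def \<Gamma>_def, folded b_def D_def]
  \<comment> \<open>As \<open>D \<le> 130 / c^2\<close>, the requirement
    \<open>D * \<eta> \<le> c / 8\<close> is met by \<open>c^3 / (8 * 130)\<close>.\<close>
  define \<eta> where "\<eta> = c ^ 3 / 1040"
  have \<eta>: "0 < \<eta>" "\<eta> \<le> 1" using c power_le_one[of c 3] by (auto simp: \<eta>_def)
  have D: "0 < D" "D * \<eta> \<le> c / 8" "128 / c\<^sup>2 * \<eta> \<le> 1 / 2"
  proof -
    show "0 < D" using c by (simp add: D_def add_pos_pos)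
    have "D * \<eta> = (128 * c + 2 * c\<^sup>2) / 1040"
      using c by (simp add: D_def \<eta>_def field_simps eval_nat_numeral)
    moreover have "c\<^sup>2 \<le> c" using c by (simp add: power2_eq_square mult_left_le)
    ultimately show "D * \<eta> \<le> c / 8" by simp
    have "128 / c\<^sup>2 * \<eta> = 128 * c / 1040" using c by (simp add: \<eta>_def field_simps eval_nat_numeral)
    also have "\<dots> \<le> 1 / 2" using c by simp
    finally show "128 / c\<^sup>2 * \<eta> \<le> 1 / 2" .
  qed
  define m where "m n = nat \<lfloor>\<eta> * real n\<rfloor>" for n
  have m_le: "real (m n) \<le> \<eta> * real n" and m_ge: "\<eta> * real n - 1 \<le> real (m n)" for n
  proof -
    show "real (m n) \<le> \<eta> * real n" using \<eta> by (simp add: m_def of_nat_floor)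
    show "\<eta> * real n - 1 \<le> real (m n)" unfolding m_def by linarith
  qed
  \<comment> \<open>Twice as many blocks as \<open>1 / \<eta>\<close>, which absorbs the rounding in
    \<open>m\<close>: \<open>n \<le> N * m\<close> as soon as
    \<open>n \<ge> 2 / \<eta>\<close>.\<close>
  define N where "N = nat \<lceil>2 / \<eta>\<rceil>"
  have N: "2 / \<eta> \<le> real N" unfolding N_def by linarith
  have Npos: "0 < real N" using N \<eta>(1) by (intro order.strict_trans2[OF _ N]) simp
  define \<mu> where "\<mu> = c / (16 * N)"
  define good where "good n S \<longleftrightarrow> S \<in> sets (M n) \<and>
     measure (M n) (space (M n) - S) \<le> real N * (real n / A n + real n * b n) \<and>
    (\<forall>\<omega>\<in>S. \<forall>v. \<mu> * real n * (\<Sum>j<p n. (v j)\<^sup>2) \<le> (\<Sum>i<n. (\<Sum>j<p n. v j * X n i \<omega> j)\<^sup>2))" for n S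
  have p1: "eventually (\<lambda>n. 0 < real (p n) / real n) sequentially"
    using order_tendstoD(1)[OF ratio(1,2)] .
  have p2: "eventually (\<lambda>n. real (p n) / real n < 1 - c) sequentially"
  proof (rule order_tendstoD(2)[OF ratio(1)])
    show "\<kappa> < 1 - c" using ratio(3) by (simp add: c_def field_simps)
  qed
  have hc: "h n * (\<eta> * real n) = 128 / c\<^sup>2 * \<eta>" if "0 < n" for n
    using that by (simp add: h_def)
  have ev: "eventually (\<lambda>n. \<exists>S. good n S) sequentially"
    using eb(1) eventually_eighth_moments[OF ps iso cc] p1 p2 eventually_ge_at_top[of "nat \<lceil>2 / \<eta>\<rceil>"]
  proof eventually_elim
    case (elim n)
    interpret prob_space "M n" by (rule ps)
    interpret barrier n "r n" "A n" "h n" "\<Gamma> n" "b n" D by (rule elim(1))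
    have n: "2 / \<eta> \<le> real n" "0 < real n" using elim(5) pos by linarith+
    have p: "0 < p n" "real (p n) \<le> real n - r n"
      using elim(3,4) n by (auto simp: r_def field_simps)
    have mn: "0 < m n" "D * real (m n) \<le> r n / 8" "h n * real (m n) \<le> 1 / 2" "p n \<le> N * m n"
    proof -
      have "2 \<le> \<eta> * real n" using n \<eta> by (simp add: field_simps)
      then show "0 < m n" using m_ge[of n] by linarith
      have "D * real (m n) \<le> D * (\<eta> * real n)" using m_le D by (intro mult_left_mono) auto
      also have "\<dots> \<le> c / 8 * real n" using D(2) n by (simp only: mult.assoc[symmetric]) (intro mult_right_mono, auto)
      finally show "D * real (m n) \<le> r n / 8" by (simp add: r_def)
      have "h n * real (m n) \<le> h n * (\<eta> * real n)" using m_le pos by (intro mult_left_mono) auto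
      also have "\<dots> = 128 / c\<^sup>2 * \<eta>" using n by (intro hc) simp
      finally show "h n * real (m n) \<le> 1 / 2" using D(3) by simp
      have "real n \<le> 2 * real n - 2 / \<eta>" using n by simp
      also have "\<dots> = 2 / \<eta> * (\<eta> * real n - 1)" using \<eta> by (simp add: field_simps)
      also have "\<dots> \<le> real N * real (m n)"
        using N m_ge[of n] \<open>2 \<le> \<eta> * real n\<close> Npos by (intro mult_mono) auto
      finally have "real n \<le> real (N * m n)" by simp
      moreover have "real (p n) \<le> real n" using p r by linarith
      ultimately show "p n \<le> N * m n" by linarith
    qed
    have K: "1 \<le> real n powr (1 / 16)" using n by (intro ge_one_powr_ge_zero) auto
    have rows: "indep_vars (\<lambda>_. vec_borel (p n)) (X n) {..<n}"
      using iso by (simp add: iid_isotropic_design_def)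
    have en: "indep_vars (\<lambda>_. borel) (\<lambda>j \<omega>. X n i \<omega> j) {..<p n}" if "i < n" for i
      using ent that by (simp add: iid_entries_def)
    have ba: "barrier n (r n) (A n) (h n) (184 * real n powr (1 / 16)) (b n) D"
      using elim(1) by (simp add: \<Gamma>_def)
    obtain S where S: "S \<in> sets (M n)" "prob (space (M n) - S) \<le> N * (n / A n + m n * b n)"
      "\<And>\<omega> v. \<omega> \<in> S \<Longrightarrow> r n / 16 * (\<Sum>j<p n. (v j)\<^sup>2) \<le> N * (\<Sum>i<n. (\<Sum>j<p n. v j * X n i \<omega> j)\<^sup>2)"
      using smallest_singular_value_bound[OF ba K rows en _ _ _ _ p mn] elim(2) by blast
    have "good n S" unfolding good_def
    proof (intro conjI ballI allI)
      show "S \<in> sets (M n)" by (rule S)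
      have "\<eta> * real n \<le> 1 * real n" using \<eta> by (intro mult_right_mono) auto
      then have "real (m n) \<le> real n" using m_le[of n] by linarith
      then have "real (m n) * b n \<le> real n * b n" using pos by (intro mult_right_mono) auto
      then have "N * (n / A n + m n * b n) \<le> real N * (real n / A n + real n * b n)"
        by (intro mult_left_mono) auto
      then show "prob (space (M n) - S) \<le> real N * (real n / A n + real n * b n)" using S(2) by linarith
      fix \<omega> v assume "\<omega> \<in> S"
      from S(3)[OF this, of v] show "\<mu> * real n * (\<Sum>j<p n. (v j)\<^sup>2) \<le> (\<Sum>i<n. (\<Sum>j<p n. v j * X n i \<omega> j)\<^sup>2)"
        using Npos by (simp add: \<mu>_def r_def field_simps)
    qed
    then show ?case by blast
  qed
  \<comment> \<open>Where no good set exists the empty set satisfies the lower bound vacuously; the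
    convergence concerns large \<open>n\<close> only.\<close>
  define S where "S n = (if \<exists>S. good n S then SOME S. good n S else {})" for n
  have S: "good n (S n)" if "\<exists>S. good n S" for n
    using someI_ex[OF that] that by (simp add: S_def)
  have "0 < \<mu>" using c Npos by (simp add: \<mu>_def)
  moreover have "S n \<in> sets (M n)" for n
  proof (cases "\<exists>S. good n S")
    case True
    then show ?thesis using S[OF True] unfolding good_def by blast
  qed (simp add: S_def)
  moreover have "\<mu> * real n * (\<Sum>j<p n. (v j)\<^sup>2) \<le> (\<Sum>i<n. (\<Sum>j<p n. v j * X n i \<omega> j)\<^sup>2)" if "\<omega> \<in> S n" for n \<omega> v
  proof (cases "\<exists>S. good n S")
    case True
    then show ?thesis using S[OF True] that unfolding good_def by blast
  next
    case False
    then show ?thesis using that by (simp add: S_def)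
  qed
  moreover have "(\<lambda>n. measure (M n) (space (M n) - S n)) \<longlonglongrightarrow> 0"
  proof (rule tendsto_sandwich[OF _ _ tendsto_const])
    show "(\<lambda>n. real N * (real n / A n + real n * b n)) \<longlonglongrightarrow> 0"
      using tendsto_mult_right_zero[OF eb(2)] .
    show "eventually (\<lambda>n. measure (M n) (space (M n) - S n) \<le> real N * (real n / A n + real n * b n)) sequentially"
      using ev by eventually_elim (use S in \<open>unfold good_def, blast\<close>)
  qed simp
  ultimately show ?thesis by blast
qed

subsection \<open>From strong convexity to the estimators\<close>

lemma strongly_convex_midpoint:
  assumes "strongly_convex f"
  obtains c where "0 < c" "\<And>x y. f ((x + y) / 2) \<le> (f x + f y) / 2 - c * (x - y)\<^sup>2"
proof -
  obtain c where c: "c > 0" "\<And>x y u v. u \<ge> 0 \<Longrightarrow> v \<ge> 0 \<Longrightarrow> u + v = 1 \<Longrightarrow>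
    f (u * x + v * y) \<le> u * f x + v * f y - c / 2 * u * v * (x - y)\<^sup>2"
    using assms unfolding strongly_convex_def by blast
  have "f ((x + y) / 2) \<le> (f x + f y) / 2 - c / 8 * (x - y)\<^sup>2" for x y
    using c(2)[of "1 / 2" "1 / 2" x y] by (simp add: add_divide_distrib)
  then show ?thesis using that[of "c / 8"] c(1) by simp
qed

text \<open>At the midpoint of \<open>\<beta>\<close> and \<open>b\<close> the risk is bounded below
  by minimality of \<open>b\<close> and above by strong convexity. The residuals at
  \<open>\<beta>\<close> and \<open>b\<close> differ by the design applied to
  \<open>\<beta> - b\<close>.\<close>

lemma emp_risk_quadratic_growth:
  assumes n: "0 < n" and c: "\<And>x y. \<rho> ((x + y) / 2) \<le> (\<rho> x + \<rho> y) / 2 - c * (x - y)\<^sup>2"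
    and min: "is_arg_min (emp_risk \<rho> p X \<epsilon> n \<omega>) (\<lambda>\<beta>. \<beta> \<in> vecs (p n)) b"
    and \<beta>: "\<beta> \<in> vecs (p n)"
  shows "2 * c * (\<Sum>i<n. (\<Sum>j<p n. (\<beta> j - b j) * X n i \<omega> j)\<^sup>2) \<le>
    n * (emp_risk \<rho> p X \<epsilon> n \<omega> \<beta> - emp_risk \<rho> p X \<epsilon> n \<omega> b)"
proof -
  define res where "res v i = \<epsilon> n i \<omega> - (\<Sum>j<p n. X n i \<omega> j * v j)" for v i
  have risk: "n * emp_risk \<rho> p X \<epsilon> n \<omega> v = (\<Sum>i<n. \<rho> (res v i))" for v
    using n by (simp add: emp_risk_def res_def)
  define mid where "mid = (\<lambda>j\<in>{..<p n}. (\<beta> j + b j) / 2)"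
  have "mid \<in> vecs (p n)" by (simp add: mid_def)
  then have "emp_risk \<rho> p X \<epsilon> n \<omega> b \<le> emp_risk \<rho> p X \<epsilon> n \<omega> mid"
    using min unfolding is_arg_min_def by (meson not_less)
  then have "n * emp_risk \<rho> p X \<epsilon> n \<omega> b \<le> n * emp_risk \<rho> p X \<epsilon> n \<omega> mid"
    by (intro mult_left_mono) auto
  also have "\<dots> = (\<Sum>i<n. \<rho> ((res \<beta> i + res b i) / 2))"
  proof -
    have eqm: "res mid i = (res \<beta> i + res b i) / 2" for i
    proof -
      have "(\<Sum>j<p n. X n i \<omega> j * mid j) = (\<Sum>j<p n. X n i \<omega> j * \<beta> j / 2 + X n i \<omega> j * b j / 2)"
        by (intro sum.cong refl) (simp add: mid_def field_simps)
      then show ?thesis by (simp add: res_def sum.distrib sum_divide_distrib[symmetric] field_simps)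
    qed
    show ?thesis by (simp only: risk eqm)
  qed
  also have "\<dots> \<le> (\<Sum>i<n. (\<rho> (res \<beta> i) + \<rho> (res b i)) / 2 - c * (res \<beta> i - res b i)\<^sup>2)"
    by (intro sum_mono c)
  also have "\<dots> = (n * emp_risk \<rho> p X \<epsilon> n \<omega> \<beta> + n * emp_risk \<rho> p X \<epsilon> n \<omega> b) / 2
      - c * (\<Sum>i<n. (\<Sum>j<p n. (\<beta> j - b j) * X n i \<omega> j)\<^sup>2)"
  proof -
    have "(res \<beta> i - res b i)\<^sup>2 = (\<Sum>j<p n. (\<beta> j - b j) * X n i \<omega> j)\<^sup>2" for i
    proof -
      have "res b i - res \<beta> i = (\<Sum>j<p n. (\<beta> j - b j) * X n i \<omega> j)"
        by (simp add: res_def sum_subtractf left_diff_distrib mult.commute)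
      then show ?thesis by (metis power2_commute)
    qed
    then show ?thesis
      by (simp add: risk sum_subtractf sum.distrib sum_distrib_left sum_divide_distrib[symmetric])
  qed
  finally show ?thesis by (simp add: algebra_simps)
qed

text \<open>The tangent at \<open>x\<close> gives \<open>\<rho> x \<le> x * deriv \<rho> x\<close>,
  and strong convexity gives \<open>2 * c * x^2 \<le> \<rho> x\<close>, so Young's inequality can
  absorb half of the product. This converts second moments of the score into a bound for the mean
  loss.\<close>

lemma loss_le_score_sq:
  assumes "smooth_convex_loss \<rho>" and c: "0 < c" "\<And>x y. \<rho> ((x + y) / 2) \<le> (\<rho> x + \<rho> y) / 2 - c * (x - y)\<^sup>2"
  shows "\<rho> x \<le> (deriv \<rho> x)\<^sup>2 / (2 * c)"
proof -
  have \<rho>: "\<And>x. \<rho> differentiable (at x)" "convex_on UNIV \<rho>" "\<And>x. \<rho> x \<ge> 0" "\<rho> 0 = 0"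
    using assms(1) by (auto simp: smooth_convex_loss_def)
  have "(\<rho> has_real_derivative deriv \<rho> x) (at x within UNIV)"
    using \<rho>(1)[of x] by (auto simp: DERIV_deriv_iff_real_differentiable)
  then have "\<rho> 0 - \<rho> x \<ge> deriv \<rho> x * (0 - x)"
    by (intro convex_on_imp_above_tangent[OF \<rho>(2)]) auto
  then have le: "\<rho> x \<le> x * deriv \<rho> x" using \<rho>(4) by (simp add: mult.commute)
  have ge: "2 * c * x\<^sup>2 \<le> \<rho> x" using c(2)[of x 0] \<rho>(3)[of "x / 2"] \<rho>(4) by simp
  have "2 * (x * deriv \<rho> x) \<le> 2 * c * x\<^sup>2 + (deriv \<rho> x)\<^sup>2 / (2 * c)"
  proof -
    have "0 \<le> (2 * c * x - deriv \<rho> x)\<^sup>2 / (2 * c)" using c by simp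
    also have "\<dots> = 2 * c * x\<^sup>2 + (deriv \<rho> x)\<^sup>2 / (2 * c) - 2 * (x * deriv \<rho> x)"
      using c(1) by (simp add: power2_eq_square field_simps)
    finally show ?thesis by simp
  qed
  then show ?thesis using le ge by linarith
qed

text \<open>The quantitative bound in the hypothesis makes the limits Cauchy in the penalty, which yields
  the common limit.\<close>

lemma limits_exchange:
  fixes M :: "nat \<Rightarrow> 'a measure" and Y :: "real \<Rightarrow> nat \<Rightarrow> 'a \<Rightarrow> real" and Z :: "nat \<Rightarrow> 'a \<Rightarrow> real"
  assumes ps: "\<And>n. prob_space (M n)"
    and mY: "\<And>\<tau> n. \<tau> > 0 \<Longrightarrow> Y \<tau> n \<in> borel_measurable (M n)" and mZ: "\<And>n. Z n \<in> borel_measurable (M n)"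
    and s: "s \<longlonglongrightarrow> 0"
    and bound: "\<And>\<tau> \<delta> n. 0 < \<tau> \<Longrightarrow> 0 < \<delta> \<Longrightarrow> 0 < n \<Longrightarrow>
      measure (M n) {\<omega> \<in> space (M n). \<bar>Y \<tau> n \<omega> - Z n \<omega>\<bar> > \<delta>} \<le> s n + Q * \<tau> / \<delta>\<^sup>2"
    and Q: "0 \<le> Q"
    and r: "\<And>\<tau>. \<tau> > 0 \<Longrightarrow> tendsto_in_prob M (Y \<tau>) (r \<tau>)"
  shows "\<exists>R. (r \<longlongrightarrow> R) (at_right 0) \<and> tendsto_in_prob M Z R"
proof -
  \<comment> \<open>The added 1 keeps the divisor in \<open>\<theta>\<close> positive when
    \<open>Q = 0\<close>.\<close>
  define q where "q = Q + 1"
  have q: "0 < q" "Q \<le> q" using Q by (simp_all add: q_def)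
  define \<theta> where "\<theta> \<delta> = \<delta>\<^sup>2 / (8 * q)" for \<delta> :: real
  have \<theta>: "0 < \<theta> \<delta>" if "0 < \<delta>" for \<delta> using that q by (simp add: \<theta>_def)
  have small: "Q * \<tau> / \<delta>\<^sup>2 \<le> 1 / 8" if "0 < \<tau>" "\<tau> \<le> \<theta> \<delta>" "0 < \<delta>" for \<tau> \<delta>
  proof -
    have "Q * \<tau> \<le> q * \<theta> \<delta>" using that q by (intro mult_mono) auto
    also have "\<dots> = \<delta>\<^sup>2 / 8" using q by (simp add: \<theta>_def)
    finally show ?thesis using that by (simp add: field_simps)
  qed
  \<comment> \<open>Four exceptional events with probabilities below 1/16, 1/16 and at most 3/16,
    3/16 cannot cover the space. At a remaining sample point both limits are compared through the
    same \<open>Z\<close>, at a cost of \<open>\<delta>\<close> for each of four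
    differences.\<close>
  have near: "\<bar>r \<tau> - r \<tau>'\<bar> \<le> 4 * \<delta>"
    if t: "0 < \<tau>" "\<tau> \<le> \<theta> \<delta>" "0 < \<tau>'" "\<tau>' \<le> \<theta> \<delta>" and \<delta>: "0 < \<delta>" for \<tau> \<tau>' \<delta>
  proof -
    have l1: "eventually (\<lambda>n. measure (M n) {\<omega> \<in> space (M n). \<bar>Y t n \<omega> - r t\<bar> > \<delta>} < 1 / 16) sequentially"
      if "0 < t" for t
      using r[OF that] \<delta> unfolding tendsto_in_prob_def by (intro order_tendstoD(2)[of _ 0]) auto
    have l2: "eventually (\<lambda>n. s n < 1 / 16) sequentially" using s by (rule order_tendstoD(2)) simp
    have "eventually (\<lambda>n. \<bar>r \<tau> - r \<tau>'\<bar> \<le> 4 * \<delta>) sequentially"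
      using l1[OF t(1)] l1[OF t(3)] l2 eventually_gt_at_top[of 0]
    proof eventually_elim
      case (elim n)
      interpret prob_space "M n" by (rule ps)
      note [measurable] = mY[OF t(1), of n] mY[OF t(3), of n] mZ[of n]
      let ?A = "\<lambda>t. {\<omega> \<in> space (M n). \<bar>Y t n \<omega> - r t\<bar> > \<delta>}"
      let ?B = "\<lambda>t. {\<omega> \<in> space (M n). \<bar>Y t n \<omega> - Z n \<omega>\<bar> > \<delta>}"
      have B: "prob (?B \<tau>) \<le> 3 / 16" "prob (?B \<tau>') \<le> 3 / 16"
        using bound[OF t(1) \<delta> elim(4)] bound[OF t(3) \<delta> elim(4)] small[OF t(1,2) \<delta>] small[OF t(3,4) \<delta>] elim(3)
        by linarith+
      have [measurable]: "?A \<tau> \<in> events" "?A \<tau>' \<in> events" "?B \<tau> \<in> events" "?B \<tau>' \<in> events" by measurable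
      have "prob ((?A \<tau> \<union> ?A \<tau>') \<union> (?B \<tau> \<union> ?B \<tau>')) \<le> (prob (?A \<tau>) + prob (?A \<tau>')) + (prob (?B \<tau>) + prob (?B \<tau>'))"
        by (intro order.trans[OF measure_Un_le] add_mono measure_Un_le) measurable
      also have "\<dots> < 1" using elim(1,2) B by linarith
      finally have lt: "prob ((?A \<tau> \<union> ?A \<tau>') \<union> (?B \<tau> \<union> ?B \<tau>')) < 1" .
      have "\<not> space (M n) \<subseteq> (?A \<tau> \<union> ?A \<tau>') \<union> (?B \<tau> \<union> ?B \<tau>')"
      proof
        assume "space (M n) \<subseteq> (?A \<tau> \<union> ?A \<tau>') \<union> (?B \<tau> \<union> ?B \<tau>')"
        then have "prob (space (M n)) \<le> prob ((?A \<tau> \<union> ?A \<tau>') \<union> (?B \<tau> \<union> ?B \<tau>'))"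
          by (rule finite_measure_mono) measurable
        then show False using lt prob_space by simp
      qed
      then obtain \<omega> where "\<omega> \<in> space (M n)" "\<omega> \<notin> (?A \<tau> \<union> ?A \<tau>') \<union> (?B \<tau> \<union> ?B \<tau>')"
        by blast
      then have "\<bar>Y \<tau> n \<omega> - r \<tau>\<bar> \<le> \<delta>" "\<bar>Y \<tau>' n \<omega> - r \<tau>'\<bar> \<le> \<delta>"
        "\<bar>Y \<tau> n \<omega> - Z n \<omega>\<bar> \<le> \<delta>" "\<bar>Y \<tau>' n \<omega> - Z n \<omega>\<bar> \<le> \<delta>"
        by (simp_all add: not_less)
      then show ?case by linarith
    qed
    then show ?thesis by simp
  qed
  have "Cauchy (\<lambda>k. r (1 / real (Suc k)))"
    unfolding Cauchy_def dist_real_def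
  proof (intro allI impI)
    fix e :: real assume e: "0 < e"
    obtain N where N: "1 / real (Suc N) < \<theta> (e / 8)" using reals_Archimedean[OF \<theta>[of "e / 8"]] e
      by (auto simp: inverse_eq_divide)
    have le: "1 / real (Suc k) \<le> \<theta> (e / 8)" if "k \<ge> N" for k
    proof -
      have "1 / real (Suc k) \<le> 1 / real (Suc N)" using that by (intro divide_left_mono) auto
      then show ?thesis using N by linarith
    qed
    have "\<bar>r (1 / real (Suc k)) - r (1 / real (Suc k'))\<bar> < e" if "k \<ge> N" "k' \<ge> N" for k k'
      using near[OF _ le[OF that(1)] _ le[OF that(2)]] e by simp
    then show "\<exists>M. \<forall>m\<ge>M. \<forall>n\<ge>M. \<bar>r (1 / real (Suc m)) - r (1 / real (Suc n))\<bar> < e" by blast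
  qed
  then obtain R where R: "(\<lambda>k. r (1 / real (Suc k))) \<longlonglongrightarrow> R"
    using Cauchy_convergent_iff convergent_def by blast
  have rR: "\<bar>r \<tau> - R\<bar> \<le> 4 * \<delta>" if "0 < \<tau>" "\<tau> \<le> \<theta> \<delta>" "0 < \<delta>" for \<tau> \<delta>
  proof (rule tendsto_upperbound)
    show "(\<lambda>k. \<bar>r \<tau> - r (1 / real (Suc k))\<bar>) \<longlonglongrightarrow> \<bar>r \<tau> - R\<bar>" using R by (intro tendsto_intros)
    have "(\<lambda>k. 1 / real (Suc k)) \<longlonglongrightarrow> 0" using LIMSEQ_inverse_real_of_nat by (simp add: inverse_eq_divide)
    then have "eventually (\<lambda>k. 1 / real (Suc k) < \<theta> \<delta>) sequentially"
      using \<theta>[OF that(3)] by (rule order_tendstoD(2))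
    then show "eventually (\<lambda>k. \<bar>r \<tau> - r (1 / real (Suc k))\<bar> \<le> 4 * \<delta>) sequentially"
      by eventually_elim (use near[OF that(1,2) _ _ that(3)] in auto)
  qed simp
  have "(r \<longlongrightarrow> R) (at_right 0)"
  proof (rule tendstoI)
    fix e :: real assume e: "0 < e"
    have "eventually (\<lambda>\<tau>. \<tau> \<in> {0<..<\<theta> (e / 8)}) (at_right 0)"
      using \<theta>[of "e / 8"] e by (intro eventually_at_right_real) auto
    then show "eventually (\<lambda>\<tau>. dist (r \<tau>) R < e) (at_right 0)"
    proof eventually_elim
      case (elim \<tau>)
      then show ?case using rR[of \<tau> "e / 8"] e by (simp add: dist_real_def)
    qed
  qed
  moreover have "tendsto_in_prob M Z R"
    unfolding tendsto_in_prob_def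
  proof (intro allI impI)
    fix \<delta> :: real assume \<delta>: "0 < \<delta>"
    show "(\<lambda>n. measure (M n) {\<omega> \<in> space (M n). \<bar>Z n \<omega> - R\<bar> > \<delta>}) \<longlonglongrightarrow> 0"
    proof (rule tendstoI)
      fix e :: real assume e: "0 < e"
      define \<delta>' where "\<delta>' = \<delta> / 3"
      have \<delta>': "0 < \<delta>'" using \<delta> by (simp add: \<delta>'_def)
      define \<tau> where "\<tau> = min (\<theta> (\<delta>' / 4)) (e * \<delta>'\<^sup>2 / (3 * q))"
      have \<tau>: "0 < \<tau>" "\<tau> \<le> \<theta> (\<delta>' / 4)" using \<theta>[of "\<delta>' / 4"] \<delta>' e q by (auto simp: \<tau>_def)
      have Q\<tau>: "Q * \<tau> / \<delta>'\<^sup>2 \<le> e / 3"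
      proof -
        have "Q * \<tau> \<le> q * (e * \<delta>'\<^sup>2 / (3 * q))" using \<tau> q by (intro mult_mono) (auto simp: \<tau>_def)
        also have "\<dots> = e / 3 * \<delta>'\<^sup>2" using q by simp
        finally show ?thesis using \<delta>' by (simp add: field_simps)
      qed
      have r\<tau>: "\<bar>r \<tau> - R\<bar> \<le> \<delta>'" using rR[OF \<tau>] \<delta>' by simp
      have l1: "eventually (\<lambda>n. measure (M n) {\<omega> \<in> space (M n). \<bar>Y \<tau> n \<omega> - r \<tau>\<bar> > \<delta>'} < e / 3) sequentially"
        using r[OF \<tau>(1)] \<delta>' e unfolding tendsto_in_prob_def by (intro order_tendstoD(2)[of _ 0]) auto
      have l2: "eventually (\<lambda>n. s n < e / 3) sequentially" using s by (rule order_tendstoD(2)) (use e in simp)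
      show "eventually (\<lambda>n. dist (measure (M n) {\<omega> \<in> space (M n). \<bar>Z n \<omega> - R\<bar> > \<delta>}) 0 < e) sequentially"
        using l1 l2 eventually_gt_at_top[of 0]
      proof eventually_elim
        case (elim n)
        interpret prob_space "M n" by (rule ps)
        note [measurable] = mY[OF \<tau>(1), of n] mZ[of n]
        let ?A = "{\<omega> \<in> space (M n). \<bar>Y \<tau> n \<omega> - r \<tau>\<bar> > \<delta>'}" and ?B = "{\<omega> \<in> space (M n). \<bar>Y \<tau> n \<omega> - Z n \<omega>\<bar> > \<delta>'}"
        have sub: "{\<omega> \<in> space (M n). \<bar>Z n \<omega> - R\<bar> > \<delta>} \<subseteq> ?A \<union> ?B"
          using r\<tau> unfolding \<delta>'_def by (auto simp: not_less) (smt (verit) field_sum_of_halves)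
        have "prob {\<omega> \<in> space (M n). \<bar>Z n \<omega> - R\<bar> > \<delta>} \<le> prob (?A \<union> ?B)"
          by (rule finite_measure_mono[OF sub]) measurable
        also have "\<dots> \<le> prob ?A + prob ?B" by (rule measure_Un_le) measurable
        also have "\<dots> < e" using elim bound[OF \<tau>(1) \<delta>', of n] Q\<tau> by linarith
        finally show ?case by (simp add: dist_real_def)
      qed
    qed
  qed
  ultimately show ?thesis by blast
qed

lemma limsup_tendsto_zero:
  fixes P :: "real \<Rightarrow> nat \<Rightarrow> real"
  assumes s: "s \<longlonglongrightarrow> 0" and nn: "\<And>\<tau> n. 0 \<le> P \<tau> n"
    and bound: "\<And>\<tau> n. 0 < \<tau> \<Longrightarrow> 0 < n \<Longrightarrow> P \<tau> n \<le> s n + Q * \<tau>"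
  shows "((\<lambda>\<tau>. limsup (\<lambda>n. ereal (P \<tau> n))) \<longlongrightarrow> 0) (at_right 0)"
proof (rule tendsto_sandwich[OF _ _ tendsto_const])
  show "eventually (\<lambda>\<tau>. 0 \<le> limsup (\<lambda>n. ereal (P \<tau> n))) (at_right 0)"
    by (intro always_eventually allI le_Limsup) (auto simp: nn)
  have "limsup (\<lambda>n. ereal (P \<tau> n)) \<le> ereal (Q * \<tau>)" if "0 < \<tau>" for \<tau>
  proof -
    have "limsup (\<lambda>n. ereal (P \<tau> n)) \<le> limsup (\<lambda>n. ereal (s n + Q * \<tau>))"
      by (intro Limsup_mono eventually_mono[OF eventually_gt_at_top[of 0]]) (simp add: bound that)
    also have "\<dots> = ereal (Q * \<tau>)"
    proof (rule lim_imp_Limsup)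
      have "(\<lambda>n. s n + Q * \<tau>) \<longlonglongrightarrow> 0 + Q * \<tau>" by (intro tendsto_intros s)
      then show "(\<lambda>n. ereal (s n + Q * \<tau>)) \<longlonglongrightarrow> ereal (Q * \<tau>)" by simp
    qed simp
    finally show ?thesis .
  qed
  then show "eventually (\<lambda>\<tau>. limsup (\<lambda>n. ereal (P \<tau> n)) \<le> ereal (Q * \<tau>)) (at_right 0)"
    by (auto simp: eventually_at_filter)
  have "((\<lambda>\<tau>. Q * \<tau>) \<longlongrightarrow> Q * 0) (at_right 0)" by (intro tendsto_intros)
  then show "((\<lambda>\<tau>. ereal (Q * \<tau>)) \<longlongrightarrow> 0) (at_right 0)" by (simp add: zero_ereal_def)
qed

section \<open>Distance between the two estimators\<close>

lemma argmin_estimator_norm_measurable: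
  assumes "argmin_estimator M p Q b"
  shows "(\<lambda>\<omega>. vnorm (p n) (b n \<omega>)) \<in> borel_measurable (M n)"
proof -
  have b: "b n \<in> measurable (M n) (vec_borel (p n))" using assms by (simp add: argmin_estimator_def)
  have "(\<lambda>\<omega>. b n \<omega> j) \<in> borel_measurable (M n)" if "j \<in> {..<p n}" for j
    using measurable_compose[OF b measurable_component_singleton[OF that]] by simp
  then show ?thesis unfolding L2_set_def by measurable
qed

lemma vnorm_sq: "(vnorm p v)\<^sup>2 = (\<Sum>j<p. (v j)\<^sup>2)"
  by (simp add: L2_set_def sum_nonneg)

lemma vnorm_diff_ge: "\<bar>vnorm p u - vnorm p v\<bar> \<le> vnorm p (\<lambda>j. u j - v j)"
proof -
  have "vnorm p u \<le> vnorm p (\<lambda>j. u j - v j) + vnorm p v"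
    using L2_set_triangle_ineq[of "\<lambda>j. u j - v j" v "{..<p}"] by simp
  moreover have "vnorm p v \<le> vnorm p (\<lambda>j. v j - u j) + vnorm p u"
    using L2_set_triangle_ineq[of "\<lambda>j. v j - u j" u "{..<p}"] by simp
  moreover have "vnorm p (\<lambda>j. v j - u j) = vnorm p (\<lambda>j. u j - v j)"
    by (simp add: L2_set_def power2_commute)
  ultimately show ?thesis by linarith
qed

text \<open>Quadratic growth is used twice: at the zero vector, to bound \<open>|b|^2\<close> by the
  risk there, and at \<open>b'\<close>, whose excess risk is at most the penalty
  \<open>\<tau> / 2 * |b|^2\<close> of \<open>b\<close>. Each use divides by
  \<open>2 * c * \<mu>\<close>.\<close>

lemma ridge_estimator_distance:
  assumes n: "0 < n" and \<tau>: "0 < \<tau>" and c: "0 < c" "\<And>x y. \<rho> ((x + y) / 2) \<le> (\<rho> x + \<rho> y) / 2 - c * (x - y)\<^sup>2"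
    and \<rho>: "\<And>x. 0 \<le> \<rho> x"
    and b: "is_arg_min (emp_risk \<rho> p X \<epsilon> n \<omega>) (\<lambda>\<beta>. \<beta> \<in> vecs (p n)) b"
    and b': "is_arg_min (ridge_risk \<rho> p X \<epsilon> \<tau> n \<omega>) (\<lambda>\<beta>. \<beta> \<in> vecs (p n)) b'"
    and \<mu>: "0 < \<mu>" "\<And>v. \<mu> * real n * (\<Sum>j<p n. (v j)\<^sup>2) \<le> (\<Sum>i<n. (\<Sum>j<p n. v j * X n i \<omega> j)\<^sup>2)"
  shows "(vnorm (p n) (\<lambda>j. b' j - b j))\<^sup>2 \<le> \<tau> / (2 * c * \<mu>)\<^sup>2 * (1 / n * (\<Sum>i<n. \<rho> (\<epsilon> n i \<omega>)))"
proof -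
  let ?G = "emp_risk \<rho> p X \<epsilon> n \<omega>"
  have a: "0 < 2 * c * \<mu>" using c \<mu> by simp
  have growth: "2 * c * \<mu> * (vnorm (p n) (\<lambda>j. \<beta> j - b j))\<^sup>2 \<le> ?G \<beta> - ?G b" if "\<beta> \<in> vecs (p n)" for \<beta>
  proof -
    have "n * (2 * c * \<mu> * (vnorm (p n) (\<lambda>j. \<beta> j - b j))\<^sup>2) =
      2 * c * (\<mu> * real n * (\<Sum>j<p n. (\<beta> j - b j)\<^sup>2))" by (simp add: vnorm_sq)
    also have "\<dots> \<le> 2 * c * (\<Sum>i<n. (\<Sum>j<p n. (\<beta> j - b j) * X n i \<omega> j)\<^sup>2)"
      using c \<mu>(2)[of "\<lambda>j. \<beta> j - b j"] by (intro mult_left_mono) auto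
    also have "\<dots> \<le> n * (?G \<beta> - ?G b)" by (rule emp_risk_quadratic_growth[OF n c(2) b that])
    finally show ?thesis using n by simp
  qed
  define z where "z = (\<lambda>j\<in>{..<p n}. 0 :: real)"
  have z: "z \<in> vecs (p n)" by (simp add: z_def)
  have Gz: "?G z = 1 / n * (\<Sum>i<n. \<rho> (\<epsilon> n i \<omega>))" by (simp add: emp_risk_def z_def)
  have Gb: "0 \<le> ?G b" unfolding emp_risk_def by (intro mult_nonneg_nonneg sum_nonneg \<rho>) auto
  have "vnorm (p n) (\<lambda>j. z j - b j) = vnorm (p n) b" by (simp add: L2_set_def z_def)
  then have 1: "2 * c * \<mu> * (vnorm (p n) b)\<^sup>2 \<le> ?G z" using growth[OF z] Gb by simp
  have b'v: "b' \<in> vecs (p n)" and bv: "b \<in> vecs (p n)" using b b' by (auto simp: is_arg_min_def)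
  have "ridge_risk \<rho> p X \<epsilon> \<tau> n \<omega> b' \<le> ridge_risk \<rho> p X \<epsilon> \<tau> n \<omega> b"
    using b' bv unfolding is_arg_min_def by (meson not_less)
  moreover have "0 \<le> \<tau> / 2 * (vnorm (p n) b')\<^sup>2" using \<tau> by simp
  ultimately have "?G b' - ?G b \<le> \<tau> / 2 * (vnorm (p n) b)\<^sup>2" by (simp add: ridge_risk_def)
  then have "2 * c * \<mu> * (vnorm (p n) (\<lambda>j. b' j - b j))\<^sup>2 \<le> \<tau> / 2 * (vnorm (p n) b)\<^sup>2"
    using growth[OF b'v] by linarith
  also have "\<dots> \<le> \<tau> * (?G z / (2 * c * \<mu>))"
  proof -
    have "(vnorm (p n) b)\<^sup>2 \<le> ?G z / (2 * c * \<mu>)" using 1 a by (simp add: pos_le_divide_eq mult.commute)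
    moreover have "0 \<le> (vnorm (p n) b)\<^sup>2" by simp
    ultimately show ?thesis using \<tau> by (intro mult_mono) auto
  qed
  finally have "(vnorm (p n) (\<lambda>j. b' j - b j))\<^sup>2 \<le> \<tau> * (?G z / (2 * c * \<mu>)) / (2 * c * \<mu>)"
    using a by (simp only: pos_le_divide_eq mult.commute)
  also have "\<dots> = \<tau> / (2 * c * \<mu>)\<^sup>2 * ?G z" by (simp add: power2_eq_square)
  finally show ?thesis by (simp only: Gz)
qed

theorem theorem6p1:
  fixes M :: "nat \<Rightarrow> 'a measure"
    and p :: "nat \<Rightarrow> nat"
    and X :: "nat \<Rightarrow> nat \<Rightarrow> 'a \<Rightarrow> nat \<Rightarrow> real"
    and \<epsilon> :: "nat \<Rightarrow> nat \<Rightarrow> 'a \<Rightarrow> real"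
    and \<rho> :: "real \<Rightarrow> real"
    and bhat :: "nat \<Rightarrow> 'a \<Rightarrow> nat \<Rightarrow> real"
    and bridge :: "real \<Rightarrow> nat \<Rightarrow> 'a \<Rightarrow> nat \<Rightarrow> real"
  assumes "\<And>n. prob_space (M n)"
    and O1: "proportional_dimension p"
    and O2: "smooth_convex_loss \<rho>"
    and O3: "polynomial_growth_loss \<rho>"
    and O4: "iid_isotropic_design M p X" "convex_concentration M p X"
    and O5: "design_indep_errors M p X \<epsilon>"
    and O6: "bounded_score_moments M \<rho> \<epsilon>"
    and O7: "indep_errors_polylog M \<epsilon>"
    and P1: "iid_entries M p X"
    and F1: "smoothed_unimodal_errors M \<epsilon>"
    and F2: "error_moments M \<epsilon>"
    and "limsup (\<lambda>n. ereal (real (p n) / real n)) < 1"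
    and "strongly_convex \<rho>"
    and "argmin_estimator M p (emp_risk \<rho> p X \<epsilon>) bhat"
    and "\<And>\<tau>. \<tau> > 0 \<Longrightarrow> argmin_estimator M p (ridge_risk \<rho> p X \<epsilon> \<tau>) (bridge \<tau>)"
  shows "(\<forall>\<delta>>0.
            ((\<lambda>\<tau>. limsup (\<lambda>n. ereal (measure (M n)
                {\<omega>\<in>space (M n). vnorm (p n) (\<lambda>j. bridge \<tau> n \<omega> j - bhat n \<omega> j) > \<delta>})))
              \<longlongrightarrow> 0) (at_right 0)) \<and>
         (\<forall>r. (\<forall>\<tau>>0. tendsto_in_prob M (\<lambda>n \<omega>. vnorm (p n) (bridge \<tau> n \<omega>)) (r \<tau>)) \<longrightarrow>
            (\<exists>R. (r \<longlongrightarrow> R) (at_right 0) \<and>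
                 tendsto_in_prob M (\<lambda>n \<omega>. vnorm (p n) (bhat n \<omega>)) R))"
proof -
  have ps: "prob_space (M n)" for n by fact
  note ratio_lt = assms(13) and sc = assms(14) and hat = assms(15) and ridge = assms(16)
  obtain \<kappa> where \<kappa>: "\<kappa> \<noteq> 0" "(\<lambda>n. real (p n) / real n) \<longlonglongrightarrow> \<kappa>"
    using O1 unfolding proportional_dimension_def by blast
  have "0 \<le> \<kappa>" by (rule tendsto_lowerbound[OF \<kappa>(2)]) auto
  then have "0 < \<kappa>" using \<kappa>(1) by simp
  have "limsup (\<lambda>n. ereal (real (p n) / real n)) = ereal \<kappa>"
    using \<kappa>(2) by (intro lim_imp_Limsup) auto
  then have "\<kappa> < 1" using ratio_lt by simp
  obtain \<mu> S where \<mu>: "0 < \<mu>" and S: "\<And>n. S n \<in> sets (M n)"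
    "(\<lambda>n. measure (M n) (space (M n) - S n)) \<longlonglongrightarrow> 0"
    "\<And>n \<omega> v. \<omega> \<in> S n \<Longrightarrow> \<mu> * real n * (\<Sum>j<p n. (v j)\<^sup>2) \<le> (\<Sum>i<n. (\<Sum>j<p n. v j * X n i \<omega> j)\<^sup>2)"
    using smallest_singular_value_linear[OF ps O4 P1 \<kappa>(2) \<open>0 < \<kappa>\<close> \<open>\<kappa> < 1\<close>] by blast
  obtain c where c: "0 < c" "\<And>x y. \<rho> ((x + y) / 2) \<le> (\<rho> x + \<rho> y) / 2 - c * (x - y)\<^sup>2"
    using strongly_convex_midpoint[OF sc] by blast
  have \<rho>: "\<And>x. 0 \<le> \<rho> x" "\<And>x. \<rho> differentiable (at x)"
    using O2 by (auto simp: smooth_convex_loss_def)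
  have [measurable]: "\<rho> \<in> borel_measurable borel"
    using \<rho>(2) by (intro borel_measurable_continuous_onI differentiable_imp_continuous_on)
      (auto simp: differentiable_on_def)
  obtain B where B: "\<And>n i. i < n \<Longrightarrow> integrable (M n) (\<lambda>\<omega>. (deriv \<rho> (\<epsilon> n i \<omega>))\<^sup>2)"
    "\<And>n. 1 / real n * (\<Sum>i<n. expect (M n) (\<lambda>\<omega>. (deriv \<rho> (\<epsilon> n i \<omega>))\<^sup>2)) \<le> B"
    using O6[unfolded bounded_score_moments_def, rule_format, of 1] by auto
  have \<epsilon>: "\<epsilon> n i \<in> borel_measurable (M n)" if "i < n" for n i
    using O7 that ps by (auto simp: indep_errors_polylog_def prob_space.indep_vars_def)
  define G where "G n \<omega> = 1 / real n * (\<Sum>i<n. \<rho> (\<epsilon> n i \<omega>))" for n \<omega>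
  have int_loss: "integrable (M n) (\<lambda>\<omega>. \<rho> (\<epsilon> n i \<omega>))" if "i < n" for n i
  proof (rule Bochner_Integration.integrable_bound)
    show "integrable (M n) (\<lambda>\<omega>. (deriv \<rho> (\<epsilon> n i \<omega>))\<^sup>2 / (2 * c))" using B(1)[OF that] by simp
    show "(\<lambda>\<omega>. \<rho> (\<epsilon> n i \<omega>)) \<in> borel_measurable (M n)" using \<epsilon>[OF that] by measurable
    show "AE \<omega> in M n. norm (\<rho> (\<epsilon> n i \<omega>)) \<le> norm ((deriv \<rho> (\<epsilon> n i \<omega>))\<^sup>2 / (2 * c))"
      using loss_le_score_sq[OF O2 c] \<rho>(1) c(1) by (intro AE_I2) auto
  qed
  have int_G: "integrable (M n) (G n)" for n
    unfolding G_def using int_loss by (intro integrable_mult_right Bochner_Integration.integrable_sum) auto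
  have E_G: "(\<integral>\<omega>. G n \<omega> \<partial>M n) \<le> B / (2 * c)" for n
  proof -
    have "(\<integral>\<omega>. G n \<omega> \<partial>M n) = 1 / real n * (\<Sum>i<n. \<integral>\<omega>. \<rho> (\<epsilon> n i \<omega>) \<partial>M n)"
      unfolding G_def using int_loss by (subst integral_mult_right_zero, subst Bochner_Integration.integral_sum) auto
    also have "\<dots> \<le> 1 / real n * (\<Sum>i<n. expect (M n) (\<lambda>\<omega>. (deriv \<rho> (\<epsilon> n i \<omega>))\<^sup>2) / (2 * c))"
    proof (intro mult_left_mono sum_mono)
      fix i assume "i \<in> {..<n}"
      then have i: "i < n" by simp
      have "(\<integral>\<omega>. \<rho> (\<epsilon> n i \<omega>) \<partial>M n) \<le> (\<integral>\<omega>. (deriv \<rho> (\<epsilon> n i \<omega>))\<^sup>2 / (2 * c) \<partial>M n)"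
        using B(1)[OF i] by (intro integral_mono int_loss i loss_le_score_sq[OF O2 c]) auto
      then show "(\<integral>\<omega>. \<rho> (\<epsilon> n i \<omega>) \<partial>M n) \<le> expect (M n) (\<lambda>\<omega>. (deriv \<rho> (\<epsilon> n i \<omega>))\<^sup>2) / (2 * c)"
        by (simp add: expect_def)
    qed simp
    also have "\<dots> = (1 / real n * (\<Sum>i<n. expect (M n) (\<lambda>\<omega>. (deriv \<rho> (\<epsilon> n i \<omega>))\<^sup>2))) / (2 * c)"
      by (simp add: sum_divide_distrib mult.commute)
    also have "\<dots> \<le> B / (2 * c)" using B(2) c(1) by (intro divide_right_mono) auto
    finally show ?thesis .
  qed
  have G_nonneg: "0 \<le> G n \<omega>" for n \<omega>
    unfolding G_def by (intro mult_nonneg_nonneg sum_nonneg \<rho>(1)) auto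
  \<comment> \<open>The average over the empty sample is 0.\<close>
  have B0: "0 \<le> B" using B(2)[of 0] by simp
  define Q where "Q = B / (2 * c) / (2 * c * \<mu>)\<^sup>2"
  have Q: "0 \<le> Q" using B0 c by (simp add: Q_def)
  let ?s = "\<lambda>n. measure (M n) (space (M n) - S n)"
  let ?d = "\<lambda>\<tau> n \<omega>. vnorm (p n) (\<lambda>j. bridge \<tau> n \<omega> j - bhat n \<omega> j)"
  have dist: "measure (M n) {\<omega> \<in> space (M n). ?d \<tau> n \<omega> > \<delta>} \<le> ?s n + Q * \<tau> / \<delta>\<^sup>2"
    and norm_dist: "measure (M n) {\<omega> \<in> space (M n). \<bar>vnorm (p n) (bridge \<tau> n \<omega>) - vnorm (p n) (bhat n \<omega>)\<bar> > \<delta>}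
      \<le> ?s n + Q * \<tau> / \<delta>\<^sup>2"
    if \<tau>: "0 < \<tau>" and \<delta>: "0 < \<delta>" and n: "0 < n" for \<tau> \<delta> n
  proof -
    interpret prob_space "M n" by (rule ps)
    \<comment> \<open>On \<open>S n\<close> a distance above \<open>\<delta>\<close> forces the
      average loss \<open>G n\<close> to reach this level; Markov's inequality for
      \<open>G n\<close> at \<open>a\<close> produces the term
      \<open>Q * \<tau> / \<delta>^2\<close>.\<close>
    define a where "a = \<delta>\<^sup>2 * (2 * c * \<mu>)\<^sup>2 / \<tau>"
    have a: "0 < a" using \<tau> \<delta> c(1) \<mu> by (simp add: a_def)
    let ?T = "{\<omega> \<in> space (M n). a \<le> G n \<omega>}"
    have [measurable]: "G n \<in> borel_measurable (M n)" using int_G by auto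
    have [measurable]: "S n \<in> sets (M n)" by (rule S)
    have sub: "{\<omega> \<in> space (M n). ?d \<tau> n \<omega> > \<delta>} \<subseteq> (space (M n) - S n) \<union> ?T"
    proof safe
      fix \<omega> assume \<omega>: "\<omega> \<in> space (M n)" "?d \<tau> n \<omega> > \<delta>" "\<omega> \<in> S n"
      have am: "is_arg_min (emp_risk \<rho> p X \<epsilon> n \<omega>) (\<lambda>\<beta>. \<beta> \<in> vecs (p n)) (bhat n \<omega>)"
        "is_arg_min (ridge_risk \<rho> p X \<epsilon> \<tau> n \<omega>) (\<lambda>\<beta>. \<beta> \<in> vecs (p n)) (bridge \<tau> n \<omega>)"
        using hat ridge[OF \<tau>] \<omega>(1) by (auto simp: argmin_estimator_def)
      have "\<delta>\<^sup>2 \<le> (?d \<tau> n \<omega>)\<^sup>2" using \<omega>(2) \<delta> by (intro power_mono) auto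
      also have "\<dots> \<le> \<tau> / (2 * c * \<mu>)\<^sup>2 * G n \<omega>"
        unfolding G_def by (rule ridge_estimator_distance[OF n \<tau> c \<rho>(1) am \<mu> S(3)[OF \<omega>(3)]])
      finally show "a \<le> G n \<omega>" using \<tau> c(1) \<mu> by (simp add: a_def field_simps)
    qed
    have "prob {\<omega> \<in> space (M n). ?d \<tau> n \<omega> > \<delta>} \<le> prob ((space (M n) - S n) \<union> ?T)"
      by (rule finite_measure_mono[OF sub]) measurable
    also have "\<dots> \<le> ?s n + prob ?T" by (rule measure_Un_le) measurable
    also have "prob ?T \<le> (\<integral>\<omega>. G n \<omega> \<partial>M n) / a"
      using G_nonneg a by (intro integral_Markov_inequality_measure[OF int_G]) auto
    also have "\<dots> \<le> (B / (2 * c)) / a" using E_G a by (intro divide_right_mono) auto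
    also have "\<dots> = Q * \<tau> / \<delta>\<^sup>2" by (simp add: Q_def a_def)
    finally show 1: "prob {\<omega> \<in> space (M n). ?d \<tau> n \<omega> > \<delta>} \<le> ?s n + Q * \<tau> / \<delta>\<^sup>2" by simp
    have [measurable]: "(\<lambda>\<omega>. bhat n \<omega> j) \<in> borel_measurable (M n)"
      "(\<lambda>\<omega>. bridge \<tau> n \<omega> j) \<in> borel_measurable (M n)" if "j \<in> {..<p n}" for j
    proof -
      have b: "bhat n \<in> measurable (M n) (vec_borel (p n))" "bridge \<tau> n \<in> measurable (M n) (vec_borel (p n))"
        using hat ridge[OF \<tau>] by (simp_all add: argmin_estimator_def)
      show "(\<lambda>\<omega>. bhat n \<omega> j) \<in> borel_measurable (M n)" "(\<lambda>\<omega>. bridge \<tau> n \<omega> j) \<in> borel_measurable (M n)"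
        using measurable_compose[OF b(1) measurable_component_singleton[OF that]]
          measurable_compose[OF b(2) measurable_component_singleton[OF that]] by simp_all
    qed
    have [measurable]: "?d \<tau> n \<in> borel_measurable (M n)" unfolding L2_set_def by measurable
    have "prob {\<omega> \<in> space (M n). \<bar>vnorm (p n) (bridge \<tau> n \<omega>) - vnorm (p n) (bhat n \<omega>)\<bar> > \<delta>} \<le>
      prob {\<omega> \<in> space (M n). ?d \<tau> n \<omega> > \<delta>}"
    proof (rule finite_measure_mono)
      show "{\<omega> \<in> space (M n). \<bar>vnorm (p n) (bridge \<tau> n \<omega>) - vnorm (p n) (bhat n \<omega>)\<bar> > \<delta>} \<subseteq>
          {\<omega> \<in> space (M n). ?d \<tau> n \<omega> > \<delta>}"
        using vnorm_diff_ge by (auto intro: order.strict_trans2)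
    qed measurable
    with 1 show "prob {\<omega> \<in> space (M n). \<bar>vnorm (p n) (bridge \<tau> n \<omega>) - vnorm (p n) (bhat n \<omega>)\<bar> > \<delta>}
      \<le> ?s n + Q * \<tau> / \<delta>\<^sup>2" by linarith
  qed
  show ?thesis
  proof (intro conjI allI impI)
    fix \<delta> :: real assume \<delta>: "0 < \<delta>"
    show "((\<lambda>\<tau>. limsup (\<lambda>n. ereal (measure (M n) {\<omega> \<in> space (M n). ?d \<tau> n \<omega> > \<delta>}))) \<longlongrightarrow> 0) (at_right 0)"
      using dist[OF _ \<delta>] by (intro limsup_tendsto_zero[OF S(2), where Q = "Q / \<delta>\<^sup>2"]) auto
  next
    fix r assume "\<forall>\<tau>>0. tendsto_in_prob M (\<lambda>n \<omega>. vnorm (p n) (bridge \<tau> n \<omega>)) (r \<tau>)"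
    then show "\<exists>R. (r \<longlongrightarrow> R) (at_right 0) \<and> tendsto_in_prob M (\<lambda>n \<omega>. vnorm (p n) (bhat n \<omega>)) R"
      by (intro limits_exchange[OF ps argmin_estimator_norm_measurable[OF ridge]
          argmin_estimator_norm_measurable[OF hat] S(2) norm_dist Q]) auto
  qed
qed

end
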